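(* Let $c(z)=\sum_{n\le0}c_nz^{-n-2}$, $c'(z)=\sum_{n\le0}c'_nz^{-n-2}\in\mathbb C((z))$, $\lambda,\lambda'\in\mathbb C^*$ and $\mu,\mu'\in\mathbb C$. (a) The Whittaker module $$V_{\widehat{\mathfrak{sl}_2}}(\lambda,\mu,-2,c(z))=V_{\widehat{\mathfrak{sl}_2}}(\lambda,\mu,-2)/\langle(T(n)-c_n)w_{\lambda,\mu,-2}\mid n\le0\rangle$$ is a simple $\widehat{\mathfrak{sl}_2}$-module. (b) Any simple quotient of $V_{\widehat{\mathfrak{sl}_2}}(\lambda,\mu,-2)$ is of the form $V_{\widehat{\mathfrak{sl}_2}}(\lambda,\mu,-2,c(z))$ for some $c(z)=\sum_{n\le 0}c_nz^{-n-2}$. (c) $V_{\widehat{\mathfrak{sl}_2}}(\lambda,\mu,-2,c(z))\cong V_{\widehat{\mathfrak{sl}_2}}(\lambda',\mu',-2,c'(z))$ if and only if $\lambda=\lambda'$, $\mu=\mu'$ and $c(z)=c'(z)$.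
   Context: $\mathfrak{sl}_2$ has basis $e,f,h$ with $[e,f]=h$, $[h,e]=2e$, $[h,f]=-2f$ and form $(e,f)=1$, $(h,h)=2$ (other pairings zero). $\widehat{\mathfrak{sl}_2}=\mathfrak{sl}_2\otimes\mathbb C[t,t^{-1}]\oplus\mathbb Cc$, $c$ central, $x(n)=x\otimes t^n$, $[x(n),y(m)]=[x,y](n+m)+n(x,y)\delta_{n+m,0}c$. The universal Whittaker module of level $-2$ is $V_{\widehat{\mathfrak{sl}_2}}(\lambda,\mu,-2)=U(\widehat{\mathfrak{sl}_2})/J$, where $J$ is the left ideal generated by $e(0)-\lambda$, $f(1)-\mu$, $c+2$, $e(i),h(i),f(i+1)$ $(i\ge1)$; $w_{\lambda,\mu,-2}$ is the image of $1$. On it act the operators $$T(n)=\tfrac12\sum_{k\in\mathbb Z}\left(:e(k)f(n-k):+:f(k)e(n-k):+\tfrac12:h(k)h(n-k):\right),\quad n\in\mathbb Z,$$ where $:x(k)y(m):=x(k)y(m)$ if $k<0$ and $y(m)x(k)$ if $k\ge0$; at level $-2$ they commute with $\widehat{\mathfrak{sl}_2}$. $\langle\cdot\rangle$ denotes the submodule generated. *)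

theory Defs
  imports
    Complex_Main
    "HOL-Library.Poly_Mapping"
    "HOL-Computational_Algebra.Formal_Laurent_Series"
    "HOL-Algebra.Algebraic_Closure_Type"
begin

section \<open>The affine Lie algebra\<close>

text \<open>A complex vector space with a given basis is rendered as the type
  \<open>'b \<Rightarrow>\<^sub>0 complex\<close> of finitely supported coefficient functions on its basis \<open>'b\<close>.\<close>

definition scale_pm :: "complex \<Rightarrow> ('b \<Rightarrow>\<^sub>0 complex) \<Rightarrow> ('b \<Rightarrow>\<^sub>0 complex)" where
  "scale_pm r x = Poly_Mapping.map ((*) r) x"

definition bilinear_ext ::
    "('b \<Rightarrow> 'b \<Rightarrow> 'b \<Rightarrow>\<^sub>0 complex) \<Rightarrow> ('b \<Rightarrow>\<^sub>0 complex) \<Rightarrow> ('b \<Rightarrow>\<^sub>0 complex) \<Rightarrow> ('b \<Rightarrow>\<^sub>0 complex)" where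
  "bilinear_ext b x y =
     (\<Sum>i\<in>Poly_Mapping.keys x. \<Sum>j\<in>Poly_Mapping.keys y.
        scale_pm (Poly_Mapping.lookup x i * Poly_Mapping.lookup y j) (b i j))"

datatype sl2_basis = sl2_e | sl2_f | sl2_h

fun sl2_bracket :: "sl2_basis \<Rightarrow> sl2_basis \<Rightarrow> (sl2_basis \<Rightarrow>\<^sub>0 complex)" where
  "sl2_bracket sl2_e sl2_f = Poly_Mapping.single sl2_h 1"
| "sl2_bracket sl2_f sl2_e = Poly_Mapping.single sl2_h (-1)"
| "sl2_bracket sl2_h sl2_e = Poly_Mapping.single sl2_e 2"
| "sl2_bracket sl2_e sl2_h = Poly_Mapping.single sl2_e (-2)"
| "sl2_bracket sl2_h sl2_f = Poly_Mapping.single sl2_f (-2)"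
| "sl2_bracket sl2_f sl2_h = Poly_Mapping.single sl2_f 2"
| "sl2_bracket sl2_e sl2_e = 0"
| "sl2_bracket sl2_f sl2_f = 0"
| "sl2_bracket sl2_h sl2_h = 0"

fun sl2_form :: "sl2_basis \<Rightarrow> sl2_basis \<Rightarrow> complex" where
  "sl2_form sl2_e sl2_f = 1"
| "sl2_form sl2_f sl2_e = 1"
| "sl2_form sl2_h sl2_h = 2"
| "sl2_form _ _ = 0"

text \<open>\<open>Loop x n\<close> is the basis vector \<open>x \<otimes> t^n\<close>.\<close>

datatype affine_basis = Loop sl2_basis int | Central

type_synonym affine_sl2 = "affine_basis \<Rightarrow>\<^sub>0 complex"

definition loop_embed :: "(sl2_basis \<Rightarrow>\<^sub>0 complex) \<Rightarrow> int \<Rightarrow> affine_sl2" where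
  "loop_embed x n = (\<Sum>i\<in>Poly_Mapping.keys x. Poly_Mapping.single (Loop i n) (Poly_Mapping.lookup x i))"

fun affine_bracket_basis :: "affine_basis \<Rightarrow> affine_basis \<Rightarrow> affine_sl2" where
  "affine_bracket_basis (Loop x n) (Loop y m) =
     loop_embed (sl2_bracket x y) (n + m) +
     Poly_Mapping.single Central (if n + m = 0 then of_int n * sl2_form x y else 0)"
| "affine_bracket_basis _ _ = 0"

definition affine_bracket :: "affine_sl2 \<Rightarrow> affine_sl2 \<Rightarrow> affine_sl2" where
  "affine_bracket = bilinear_ext affine_bracket_basis"

definition e_at :: "int \<Rightarrow> affine_sl2" where "e_at n = Poly_Mapping.single (Loop sl2_e n) 1"
definition f_at :: "int \<Rightarrow> affine_sl2" where "f_at n = Poly_Mapping.single (Loop sl2_f n) 1"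
definition h_at :: "int \<Rightarrow> affine_sl2" where "h_at n = Poly_Mapping.single (Loop sl2_h n) 1"
definition central :: affine_sl2 where "central = Poly_Mapping.single Central 1"


section \<open>The universal enveloping algebra\<close>

text \<open>The tensor algebra of a vector space with basis \<open>'b\<close> is the free associative algebra on
  \<open>'b\<close>, that is, the monoid algebra of the free monoid on \<open>'b\<close>. The product of
  \<open>\<Rightarrow>\<^sub>0\<close> is convolution with respect to the additively written monoid of its keys, so the
  free monoid (lists under concatenation) is written additively.\<close>

datatype 'b free_mon = Word "'b list"

instantiation free_mon :: (type) monoid_add
begin
definition zero_free_mon :: "'a free_mon" where "0 = Word []"
fun plus_free_mon :: "'a free_mon \<Rightarrow> 'a free_mon \<Rightarrow> 'a free_mon" where
  "Word u + Word v = Word (u @ v)"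
instance
proof
  fix a b c :: "'a free_mon"
  show "a + b + c = a + (b + c)" by (cases a; cases b; cases c) simp
  show "0 + a = a" by (cases a) (simp add: zero_free_mon_def)
  show "a + 0 = a" by (cases a) (simp add: zero_free_mon_def)
qed
end

type_synonym affine_tensor = "affine_basis free_mon \<Rightarrow>\<^sub>0 complex"

definition tensor_incl :: "affine_sl2 \<Rightarrow> affine_tensor" where
  "tensor_incl x = (\<Sum>i\<in>Poly_Mapping.keys x. Poly_Mapping.single (Word [i]) (Poly_Mapping.lookup x i))"

definition left_ideal :: "'a::ring_1 set \<Rightarrow> bool" where
  "left_ideal I \<longleftrightarrow> 0 \<in> I \<and> (\<forall>x\<in>I. \<forall>y\<in>I. x + y \<in> I) \<and> (\<forall>a. \<forall>x\<in>I. a * x \<in> I)"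

definition two_sided_ideal :: "'a::ring_1 set \<Rightarrow> bool" where
  "two_sided_ideal I \<longleftrightarrow> left_ideal I \<and> (\<forall>a. \<forall>x\<in>I. x * a \<in> I)"

definition uea_relations :: "affine_tensor set" where
  "uea_relations =
     {tensor_incl x * tensor_incl y - tensor_incl y * tensor_incl x - tensor_incl (affine_bracket x y)
      | x y. True}"

definition uea_ideal :: "affine_tensor set" where
  "uea_ideal = two_sided_ideal hull uea_relations"

lemma two_sided_ideal_uea_ideal: "two_sided_ideal uea_ideal"
  unfolding uea_ideal_def
  by (rule hull_in) (auto simp: two_sided_ideal_def left_ideal_def)

lemma uea_ideal_0: "0 \<in> uea_ideal"
  and uea_ideal_add: "x \<in> uea_ideal \<Longrightarrow> y \<in> uea_ideal \<Longrightarrow> x + y \<in> uea_ideal"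
  and uea_ideal_lmult: "x \<in> uea_ideal \<Longrightarrow> a * x \<in> uea_ideal"
  and uea_ideal_rmult: "x \<in> uea_ideal \<Longrightarrow> x * a \<in> uea_ideal"
  using two_sided_ideal_uea_ideal by (auto simp: two_sided_ideal_def left_ideal_def)

lemma uea_ideal_uminus: "x \<in> uea_ideal \<Longrightarrow> - x \<in> uea_ideal"
  using uea_ideal_lmult[of x "- 1"] by simp

lemma uea_ideal_minus_commute: "x - y \<in> uea_ideal \<Longrightarrow> y - x \<in> uea_ideal"
  using uea_ideal_uminus[of "x - y"] by simp

lemma lookup_mult_zero:
  "Poly_Mapping.lookup (p * q) 0 = Poly_Mapping.lookup p 0 * Poly_Mapping.lookup q 0"
  for p q :: "'b free_mon \<Rightarrow>\<^sub>0 complex"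
proof -
  have sum0: "0 = l + k \<longleftrightarrow> l = 0 \<and> k = 0" for l k :: "'b free_mon"
    by (cases l; cases k) (auto simp: zero_free_mon_def)
  have inner: "Sum_any (\<lambda>k. Poly_Mapping.lookup q k when 0 = l + k) = (Poly_Mapping.lookup q 0 when l = 0)"
    for l :: "'b free_mon"
  proof -
    have "(\<lambda>k. (Poly_Mapping.lookup q k when (0 = l + k))) =
          (\<lambda>k. (Poly_Mapping.lookup q 0 when l = 0) when k = 0)"
      by (rule ext) (simp add: sum0 when_def)
    then show ?thesis by (simp only: Sum_any_when_equal)
  qed
  have "Poly_Mapping.lookup (p * q) 0 =
        Sum_any (\<lambda>l. Poly_Mapping.lookup p l * (Poly_Mapping.lookup q 0 when l = 0))"
    by (simp only: times_poly_mapping.rep_eq prod_fun_def inner)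
  also have "\<dots> = Sum_any (\<lambda>l :: 'b free_mon. Poly_Mapping.lookup p 0 * Poly_Mapping.lookup q 0 when l = 0)"
    by (rule Sum_any.cong) (simp add: when_def)
  finally show ?thesis by simp
qed

lemma lookup_tensor_incl_zero: "Poly_Mapping.lookup (tensor_incl x) 0 = 0"
  by (simp add: tensor_incl_def lookup_sum lookup_single zero_free_mon_def when_def)

lemma uea_ideal_augmentation: "p \<in> uea_ideal \<Longrightarrow> Poly_Mapping.lookup p 0 = 0"
proof -
  have "uea_ideal \<subseteq> {p. Poly_Mapping.lookup p 0 = 0}"
    unfolding uea_ideal_def
    by (rule hull_minimal)
      (auto simp: uea_relations_def two_sided_ideal_def left_ideal_def lookup_mult_zero
        lookup_add lookup_minus lookup_tensor_incl_zero)
  then show "p \<in> uea_ideal \<Longrightarrow> Poly_Mapping.lookup p 0 = 0" by auto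
qed

quotient_type affine_uea = affine_tensor / "\<lambda>p q. p - q \<in> uea_ideal"
proof (rule equivpI)
  show "reflp (\<lambda>p q. p - q \<in> uea_ideal)"
    by (simp add: reflp_def uea_ideal_0)
  show "symp (\<lambda>p q. p - q \<in> uea_ideal)"
    by (simp add: symp_def uea_ideal_minus_commute)
  show "transp (\<lambda>p q. p - q \<in> uea_ideal)"
  proof (rule transpI)
    fix x y z assume "x - y \<in> uea_ideal" "y - z \<in> uea_ideal"
    from uea_ideal_add[OF this] show "x - z \<in> uea_ideal" by simp
  qed
qed

instantiation affine_uea :: ring_1
begin

lift_definition zero_affine_uea :: affine_uea is 0 .

lift_definition one_affine_uea :: affine_uea is 1 .

lift_definition plus_affine_uea :: "affine_uea \<Rightarrow> affine_uea \<Rightarrow> affine_uea" is "(+)"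
  using uea_ideal_add by (metis add_diff_add)

lift_definition uminus_affine_uea :: "affine_uea \<Rightarrow> affine_uea" is uminus
  using uea_ideal_uminus by fastforce

lift_definition minus_affine_uea :: "affine_uea \<Rightarrow> affine_uea \<Rightarrow> affine_uea" is "(-)"
proof -
  fix a b c d :: affine_tensor
  assume "a - b \<in> uea_ideal" "c - d \<in> uea_ideal"
  from uea_ideal_add[OF this(1) uea_ideal_uminus[OF this(2)]]
  show "a - c - (b - d) \<in> uea_ideal" by (simp add: algebra_simps)
qed

lift_definition times_affine_uea :: "affine_uea \<Rightarrow> affine_uea \<Rightarrow> affine_uea" is "(*)"
proof -
  fix a b c d :: affine_tensor
  assume ab: "a - b \<in> uea_ideal" and cd: "c - d \<in> uea_ideal"
  have "a * c - b * d = (a - b) * c + b * (c - d)" by (simp add: algebra_simps)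
  with uea_ideal_add[OF uea_ideal_rmult[OF ab] uea_ideal_lmult[OF cd]]
  show "a * c - b * d \<in> uea_ideal" by simp
qed

instance
proof
  show "(0 :: affine_uea) \<noteq> 1"
  proof (transfer, rule notI)
    assume "(0 :: affine_tensor) - 1 \<in> uea_ideal"
    from uea_ideal_augmentation[OF this] show False by (simp add: lookup_minus)
  qed
qed (transfer; simp add: algebra_simps uea_ideal_0)+

end

lift_definition uea_scalar :: "complex \<Rightarrow> affine_uea" is "\<lambda>r. Poly_Mapping.single 0 r" .

lift_definition uea_incl :: "affine_sl2 \<Rightarrow> affine_uea" is tensor_incl .


section \<open>Modules over the affine Lie algebra\<close>

text \<open>Of the fields inherited from rings, a module uses only the carrier, zero and addition; the
  ring multiplication and unit are irrelevant.\<close>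

record 'v affine_module = "(complex, 'v) module" +
  act :: "affine_sl2 \<Rightarrow> 'v \<Rightarrow> 'v"

abbreviation complex_ring :: "complex ring" where
  "complex_ring \<equiv> ring_of_type_algebra"

definition is_affine_module :: "'v affine_module \<Rightarrow> bool" where
  "is_affine_module M \<longleftrightarrow>
     Module.module complex_ring M \<and>
     (\<forall>x. \<forall>v\<in>carrier M. act M x v \<in> carrier M) \<and>
     (\<forall>x. \<forall>v\<in>carrier M. \<forall>w\<in>carrier M. act M x (v \<oplus>\<^bsub>M\<^esub> w) = act M x v \<oplus>\<^bsub>M\<^esub> act M x w) \<and>
     (\<forall>x r. \<forall>v\<in>carrier M. act M x (r \<odot>\<^bsub>M\<^esub> v) = r \<odot>\<^bsub>M\<^esub> act M x v) \<and>
     (\<forall>x y. \<forall>v\<in>carrier M. act M (x + y) v = act M x v \<oplus>\<^bsub>M\<^esub> act M y v) \<and>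
     (\<forall>x r. \<forall>v\<in>carrier M. act M (scale_pm r x) v = r \<odot>\<^bsub>M\<^esub> act M x v) \<and>
     (\<forall>x y. \<forall>v\<in>carrier M.
        act M (affine_bracket x y) v = act M x (act M y v) \<ominus>\<^bsub>M\<^esub> act M y (act M x v))"

definition is_submodule :: "'v affine_module \<Rightarrow> 'v set \<Rightarrow> bool" where
  "is_submodule M N \<longleftrightarrow> submodule N complex_ring M \<and> (\<forall>x. \<forall>v\<in>N. act M x v \<in> N)"

definition generated_submodule :: "'v affine_module \<Rightarrow> 'v set \<Rightarrow> 'v set" where
  "generated_submodule M S = is_submodule M hull S"

definition quotient_module :: "'v affine_module \<Rightarrow> 'v set \<Rightarrow> 'v set affine_module" where
  "quotient_module M N =
     \<lparr>carrier = a_rcosets\<^bsub>M\<^esub> N, monoid.mult = undefined, one = undefined,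
      ring.zero = N, add = set_add M,
      module.smult = (\<lambda>r A. \<Union>v\<in>A. (N +>\<^bsub>M\<^esub> (r \<odot>\<^bsub>M\<^esub> v))),
      act = (\<lambda>x A. \<Union>v\<in>A. (N +>\<^bsub>M\<^esub> act M x v))\<rparr>"

definition simple_module :: "'v affine_module \<Rightarrow> bool" where
  "simple_module M \<longleftrightarrow>
     is_affine_module M \<and> carrier M \<noteq> {\<zero>\<^bsub>M\<^esub>} \<and>
     (\<forall>N. is_submodule M N \<longrightarrow> N = {\<zero>\<^bsub>M\<^esub>} \<or> N = carrier M)"

definition module_iso :: "'v affine_module \<Rightarrow> 'w affine_module \<Rightarrow> bool" where
  "module_iso M M' \<longleftrightarrow>
     (\<exists>\<phi>. bij_betw \<phi> (carrier M) (carrier M') \<and>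
        (\<forall>v\<in>carrier M. \<forall>w\<in>carrier M. \<phi> (v \<oplus>\<^bsub>M\<^esub> w) = \<phi> v \<oplus>\<^bsub>M'\<^esub> \<phi> w) \<and>
        (\<forall>r. \<forall>v\<in>carrier M. \<phi> (r \<odot>\<^bsub>M\<^esub> v) = r \<odot>\<^bsub>M'\<^esub> \<phi> v) \<and>
        (\<forall>x. \<forall>v\<in>carrier M. \<phi> (act M x v) = act M' x (\<phi> v)))"

definition uea_module :: "affine_uea affine_module" where
  "uea_module =
     \<lparr>carrier = UNIV, monoid.mult = (*), one = 1, ring.zero = 0, add = (+),
      module.smult = (\<lambda>r u. uea_scalar r * u), act = (\<lambda>x u. uea_incl x * u)\<rparr>"


section \<open>Whittaker modules of level -2\<close>

definition whittaker_ideal :: "complex \<Rightarrow> complex \<Rightarrow> affine_uea set" where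
  "whittaker_ideal lam mu = left_ideal hull
     ({uea_incl (e_at 0) - uea_scalar lam, uea_incl (f_at 1) - uea_scalar mu,
       uea_incl central + uea_scalar 2} \<union>
      {uea_incl (e_at i) | i. i \<ge> 1} \<union> {uea_incl (h_at i) | i. i \<ge> 1} \<union>
      {uea_incl (f_at (i + 1)) | i. i \<ge> 1})"

definition universal_whittaker :: "complex \<Rightarrow> complex \<Rightarrow> affine_uea set affine_module" where
  "universal_whittaker lam mu = quotient_module uea_module (whittaker_ideal lam mu)"

definition whittaker_vector :: "complex \<Rightarrow> complex \<Rightarrow> affine_uea set" where
  "whittaker_vector lam mu = whittaker_ideal lam mu +>\<^bsub>uea_module\<^esub> 1"

text \<open>\<open>normal_ordered M x k y m v\<close> is \<open>:x(k)y(m): v\<close> for \<open>x\<close>, \<open>y\<close> given as families of modes.\<close>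

definition normal_ordered ::
    "'v affine_module \<Rightarrow> (int \<Rightarrow> affine_sl2) \<Rightarrow> int \<Rightarrow> (int \<Rightarrow> affine_sl2) \<Rightarrow> int \<Rightarrow> 'v \<Rightarrow> 'v" where
  "normal_ordered M x k y m v =
     (if k < 0 then act M (x k) (act M (y m) v) else act M (y m) (act M (x k) v))"

definition sugawara_term :: "'v affine_module \<Rightarrow> int \<Rightarrow> 'v \<Rightarrow> int \<Rightarrow> 'v" where
  "sugawara_term M n v k =
     normal_ordered M e_at k f_at (n - k) v \<oplus>\<^bsub>M\<^esub>
     normal_ordered M f_at k e_at (n - k) v \<oplus>\<^bsub>M\<^esub>
     (1/2) \<odot>\<^bsub>M\<^esub> normal_ordered M h_at k h_at (n - k) v"

text \<open>The sum over all \<open>k\<close> is taken over its support. This is finite on the universal Whittaker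
  module, where every vector is annihilated by all \<open>x(k)\<close> with \<open>k\<close> large.\<close>

definition sugawara :: "'v affine_module \<Rightarrow> int \<Rightarrow> 'v \<Rightarrow> 'v" where
  "sugawara M n v =
     (1/2) \<odot>\<^bsub>M\<^esub> (\<Oplus>\<^bsub>M\<^esub>k\<in>{k. sugawara_term M n v k \<noteq> \<zero>\<^bsub>M\<^esub>}. sugawara_term M n v k)"

text \<open>\<open>c(z) = \<Sum>\<^bsub>n\<le>0\<^esub> c\<^sub>n z^(-n-2)\<close>, so \<open>c\<^sub>n\<close> is the coefficient of \<open>z^(-n-2)\<close>, and the series of
  this shape are those without terms below \<open>z^(-2)\<close>.\<close>

definition mode_coeff :: "complex fls \<Rightarrow> int \<Rightarrow> complex" where
  "mode_coeff c n = fls_nth c (- n - 2)"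

definition nonpositive_modes :: "complex fls \<Rightarrow> bool" where
  "nonpositive_modes c \<longleftrightarrow> (\<forall>n>0. mode_coeff c n = 0)"

definition whittaker_module :: "complex \<Rightarrow> complex \<Rightarrow> complex fls \<Rightarrow> affine_uea set set affine_module" where
  "whittaker_module lam mu c =
     (let V = universal_whittaker lam mu; w = whittaker_vector lam mu
      in quotient_module V
           (generated_submodule V {sugawara V n w \<ominus>\<^bsub>V\<^esub> mode_coeff c n \<odot>\<^bsub>V\<^esub> w | n. n \<le> 0}))"

end

theory Submission
  imports Defs
    "HOL-Library.Multiset"
    "HOL-Library.Countable"
    "HOL-Computational_Algebra.Fundamental_Theorem_Algebra"
    "HOL-Analysis.Continuum_Not_Denumerable"
begin

text \<open>Every module in the statement is a quotient \<open>U/L\<close> of the enveloping algebra by a left ideal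
  containing the Whittaker ideal \<open>J\<close>, and it is simple exactly when \<open>L\<close> is a maximal left ideal
  (\<open>presents_simple_iff\<close>). So the theorem is about left ideals of \<open>U\<close>. Write \<open>w\<close> for the class of 1.

  The level \<open>-2\<close> is critical: the commutators of the operators \<open>T(n)\<close> with \<open>e(m)\<close> and \<open>f(m)\<close> telescope to
  \<open>(4m + 2mc)\<close> times \<open>e(m+n)\<close> or \<open>f(m+n)\<close>, which vanishes for \<open>c = -2\<close> (\<open>sugawara_commutator\<close>). Hence, if
  \<open>t(n)\<close> in \<open>U\<close> represents \<open>T(n)w\<close>, the operator \<open>T(n)\<close> is right multiplication by \<open>t(n)\<close> on every quotient
  \<open>U/L\<close>, and right multiplication by \<open>t(n)\<close> preserves \<open>L\<close>. Modulo \<open>J\<close>, \<open>t(1)\<close> is the scalar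
  \<open>\<lambda>\<mu>\<close>, and for \<open>n \<le> 0\<close> it is \<open>\<lambda>f(n)\<close> plus terms without \<open>f(k)\<close>, \<open>k \<le> n\<close>. As \<open>\<lambda> \<noteq> 0\<close>, every
  \<open>f(n)\<close> can be traded for \<open>t(n)\<close>: \<open>U/J\<close> is spanned by the \<open>h\<^sub>K e\<^sub>A p(t) w\<close>, with \<open>h\<^sub>K\<close> a monomial in
  the \<open>h(-j)\<close>, \<open>j \<ge> 0\<close>, \<open>e\<^sub>A\<close> a monomial in the \<open>e(-a)\<close>, \<open>a \<ge> 1\<close>, and \<open>p(t)\<close> a polynomial in the
  central operators (\<open>left_ideal_spanned\<close>). In the quotient by \<open>T(n) = c\<^sub>n\<close> the polynomials become scalars.

  Maximality comes from the subalgebra spanned by the \<open>e(n)\<close> and \<open>h(n)\<close> alone. On Whittaker vectors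
  \<open>[h(-j), e(j)]\<close> and \<open>[h(a), e(-a)]\<close> act by \<open>2\<lambda>\<close>, so that \<open>e(j)\<close> differentiates
  by \<open>h(-j)\<close> and \<open>h(a)\<close> by \<open>e(-a)\<close>, up to terms of a smaller order. Therefore some product of lowering operators
  carries a combination of the \<open>h\<^sub>K e\<^sub>A\<close> to a nonzero multiple of one of its coefficients (\<open>lowering\<close>);
  when the coefficients are scalars, 1 is reached.

  The quotient is not zero because the \<open>t(n)\<close>, \<open>n \<le> 0\<close>, are
  algebraically independent on \<open>w\<close>. The affine algebra is the direct sum of the
  subalgebra of creation operators and the subalgebra on which the Whittaker character is defined,
  so \<open>U/J\<close> maps to every module over the former (\<open>lie_splitting\<close>). On a
  polynomial ring where \<open>f(-m)\<close> multiplies by the variable \<open>X\<^sub>m\<close>, a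
  monomial of degree \<open>k\<close> in the \<open>t(-m)\<close> has the leading term
  \<open>\<lambda>\<^sup>k\<close> times the same monomial in the \<open>X\<^sub>m\<close>
  (\<open>tau_injective\<close>). If 1 were in the ideal of \<open>T(n) = c\<^sub>n\<close>, then by
  \<open>lowering\<close> the constant polynomial 1 would vanish at \<open>c\<close>
  (\<open>central_ideal_proper\<close>).

  For a simple quotient, each \<open>t(n)\<close> acts as a scalar by Dixmier's form of the lemma of Schur, since \<open>U\<close> has
  countable dimension (\<open>schur_scalar\<close>); then the maximal ideal of these scalars is contained in \<open>L\<close> and equals it.
  An isomorphism commutes with all \<open>T(n)\<close>, which gives \<open>c\<^sub>n\<close> for \<open>n \<le> 0\<close> and \<open>\<lambda>\<mu>\<close> for \<open>n = 1\<close>; and \<open>\<lambda>\<close> is the only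
  eigenvalue of \<open>e(0)\<close>, because \<open>e(0) - \<lambda>\<close> is locally nilpotent (\<open>iso_invariants\<close>).\<close>

section \<open>Linear maps between coefficient spaces\<close>

abbreviation (input) lookup where "lookup \<equiv> Poly_Mapping.lookup"
abbreviation (input) keys where "keys \<equiv> Poly_Mapping.keys"
abbreviation (input) single where "single \<equiv> Poly_Mapping.single"

lemma lookup_scale_pm [simp]: "lookup (scale_pm r p) k = r * lookup p k"
  unfolding scale_pm_def by transfer (simp add: when_def)

lemma scale_pm_simps [simp]:
  "scale_pm r 0 = 0" "scale_pm 0 p = 0" "scale_pm 1 p = p"
  "scale_pm r (scale_pm s p) = scale_pm (r * s) p"
  "scale_pm r (single k s) = single k (r * s)"
  by (auto intro!: poly_mapping_eqI simp: lookup_single when_def)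

lemma scale_pm_add: "scale_pm r (p + q) = scale_pm r p + scale_pm r q"
  and scale_pm_diff: "scale_pm r (p - q) = scale_pm r p - scale_pm r q"
  and scale_pm_add_left: "scale_pm (r + s) p = scale_pm r p + scale_pm s p"
  and scale_pm_minus_left: "scale_pm (- r) p = - scale_pm r p"
  and scale_pm_uminus: "scale_pm r (- p) = - scale_pm r p"
  by (auto intro!: poly_mapping_eqI simp: lookup_add lookup_minus algebra_simps)

lemma scale_pm_mult: "scale_pm r p = single 0 r * p"
  unfolding scale_pm_def by (rule mult_map_scale_conv_mult)

lemma scale_pm_mult_left: "scale_pm r p * q = scale_pm r (p * q)"
  for p q :: "'b::monoid_add \<Rightarrow>\<^sub>0 complex"
  by (simp add: scale_pm_mult mult.assoc)

lemma poly_mapping_induct' [case_names single add]: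
  fixes p :: "'b \<Rightarrow>\<^sub>0 complex"
  assumes single: "\<And>k r. P (single k r)"
    and add: "\<And>p q. P p \<Longrightarrow> P q \<Longrightarrow> P (p + q)"
  shows "P p"
proof -
  have sums: "P (\<Sum>k\<in>A. single k (lookup p k))" if "finite A" for A
    using that
  proof induction
    case empty
    show ?case using single[of undefined 0] by simp
  next
    case (insert k A)
    then show ?case by (simp add: single add)
  qed
  have "p = (\<Sum>k\<in>keys p. single k (lookup p k))"
    by (rule poly_mapping_eqI) (auto simp: lookup_sum lookup_single when_def in_keys_iff)
  with sums[of "keys p"] show ?thesis by simp
qed

lemma scale_pm_commute: "p * scale_pm r q = scale_pm r (p * q)"
  for p q :: "'b::monoid_add \<Rightarrow>\<^sub>0 complex"
proof -
  have "p * single 0 r = single 0 r * p"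
    by (induction p rule: poly_mapping_induct') (simp_all add: mult_single algebra_simps)
  then show ?thesis by (simp add: scale_pm_mult flip: mult.assoc)
qed

text \<open>Linearity for \<open>scale_pm\<close>. Most identities below are proved by comparing two linear maps on basis vectors.\<close>

definition linear_pm :: "(('a \<Rightarrow>\<^sub>0 complex) \<Rightarrow> ('b \<Rightarrow>\<^sub>0 complex)) \<Rightarrow> bool" where
  "linear_pm f \<longleftrightarrow> (\<forall>p q. f (p + q) = f p + f q) \<and> (\<forall>r p. f (scale_pm r p) = scale_pm r (f p))"

lemma linear_pm_add: "linear_pm f \<Longrightarrow> f (p + q) = f p + f q"
  and linear_pm_scale: "linear_pm f \<Longrightarrow> f (scale_pm r p) = scale_pm r (f p)"
  by (auto simp: linear_pm_def)

lemma linear_pm_zero: "linear_pm f \<Longrightarrow> f 0 = 0"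
  using linear_pm_scale[of f 0 0] by simp

lemma linear_pm_minus: "linear_pm f \<Longrightarrow> f (- p) = - f p"
  using linear_pm_scale[of f "-1" p] by (simp add: scale_pm_minus_left)

lemma linear_pm_diff: "linear_pm f \<Longrightarrow> f (p - q) = f p - f q"
  using linear_pm_add[of f p "- q"] by (simp add: linear_pm_minus)

lemmas linear_pm_simps = linear_pm_add linear_pm_scale linear_pm_zero linear_pm_minus linear_pm_diff

lemma linear_pm_eqI:
  assumes "linear_pm f" "linear_pm g"
    and "\<And>k. f (single k 1) = g (single k 1)"
  shows "f p = g p"
proof (induction p rule: poly_mapping_induct')
  case (single k r)
  have "single k r = scale_pm r (single k 1)" by simp
  then show ?case using assms by (simp only: linear_pm_scale)
next
  case (add p q)
  then show ?case using assms by (simp add: linear_pm_add)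
qed

definition lin_ext :: "('a \<Rightarrow> ('b \<Rightarrow>\<^sub>0 complex)) \<Rightarrow> ('a \<Rightarrow>\<^sub>0 complex) \<Rightarrow> ('b \<Rightarrow>\<^sub>0 complex)" where
  "lin_ext g p = (\<Sum>k\<in>keys p. scale_pm (lookup p k) (g k))"

lemma lin_ext_superset:
  assumes "finite A" "keys p \<subseteq> A"
  shows "lin_ext g p = (\<Sum>k\<in>A. scale_pm (lookup p k) (g k))"
  unfolding lin_ext_def using assms
  by (intro sum.mono_neutral_left) (auto simp: in_keys_iff)

lemma scale_pm_sum: "scale_pm r (sum f A) = (\<Sum>k\<in>A. scale_pm r (f k))"
  by (induction A rule: infinite_finite_induct) (auto simp: scale_pm_add)

lemma linear_lin_ext: "linear_pm (lin_ext g)"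
  unfolding linear_pm_def
proof safe
  fix p q :: "'a \<Rightarrow>\<^sub>0 complex"
  define A where "A = keys p \<union> keys q"
  have A: "finite A" "keys p \<subseteq> A" "keys q \<subseteq> A" "keys (p + q) \<subseteq> A"
    using Poly_Mapping.keys_add[of p q] by (auto simp: A_def)
  show "lin_ext g (p + q) = lin_ext g p + lin_ext g q"
    using A by (simp add: lin_ext_superset[OF A(1)] lookup_add scale_pm_add_left sum.distrib)
next
  fix r and p :: "'a \<Rightarrow>\<^sub>0 complex"
  have "keys (scale_pm r p) \<subseteq> keys p" by (auto simp: in_keys_iff)
  from lin_ext_superset[OF finite_keys this]
  show "lin_ext g (scale_pm r p) = scale_pm r (lin_ext g p)"
    by (simp add: lin_ext_def scale_pm_sum)
qed

lemma lin_ext_single [simp]: "lin_ext g (single k r) = scale_pm r (g k)"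
  by (cases "r = 0") (simp_all add: lin_ext_def)

lemma bilinear_ext_lin: "bilinear_ext b x y = lin_ext (\<lambda>i. lin_ext (b i) y) x"
  by (simp add: bilinear_ext_def lin_ext_def scale_pm_sum)

lemma lin_ext_add_fun: "lin_ext (\<lambda>k. f k + g k) p = lin_ext f p + lin_ext g p"
  by (simp add: lin_ext_def scale_pm_add sum.distrib)
lemma lin_ext_scale_fun: "lin_ext (\<lambda>k. scale_pm r (g k)) p = scale_pm r (lin_ext g p)"
  by (simp add: lin_ext_def scale_pm_sum mult.commute)

lemma linear_pm_compose: "linear_pm f \<Longrightarrow> linear_pm g \<Longrightarrow> linear_pm (\<lambda>p. f (g p))"
  by (simp add: linear_pm_def)
lemma linear_pm_plus: "linear_pm f \<Longrightarrow> linear_pm g \<Longrightarrow> linear_pm (\<lambda>p. f p + g p)"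
  by (simp add: linear_pm_def scale_pm_add algebra_simps)
lemma linear_pm_sub: "linear_pm f \<Longrightarrow> linear_pm g \<Longrightarrow> linear_pm (\<lambda>p. f p - g p)"
  by (simp add: linear_pm_def scale_pm_diff algebra_simps)
lemma linear_pm_const0: "linear_pm (\<lambda>p. 0)"
  by (simp add: linear_pm_def)
lemma linear_pm_id: "linear_pm (\<lambda>p. p)"
  by (simp add: linear_pm_def)
lemma linear_pm_scaled: "linear_pm f \<Longrightarrow> linear_pm (\<lambda>p. scale_pm r (f p))"
  by (simp add: linear_pm_def scale_pm_add mult.commute)
lemma linear_pm_mult_left: "linear_pm f \<Longrightarrow> linear_pm (\<lambda>p. q * f p)"
  for q :: "'b::monoid_add \<Rightarrow>\<^sub>0 complex"
  by (simp add: linear_pm_def algebra_simps scale_pm_commute)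
lemma linear_pm_mult_right: "linear_pm f \<Longrightarrow> linear_pm (\<lambda>p. f p * q)"
  for q :: "'b::monoid_add \<Rightarrow>\<^sub>0 complex"
  by (simp add: linear_pm_def algebra_simps scale_pm_mult_left)

lemmas linear_pm_intros = linear_pm_plus linear_pm_sub linear_pm_const0 linear_pm_id
  linear_pm_scaled linear_pm_mult_left linear_pm_mult_right linear_lin_ext

section \<open>The bracket of the affine Lie algebra\<close>

abbreviation (input) br where "br \<equiv> affine_bracket_basis"
abbreviation (input) bvec :: "affine_basis \<Rightarrow> affine_sl2" where "bvec a \<equiv> single a 1"

lemma linear_bracket_left: "linear_pm (\<lambda>x. affine_bracket x y)"
  unfolding affine_bracket_def bilinear_ext_lin by (rule linear_lin_ext)

lemma linear_bracket_right: "linear_pm (affine_bracket x)"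
  unfolding affine_bracket_def bilinear_ext_lin linear_pm_def
  by (simp add: linear_pm_simps linear_lin_ext lin_ext_add_fun lin_ext_scale_fun)

lemma bracket_single [simp]:
  "affine_bracket (single a r) (single b s) = scale_pm (r * s) (br a b)"
  by (simp add: affine_bracket_def bilinear_ext_lin)

lemma loop_embed_single [simp]:
  "loop_embed (single a r) n = single (Loop a n) r"
  "loop_embed 0 n = 0"
  by (cases "r = 0"; simp add: loop_embed_def)+

lemma loop_embed_uminus [simp]: "loop_embed (- x) n = - loop_embed x n"
proof -
  have "linear_pm (\<lambda>x. loop_embed x n)"
    using linear_lin_ext[of "\<lambda>i. single (Loop i n) 1"]
    by (simp add: loop_embed_def[abs_def] lin_ext_def[abs_def])
  from linear_pm_minus[OF this] show ?thesis .
qed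

lemma tensor_incl_eq: "tensor_incl x = lin_ext (\<lambda>i. single (Word [i]) 1) x"
  by (simp add: tensor_incl_def lin_ext_def)

lemma linear_tensor_incl: "linear_pm tensor_incl"
  unfolding tensor_incl_eq[abs_def] by (rule linear_lin_ext)

lemma tensor_incl_single [simp]: "tensor_incl (single a r) = single (Word [a]) r"
  by (simp add: tensor_incl_eq)

lemma linear_bracket_left': "linear_pm f \<Longrightarrow> linear_pm (\<lambda>x. affine_bracket (f x) y)"
  by (rule linear_pm_compose[OF linear_bracket_left])
lemma linear_bracket_right': "linear_pm f \<Longrightarrow> linear_pm (\<lambda>x. affine_bracket y (f x))"
  by (rule linear_pm_compose[OF linear_bracket_right])

lemma bracket_basis_antisym: "br a b = - br b a"
proof -
  have "br (Loop x n) (Loop y m) = - br (Loop y m) (Loop x n)" for x y n m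
    by (cases x; cases y) (auto simp: add.commute single_uminus add_eq_0_iff)
  then show ?thesis by (cases a; cases b) auto
qed

lemma bracket_basis_Jacobi:
  "affine_bracket (bvec a) (br b c) =
   affine_bracket (br a b) (bvec c) +
   affine_bracket (bvec b) (br a c)"
proof (cases "a = Central \<or> b = Central \<or> c = Central")
  case True
  have z: "br Central x = 0" "br x Central = 0" for x
    by (cases x; simp)+
  have z1: "affine_bracket (bvec Central) p = 0"
    "affine_bracket p (bvec Central) = 0" for p
    by (simp_all add: affine_bracket_def bilinear_ext_lin z) (simp_all add: lin_ext_def)
  show ?thesis using True
    by (auto simp: z z1 linear_pm_zero[OF linear_bracket_left] linear_pm_zero[OF linear_bracket_right])
next
  case False
  then obtain x y z i j k where abc: "a = Loop x i" "b = Loop y j" "c = Loop z k"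
    by (meson affine_basis.exhaust)
  have c: "i + (j + k) = i + j + k" "j + (i + k) = i + j + k" by simp_all
  show ?thesis unfolding abc
  proof (rule poly_mapping_eqI)
    fix b
    show "lookup (affine_bracket (bvec (Loop x i)) (br (Loop y j) (Loop z k))) b =
      lookup (affine_bracket (br (Loop x i) (Loop y j)) (bvec (Loop z k)) +
        affine_bracket (bvec (Loop y j)) (br (Loop x i) (Loop z k))) b"
      by (cases b; cases x; cases y; cases z)
        (simp_all add: linear_pm_simps[OF linear_bracket_left] linear_pm_simps[OF linear_bracket_right]
         c lookup_add lookup_single when_def split del: if_split,
         (auto simp: algebra_simps add_eq_0_iff)?)
  qed
qed

section \<open>A functional attached to a splitting of the Lie algebra\<close>

lemma lin_ext_cong: "(\<And>k. k \<in> keys p \<Longrightarrow> f k = g k) \<Longrightarrow> lin_ext f p = lin_ext g p"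
  by (simp add: lin_ext_def)

lemma linear_lin_ext_commute: "linear_pm f \<Longrightarrow> f (lin_ext g p) = lin_ext (\<lambda>k. f (g k)) p"
  by (rule linear_pm_eqI[of "\<lambda>p. f (lin_ext g p)"])
    (auto intro!: linear_pm_intros linear_pm_compose[OF _ linear_lin_ext] simp: linear_pm_scale)

abbreviation (input) word :: "affine_basis list \<Rightarrow> affine_tensor" where
  "word v \<equiv> single (Word v) 1"

abbreviation (input) letter :: "affine_basis \<Rightarrow> affine_tensor" where
  "letter a \<equiv> word [a]"

lemma word_Cons: "word (a # v) = letter a * word v"
  by (simp add: mult_single)

lemma word_Nil: "word [] = 1"
  by (metis single_one zero_free_mon_def)

lemma linear_tensor_eqI:
  assumes "linear_pm f" "linear_pm g"
    and "\<And>v. f (word v) = g (word v)"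
  shows "f p = g p"
  using assms(1,2) by (rule linear_pm_eqI) (metis assms(3) free_mon.exhaust)

text \<open>The adjoint action of a basis vector on the tensor algebra, as the derivation extending the bracket.\<close>

fun ad_word :: "affine_basis \<Rightarrow> affine_basis list \<Rightarrow> affine_tensor" where
  "ad_word a [] = 0"
| "ad_word a (b # v) = tensor_incl (br a b) * word v + letter b * ad_word a v"

primrec letters :: "'b free_mon \<Rightarrow> 'b list" where "letters (Word v) = v"

definition ad :: "affine_basis \<Rightarrow> affine_tensor \<Rightarrow> affine_tensor" where
  "ad a = lin_ext (\<lambda>w. ad_word a (letters w))"

lemma linear_ad: "linear_pm (ad a)"
  unfolding ad_def by (rule linear_lin_ext)

lemma linear_ad': "linear_pm f \<Longrightarrow> linear_pm (\<lambda>p. ad a (f p))"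
  by (rule linear_pm_compose[OF linear_ad])
lemma linear_incl': "linear_pm f \<Longrightarrow> linear_pm (\<lambda>p. tensor_incl (f p))"
  by (rule linear_pm_compose[OF linear_tensor_incl])

lemma ad_word: "ad a (single (Word v) r) = scale_pm r (ad_word a v)"
  by (simp add: ad_def)

lemma ad_letter: "ad a (letter b) = tensor_incl (br a b)"
  by (simp add: ad_word word_Nil)

lemma ad_mult: "ad a (p * q) = ad a p * q + p * ad a q"
proof -
  have words: "ad a (word u * word v)
     = ad a (word u) * word v
       + word u * ad a (word v)" for u v
  proof (induction u)
    case Nil
    show ?case by (simp add: word_Nil) (simp add: ad_word flip: word_Nil)
  next
    case (Cons b u)
    have e: "word (b # u) * word v
      = word (b # (u @ v))" by (simp add: mult_single)
    have "ad_word a (u @ v) = ad_word a u * word v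
       + word u * ad_word a v"
      using Cons by (simp add: ad_word mult_single)
    moreover have "word (u @ v)
       = word u * word v" by (simp add: mult_single)
    moreover have "ad a (word (b # u))
       = tensor_incl (br a b) * word u + letter b * ad_word a u"
      by (simp add: ad_word)
    moreover have "ad a (word (b # (u @ v)))
       = tensor_incl (br a b) * word (u @ v) + letter b * ad_word a (u @ v)"
      by (simp add: ad_word)
    ultimately show ?case unfolding e by (simp add: algebra_simps word_Cons[of b u] ad_word)
  qed
  have "ad a (p * word v) = ad a p * word v
     + p * ad a (word v)" for v
    by (rule linear_tensor_eqI[where p = p]) (auto intro!: linear_pm_intros linear_ad linear_ad' words)
  note on_words = this
  show ?thesis
    by (rule linear_tensor_eqI[where p = q]) (auto intro!: linear_pm_intros linear_ad linear_ad' simp: on_words)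
qed

lemma ad_incl: "ad a (tensor_incl x) = tensor_incl (affine_bracket (bvec a) x)"
  by (rule linear_pm_eqI[where p = x])
    (auto intro!: linear_ad' linear_incl' linear_tensor_incl linear_bracket_right simp: ad_letter)

definition ad_elt :: "affine_sl2 \<Rightarrow> affine_tensor \<Rightarrow> affine_tensor" where
  "ad_elt x p = lin_ext (\<lambda>a. ad a p) x"

lemma linear_ad_elt_left: "linear_pm (\<lambda>x. ad_elt x p)"
  unfolding ad_elt_def by (rule linear_lin_ext)

lemma linear_ad_elt: "linear_pm (ad_elt x)"
  unfolding ad_elt_def linear_pm_def
  by (simp add: linear_pm_simps linear_ad lin_ext_add_fun lin_ext_scale_fun)

lemma ad_elt_mult: "ad_elt x (p * q) = ad_elt x p * q + p * ad_elt x q"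
  by (rule linear_pm_eqI[where p = x])
    (auto intro!: linear_pm_intros linear_ad_elt_left simp: ad_elt_def ad_mult)

lemma ad_elt_letter: "ad_elt x (letter b) = tensor_incl (affine_bracket x (bvec b))"
  by (rule linear_pm_eqI[where p = x])
    (auto intro!: linear_pm_intros linear_ad_elt_left linear_incl' linear_bracket_left simp: ad_elt_def ad_letter)

text \<open>The adjoint action on the tensor algebra, before passing to the enveloping algebra, is already
  a representation: both sides are derivations, and on letters this is the Jacobi identity.\<close>

lemma ad_commutator: "ad a (ad b p) - ad b (ad a p) = ad_elt (br a b) p"
proof -
  have "ad a (ad b (word v)) - ad b (ad a (word v))
     = ad_elt (br a b) (word v)" for v
  proof (induction v)
    case Nil
    have "ad c 1 = 0" for c by (simp add: ad_word flip: word_Nil)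
    then show ?case by (simp add: word_Nil linear_pm_zero[OF linear_ad] ad_elt_def) (simp add: lin_ext_def)
  next
    case (Cons c v)
    have l: "ad a (ad b (letter c)) - ad b (ad a (letter c)) = ad_elt (br a b) (letter c)"
      by (simp add: ad_letter ad_incl ad_elt_letter bracket_basis_Jacobi[of a b c] linear_pm_simps[OF linear_tensor_incl])
    show ?case
      unfolding word_Cons[of c v] ad_mult ad_elt_mult Cons[symmetric] l[symmetric]
      by (simp add: linear_pm_simps[OF linear_ad] ad_mult algebra_simps)
  qed
  note on_words = this
  show ?thesis
    by (rule linear_tensor_eqI[where p = p]) (auto intro!: linear_pm_intros linear_ad' linear_ad_elt linear_ad simp: on_words)
qed

lemma keys_mult_word_length:
  assumes "\<And>w. w \<in> keys p \<Longrightarrow> length (letters w) = m"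
    and "\<And>w. w \<in> keys q \<Longrightarrow> length (letters w) = n"
    and "w \<in> keys (p * q)"
  shows "length (letters w) = m + n"
proof -
  from assms(3) keys_mult[of p q] obtain u v where "w = u + v" "u \<in> keys p" "v \<in> keys q"
    by blast
  with assms(1)[of u] assms(2)[of v] show ?thesis by (cases u; cases v) auto
qed

lemma keys_tensor_incl: "w \<in> keys (tensor_incl x) \<Longrightarrow> length (letters w) = 1"
  using keys_sum[of "\<lambda>i. single (Word [i]) (lookup x i)" "keys x"]
  by (auto simp: tensor_incl_def split: if_splits)

lemma keys_ad_word: "w \<in> keys (ad_word a v) \<Longrightarrow> length (letters w) = length v"
proof (induction v arbitrary: w)
  case (Cons b v)
  have "w \<in> keys (tensor_incl (br a b) * word v)
     \<or> w \<in> keys (letter b * ad_word a v)"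
    using Cons.prems Poly_Mapping.keys_add by fastforce
  then show ?case
  proof
    assume "w \<in> keys (tensor_incl (br a b) * word v)"
    from keys_mult_word_length[OF keys_tensor_incl _ this, where n = "length v"] show ?thesis by simp
  next
    assume "w \<in> keys (letter b * ad_word a v)"
    from keys_mult_word_length[OF _ Cons.IH this, where m = 1] show ?thesis by simp
  qed
qed simp

text \<open>The affine algebra is a direct sum of two subalgebras, each spanned by basis vectors: \<open>N\<close>, which carries
  a character \<open>chi\<close>, and the span of the other basis vectors, which acts by \<open>rho\<close>. By the theorem of
  Poincare, Birkhoff and Witt the module induced from \<open>chi\<close> is free over the second subalgebra and so maps to \<open>rho\<close>,
  its generator going to any given vector. The map is constructed by recursion on words.\<close>

locale lie_splitting =
  fixes N :: "affine_basis set" and chi :: "affine_basis \<Rightarrow> complex"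
    and rho :: "affine_basis \<Rightarrow> ('m \<Rightarrow>\<^sub>0 complex) \<Rightarrow> ('m \<Rightarrow>\<^sub>0 complex)"
    and v0 :: "'m \<Rightarrow>\<^sub>0 complex"
  assumes linear_rho: "a \<notin> N \<Longrightarrow> linear_pm (rho a)"
    and N_closed: "a \<in> N \<Longrightarrow> b \<in> N \<Longrightarrow> keys (br a b) \<subseteq> N"
    and chi_bracket: "a \<in> N \<Longrightarrow> b \<in> N \<Longrightarrow> lin_ext (\<lambda>l. scale_pm (chi l) p) (br a b) = 0"
    and M_closed: "a \<notin> N \<Longrightarrow> b \<notin> N \<Longrightarrow> keys (br a b) \<inter> N = {}"
    and rho_bracket: "a \<notin> N \<Longrightarrow> b \<notin> N \<Longrightarrow>
      lin_ext (\<lambda>l. rho l p) (br a b) = rho a (rho b p) - rho b (rho a p)"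
begin

text \<open>A letter of the second subalgebra acts by \<open>rho\<close>; a letter of \<open>N\<close> is moved to the right end of the word, where
  it acts by \<open>chi\<close>, at the cost of its adjoint action. That action keeps the length of the words, whence the
  recursion ends.\<close>

function psi :: "affine_basis list \<Rightarrow> ('m \<Rightarrow>\<^sub>0 complex)" where
  "psi [] = v0"
| "psi (a # v) =
    (if a \<in> N
     then scale_pm (chi a) (psi v) +
       (\<Sum>w\<in>keys (ad_word a v). scale_pm (lookup (ad_word a v) w) (psi (letters w)))
     else rho a (psi v))"
  by pat_completeness auto
termination
  by (relation "measure length") (auto dest: keys_ad_word)

definition Psi :: "affine_tensor \<Rightarrow> ('m \<Rightarrow>\<^sub>0 complex)" where
  "Psi = lin_ext (\<lambda>w. psi (letters w))"

lemma Psi_apply: "Psi p = (\<Sum>w\<in>keys p. scale_pm (lookup p w) (psi (letters w)))"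
  by (simp add: Psi_def lin_ext_def)

lemma linear_Psi: "linear_pm Psi" unfolding Psi_def by (rule linear_lin_ext)
lemma linear_Psi': "linear_pm f \<Longrightarrow> linear_pm (\<lambda>p. Psi (f p))"
  by (rule linear_pm_compose[OF linear_Psi])

lemma Psi_1: "Psi 1 = v0"
  by (simp add: Psi_def flip: word_Nil)

lemma Psi_word: "Psi (word v) = psi v" by (simp add: Psi_def)

lemma Psi_M: "a \<notin> N \<Longrightarrow> Psi (letter a * p) = rho a (Psi p)"
  by (rule linear_tensor_eqI[where p = p])
    (auto intro!: linear_pm_intros linear_Psi linear_Psi' linear_pm_compose[OF linear_rho] simp: Psi_word simp flip: word_Cons)

lemma Psi_N: "a \<in> N \<Longrightarrow> Psi (letter a * p) = scale_pm (chi a) (Psi p) + Psi (ad a p)"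
  by (rule linear_tensor_eqI[where p = p])
    (auto intro!: linear_pm_intros linear_Psi linear_Psi' linear_ad
      simp: Psi_word ad_word Psi_apply[of "ad_word a v" for v] simp flip: word_Cons)

definition relator :: "affine_sl2 \<Rightarrow> affine_sl2 \<Rightarrow> affine_tensor" where
  "relator x y = tensor_incl x * tensor_incl y - tensor_incl y * tensor_incl x - tensor_incl (affine_bracket x y)"

lemma incl_mult_lin:
  assumes f: "linear_pm f"
  shows "f (tensor_incl x * p) = lin_ext (\<lambda>a. f (letter a * p)) x"
  by (rule linear_pm_eqI[where p = x]) (auto intro!: linear_pm_intros linear_pm_compose[OF f] linear_tensor_incl)

lemma relator_linear: "linear_pm (\<lambda>x. relator x y)" "linear_pm (relator x)"
  unfolding relator_def
  by (auto intro!: linear_pm_intros linear_tensor_incl linear_incl' linear_bracket_left linear_bracket_right)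

text \<open>For a letter of \<open>N\<close> against a letter of the other subalgebra this is the recursion itself; for two letters of \<open>N\<close>
  it is the fact that the adjoint action is a representation and that \<open>chi\<close> is a character.\<close>

lemma Psi_relator_left: "Psi (relator x y * q) = 0"
proof -
  have mixed: "Psi (letter a * (letter b * q)) - Psi (letter b * (letter a * q))
     - Psi (tensor_incl (br a b) * q) = 0" if a: "a \<in> N" and b: "b \<notin> N" for a b
    by (simp add: Psi_N[OF a] Psi_M[OF b] ad_mult ad_letter linear_pm_simps[OF linear_Psi] linear_pm_simps[OF linear_rho[OF b]])
  have basis: "Psi (letter a * (letter b * q)) - Psi (letter b * (letter a * q))
     - Psi (tensor_incl (br a b) * q) = 0" for a b
  proof -
    consider (NN) "a \<in> N" "b \<in> N" | (NM) "a \<in> N" "b \<notin> N" | (MN) "a \<notin> N" "b \<in> N" | (MM) "a \<notin> N" "b \<notin> N" by blast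
    then show ?thesis
    proof cases
      case NN
      have "Psi (tensor_incl (br a b) * q)
         = lin_ext (\<lambda>l. scale_pm (chi l) (Psi q) + Psi (ad l q)) (br a b)"
        unfolding incl_mult_lin[OF linear_Psi] using N_closed[OF NN] by (intro lin_ext_cong) (auto simp: Psi_N)
      also have "\<dots> = Psi (ad_elt (br a b) q)"
        by (simp add: lin_ext_add_fun chi_bracket[OF NN] ad_elt_def linear_lin_ext_commute[OF linear_Psi])
      finally have 1: "Psi (tensor_incl (br a b) * q) = Psi (ad a (ad b q)) - Psi (ad b (ad a q))"
        by (simp add: linear_pm_simps[OF linear_Psi] flip: ad_commutator)
      have 2: "Psi (tensor_incl (br b a) * q) = Psi (ad b (ad a q)) - Psi (ad a (ad b q))"
        using 1 by (simp add: bracket_basis_antisym[of b a] linear_pm_simps[OF linear_Psi] linear_pm_simps[OF linear_tensor_incl])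
      show ?thesis
        by (simp add: Psi_N[OF NN(1)] Psi_N[OF NN(2)] ad_mult ad_letter linear_pm_simps[OF linear_Psi] scale_pm_add 1 2 mult.commute)
    next
      case NM
      then show ?thesis by (rule mixed)
    next
      case MN
      have "Psi (tensor_incl (br b a) * q) = - Psi (tensor_incl (br a b) * q)"
        by (simp add: bracket_basis_antisym[of b a] linear_pm_simps[OF linear_Psi] linear_pm_simps[OF linear_tensor_incl])
      with mixed[OF MN(2,1)] show ?thesis by (simp add: algebra_simps)
    next
      case MM
      have "Psi (tensor_incl (br a b) * q) = lin_ext (\<lambda>l. rho l (Psi q)) (br a b)"
        unfolding incl_mult_lin[OF linear_Psi] using M_closed[OF MM] by (intro lin_ext_cong Psi_M) blast
      then show ?thesis using MM by (simp add: Psi_M rho_bracket)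
    qed
  qed
  have "Psi (relator x (bvec b) * q) = 0" for x b
  proof (rule linear_pm_eqI[where p = x])
    show "linear_pm (\<lambda>p. Psi (relator p (bvec b) * q))"
      by (intro linear_Psi' linear_pm_intros relator_linear)
    show "Psi (relator (bvec a) (bvec b) * q) = 0" for a
      using basis[of a b] by (simp add: relator_def algebra_simps linear_pm_simps[OF linear_Psi])
  qed (rule linear_pm_intros)
  note on_words = this
  show ?thesis
    by (rule linear_pm_eqI[where p = y]) (auto intro!: linear_Psi' linear_pm_intros relator_linear simp: on_words)
qed

lemma ad_relator: "ad a (relator x y) = relator (affine_bracket (bvec a) x) y
   + relator x (affine_bracket (bvec a) y)"
proof -
  have b: "affine_bracket (bvec a) (affine_bracket (bvec b) (bvec c)) =
    affine_bracket (affine_bracket (bvec a) (bvec b)) (bvec c) +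
    affine_bracket (bvec b) (affine_bracket (bvec a) (bvec c))" for b c
    using bracket_basis_Jacobi[of a b c] by simp
  have "affine_bracket (bvec a) (affine_bracket x (bvec c)) =
    affine_bracket (affine_bracket (bvec a) x) (bvec c) +
    affine_bracket x (affine_bracket (bvec a) (bvec c))" for c
    by (rule linear_pm_eqI[where p = x])
      (auto intro!: linear_pm_intros linear_bracket_left linear_bracket_right linear_bracket_left' linear_bracket_right'
        simp del: bracket_single simp: b)
  note on_basis = this
  have "affine_bracket (bvec a) (affine_bracket x y) =
    affine_bracket (affine_bracket (bvec a) x) y +
    affine_bracket x (affine_bracket (bvec a) y)"
    by (rule linear_pm_eqI[where p = y])
      (auto intro!: linear_pm_intros linear_bracket_left linear_bracket_right linear_bracket_left' linear_bracket_right'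
        simp del: bracket_single simp: on_basis)
  then show ?thesis
    by (simp add: relator_def ad_mult ad_incl linear_pm_simps[OF linear_ad] linear_pm_simps[OF linear_tensor_incl] algebra_simps)
qed

text \<open>A relation inside a word: letters of \<open>N\<close> in front of it are removed by the recursion, and the derivations
  map relations to relations by the Jacobi identity.\<close>

lemma Psi_relator: "Psi (p * relator x y * q) = 0"
proof -
  have "\<forall>v x y q. length v = n \<longrightarrow> Psi (word v * relator x y * q) = 0" for n
  proof (induction n)
    case 0
    show ?case by (simp add: word_Nil Psi_relator_left)
  next
    case (Suc n)
    show ?case
    proof (intro allI impI)
      fix v :: "affine_basis list" and x y q
      assume "length v = Suc n"
      then obtain a u where v: "v = a # u" and u: "length u = n" by (cases v) auto
      have IH: "Psi (word u * relator x y * q) = 0" for x y q using Suc u by blast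
      have "Psi (ad_word a u * relator x y * q) = 0"
      proof -
        have expand: "Psi (p * relator x y * q) = lin_ext (\<lambda>w. Psi (single w 1 * relator x y * q)) p" for p
          by (rule linear_pm_eqI[where p = p]) (auto intro!: linear_pm_intros linear_Psi')
        have "Psi (single w 1 * relator x y * q) = 0" if "w \<in> keys (ad_word a u)" for w
        proof (cases w)
          case (Word v')
          then show ?thesis using Suc[rule_format, of v' x y q] keys_ad_word[OF that] u by simp
        qed
        then show ?thesis unfolding expand[of "ad_word a u"] by (simp add: lin_ext_def)
      qed
      moreover have "Psi (word u * ad a (relator x y) * q) = 0"
        by (simp add: ad_relator distrib_left distrib_right linear_pm_simps[OF linear_Psi] IH flip: mult.assoc)
      ultimately have "Psi (ad a (word u * relator x y * q)) = 0"
        by (simp add: ad_mult ad_word distrib_left distrib_right linear_pm_simps[OF linear_Psi] IH flip: mult.assoc)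
      then show "Psi (word v * relator x y * q) = 0"
        unfolding v word_Cons[of a u] mult.assoc[of "letter a"]
        by (cases "a \<in> N") (simp_all add: Psi_M Psi_N IH linear_pm_zero[OF linear_rho])
    qed
  qed
  note on_words = this
  show ?thesis
    by (rule linear_tensor_eqI[where p = p]) (auto intro!: linear_pm_intros linear_Psi' simp: on_words)
qed

lemma Psi_uea_ideal: "p \<in> uea_ideal \<Longrightarrow> Psi p = 0"
proof -
  have "uea_ideal \<subseteq> {p. \<forall>u v. Psi (u * p * v) = 0}"
    unfolding uea_ideal_def
  proof (rule hull_minimal)
    show "uea_relations \<subseteq> {p. \<forall>u v. Psi (u * p * v) = 0}"
      using Psi_relator by (auto simp: uea_relations_def relator_def)
    show "two_sided_ideal {p. \<forall>u v. Psi (u * p * v) = 0}"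
      unfolding two_sided_ideal_def left_ideal_def
    proof (intro conjI allI ballI)
      fix a x assume "x \<in> {p. \<forall>u v. Psi (u * p * v) = 0}"
      then have "Psi (u * a * x * v) = 0" "Psi (u * x * (a * v)) = 0" for u v by auto
      then show "a * x \<in> {p. \<forall>u v. Psi (u * p * v) = 0}" "x * a \<in> {p. \<forall>u v. Psi (u * p * v) = 0}"
        by (auto simp: mult.assoc)
    qed (auto simp: linear_pm_simps[OF linear_Psi] algebra_simps)
  qed
  moreover assume "p \<in> uea_ideal"
  ultimately have "Psi (1 * p * 1) = 0" by blast
  then show ?thesis by simp
qed

lemma Psi_right: "a \<in> N \<Longrightarrow> Psi (p * letter a) = scale_pm (chi a) (Psi p)"
proof -
  have "\<forall>v a. length v = n \<longrightarrow> a \<in> N \<longrightarrow> Psi (word v * letter a)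
     = scale_pm (chi a) (Psi (word v))" for n
  proof (induction n)
    case 0
    show ?case
    proof (intro allI impI)
      fix v :: "affine_basis list" and a assume "length v = 0" "a \<in> N"
      then show "Psi (word v * letter a) = scale_pm (chi a) (Psi (word v))"
        using Psi_N[of a 1] by (simp add: word_Nil) (simp add: ad_word linear_pm_zero[OF linear_Psi] flip: word_Nil)
    qed
  next
    case (Suc n)
    show ?case
    proof (intro allI impI)
      fix v :: "affine_basis list" and a
      assume "length v = Suc n" and a: "a \<in> N"
      then obtain b u where v: "v = b # u" and u: "length u = n" by (cases v) auto
      have IH: "Psi (word u * letter a) = scale_pm (chi a) (Psi (word u))"
        if "a \<in> N" for a using Suc u that by blast
      show "Psi (word v * letter a) = scale_pm (chi a) (Psi (word v))"
      proof (cases "b \<in> N")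
        case False
        then show ?thesis unfolding v word_Cons[of b u] mult.assoc
          by (simp add: Psi_M IH[OF a] linear_pm_simps[OF linear_rho])
      next
        case True
        have "Psi (ad_word b u * letter a) = scale_pm (chi a) (Psi (ad_word b u))"
        proof -
          have "Psi (p * letter a) = lin_ext (\<lambda>w. Psi (single w 1 * letter a)) p" for p
            by (rule linear_pm_eqI[where p = p]) (auto intro!: linear_pm_intros linear_Psi')
          also have "lin_ext (\<lambda>w. Psi (single w 1 * letter a)) (ad_word b u)
             = lin_ext (\<lambda>w. scale_pm (chi a) (Psi (single w 1))) (ad_word b u)"
          proof (rule lin_ext_cong)
            fix w assume "w \<in> keys (ad_word b u)"
            from keys_ad_word[OF this] show "Psi (single w 1 * letter a) = scale_pm (chi a) (Psi (single w 1))"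
              using Suc[rule_format, of "letters w" a] u a by (cases w) simp
          qed
          also have "\<dots> = scale_pm (chi a) (Psi (ad_word b u))"
            by (simp add: lin_ext_scale_fun Psi_def)
          finally show ?thesis .
        qed
        moreover have "Psi (word u * tensor_incl (br b a)) = 0"
        proof -
          have "Psi (word u * tensor_incl x)
             = lin_ext (\<lambda>l. Psi (word u * letter l)) x" for x
            by (rule linear_pm_eqI[where p = x]) (auto intro!: linear_pm_intros linear_Psi' linear_tensor_incl)
          also have "lin_ext (\<lambda>l. Psi (word u * letter l)) (br b a)
             = lin_ext (\<lambda>l. scale_pm (chi l) (Psi (word u))) (br b a)"
            using N_closed[OF True a] by (intro lin_ext_cong IH) auto
          finally show ?thesis by (simp add: chi_bracket[OF True a])
        qed
        ultimately show ?thesis unfolding v word_Cons[of b u] mult.assoc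
          by (simp add: Psi_N[OF True] IH[OF a] ad_mult ad_letter linear_pm_simps[OF linear_Psi])
             (simp add: ad_word scale_pm_add mult.commute)
      qed
    qed
  qed
  note on_words = this
  show "a \<in> N \<Longrightarrow> Psi (p * letter a) = scale_pm (chi a) (Psi p)"
    by (rule linear_tensor_eqI[where p = p]) (auto intro!: linear_pm_intros linear_Psi linear_Psi' simp: on_words)
qed

end

section \<open>A representation of the creation operators on polynomials\<close>

text \<open>Polynomials over the complex numbers in variables \<open>X\<^sub>m\<close>, \<open>m\<close> a natural number; monomials are multisets.
  They serve in two roles: as a module for the creation operators, and as polynomials in the
  commuting operators \<open>T(-m)\<close>.\<close>

type_synonym Zpoly = "nat multiset \<Rightarrow>\<^sub>0 complex"

definition Zmon :: "nat multiset \<Rightarrow> Zpoly" where "Zmon M = single M 1"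
definition Zvar :: "nat \<Rightarrow> Zpoly" where "Zvar m = Zmon {#m#}"

lemma Zmon_add: "Zmon (add_mset m M) = Zvar m * Zmon M"
  by (simp add: Zmon_def Zvar_def mult_single)
lemma Zmon_empty: "Zmon {#} = 1" by (simp add: Zmon_def flip: single_one)
text \<open>The creation operators \<open>f(-m)\<close>, \<open>h(-i)\<close>, \<open>e(-i)\<close> act on the module induced from the trivial representation of
  the \<open>h(-i)\<close> and \<open>e(-i)\<close>: by the variable \<open>X\<^sub>m\<close>, by the derivation with \<open>X\<^sub>m \<mapsto> -2X\<^sub>m\<^sub>+\<^sub>i\<close>, and by a
  differential operator of second order. In the latter each unordered pair of factors is met twice, which
  accounts for the factor \<open>1/2\<close>.\<close>

definition hop_mon :: "nat \<Rightarrow> nat multiset \<Rightarrow> Zpoly" where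
  "hop_mon i M = (\<Sum>m\<in>#M. scale_pm (- 2) (Zvar (m + i) * Zmon (M - {#m#})))"
definition hop :: "nat \<Rightarrow> Zpoly \<Rightarrow> Zpoly" where "hop i = lin_ext (hop_mon i)"

definition eop_mon :: "nat \<Rightarrow> nat multiset \<Rightarrow> Zpoly" where
  "eop_mon i M = (\<Sum>m\<in>#M. scale_pm (1/2) (hop (m + i) (Zmon (M - {#m#}))))"
definition eop :: "nat \<Rightarrow> Zpoly \<Rightarrow> Zpoly" where "eop i = lin_ext (eop_mon i)"

lemma linear_hop: "linear_pm (hop i)" and linear_eop: "linear_pm (eop i)"
  unfolding hop_def eop_def by (rule linear_lin_ext)+

lemma linear_hop': "linear_pm f \<Longrightarrow> linear_pm (\<lambda>p. hop i (f p))"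
  by (rule linear_pm_compose[OF linear_hop])
lemma linear_eop': "linear_pm f \<Longrightarrow> linear_pm (\<lambda>p. eop i (f p))"
  by (rule linear_pm_compose[OF linear_eop])

lemma hop_Zmon: "hop i (Zmon M) = hop_mon i M" by (simp add: hop_def Zmon_def)
lemma eop_Zmon: "eop i (Zmon M) = eop_mon i M" by (simp add: eop_def Zmon_def)

lemma linear_Zpoly_eqI:
  "linear_pm f \<Longrightarrow> linear_pm g \<Longrightarrow> (\<And>M. f (Zmon M) = g (Zmon M)) \<Longrightarrow> f p = g p"
  by (rule linear_pm_eqI) (simp_all add: Zmon_def)

lemma mult_sum_mset: "x * sum_mset (image_mset f M) = (\<Sum>m\<in>#M. x * f m)" for x :: "'b::semiring_0"
  by (induction M) (simp_all add: algebra_simps)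

lemma hop_Zvar: "hop i (Zvar k * p) = Zvar k * hop i p - scale_pm 2 (Zvar (k + i) * p)"
proof (rule linear_Zpoly_eqI[where p = p])
  fix M
  have "hop i (Zvar k * Zmon M) = scale_pm (- 2) (Zvar (k + i) * Zmon M)
     + (\<Sum>m\<in>#M. scale_pm (- 2) (Zvar (m + i) * Zmon (add_mset k M - {#m#})))"
    unfolding Zmon_add[of k M, symmetric] hop_Zmon hop_mon_def by simp
  also have "(\<Sum>m\<in>#M. scale_pm (- 2) (Zvar (m + i) * Zmon (add_mset k M - {#m#})))
     = (\<Sum>m\<in>#M. Zvar k * scale_pm (- 2) (Zvar (m + i) * Zmon (M - {#m#})))"
    by (intro arg_cong[where f = sum_mset] image_mset_cong) (simp add: Zmon_add scale_pm_commute mult.left_commute)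
  also have "\<dots> = Zvar k * hop i (Zmon M)" by (simp add: hop_Zmon hop_mon_def mult_sum_mset)
  finally show "hop i (Zvar k * Zmon M) = Zvar k * hop i (Zmon M) - scale_pm 2 (Zvar (k + i) * Zmon M)"
    by (simp add: scale_pm_minus_left)
qed (auto intro!: linear_pm_intros linear_hop linear_hop')

lemma eop_Zvar: "eop i (Zvar k * p) = Zvar k * eop i p + hop (k + i) p"
proof (rule linear_Zpoly_eqI[where p = p])
  fix M
  have "eop i (Zvar k * Zmon M) = scale_pm (1/2) (hop (k + i) (Zmon M))
     + (\<Sum>m\<in>#M. scale_pm (1/2) (hop (m + i) (Zmon (add_mset k M - {#m#}))))"
    by (simp flip: Zmon_add) (simp add: eop_Zmon eop_mon_def)
  also have "(\<Sum>m\<in>#M. scale_pm (1/2) (hop (m + i) (Zmon (add_mset k M - {#m#}))))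
     = (\<Sum>m\<in>#M. Zvar k * scale_pm (1/2) (hop (m + i) (Zmon (M - {#m#})))
          + scale_pm (1/2) (scale_pm (- 2) (Zvar (m + (k + i)) * Zmon (M - {#m#}))))"
    by (intro arg_cong[where f = sum_mset] image_mset_cong)
       (simp add: Zmon_add hop_Zvar scale_pm_diff scale_pm_commute scale_pm_minus_left scale_pm_uminus ac_simps)
  also have "\<dots> = Zvar k * eop i (Zmon M) + scale_pm (1/2) (hop (k + i) (Zmon M))"
  proof -
    have "(\<Sum>m\<in>#M. scale_pm (1/2) (f m)) = scale_pm (1/2) (\<Sum>m\<in>#M. f m)" for f :: "nat \<Rightarrow> Zpoly" and M
      by (induction M) (simp_all add: scale_pm_add)
    note half = this
    have "(\<Sum>m\<in>#M. Zvar k * scale_pm (1/2) (hop (m + i) (Zmon (M - {#m#})))) = Zvar k * eop i (Zmon M)"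
      by (simp only: eop_Zmon eop_mon_def mult_sum_mset)
    moreover have "(\<Sum>m\<in>#M. scale_pm (1/2) (scale_pm (- 2) (Zvar (m + (k + i)) * Zmon (M - {#m#}))))
       = scale_pm (1/2) (hop (k + i) (Zmon M))"
      by (simp only: half hop_Zmon hop_mon_def)
    ultimately show ?thesis by (simp only: sum_mset.distrib)
  qed
  finally have "eop i (Zvar k * Zmon M) = Zvar k * eop i (Zmon M) +
     (scale_pm (1/2) (hop (k + i) (Zmon M)) + scale_pm (1/2) (hop (k + i) (Zmon M)))" by simp
  then show "eop i (Zvar k * Zmon M) = Zvar k * eop i (Zmon M) + hop (k + i) (Zmon M)"
    by (simp flip: scale_pm_add_left)
qed (auto intro!: linear_pm_intros linear_hop linear_eop linear_eop')

lemma hop_1: "hop i 1 = 0" and eop_1: "eop i 1 = 0"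
  using hop_Zmon[of i "{#}"] eop_Zmon[of i "{#}"] by (simp_all add: Zmon_empty hop_mon_def eop_mon_def)

text \<open>For commutator identities: an operator that kills 1 and whose kernel is stable under the variables vanishes.\<close>

lemma Zpoly_operator_zero:
  assumes "linear_pm D" and "D 1 = 0" and "\<And>k p. D p = 0 \<Longrightarrow> D (Zvar k * p) = 0"
  shows "D p = 0"
proof (rule linear_Zpoly_eqI[where p = p and g = "\<lambda>p. 0"])
  fix M show "D (Zmon M) = 0"
    by (induction M) (simp_all add: Zmon_empty assms(2) Zmon_add assms(3))
qed (auto intro: linear_pm_intros assms(1))

lemma hop_commute: "hop i (hop j p) = hop j (hop i p)"
proof -
  have "hop i (hop j p) - hop j (hop i p) = 0"
    by (rule Zpoly_operator_zero[where p = p])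
      (auto intro!: linear_pm_intros linear_hop linear_hop'
        simp: hop_1 hop_Zvar linear_pm_simps[OF linear_hop] scale_pm_diff right_diff_distrib scale_pm_commute add.assoc add.commute[of i j])
  then show ?thesis by simp
qed

lemma hop_eop: "hop i (eop j p) - eop j (hop i p) = scale_pm 2 (eop (i + j) p)"
proof -
  have "hop i (eop j p) - eop j (hop i p) - scale_pm 2 (eop (i + j) p) = 0"
    by (rule Zpoly_operator_zero[where p = p])
      (auto intro!: linear_pm_intros linear_hop linear_hop' linear_eop linear_eop'
       simp: hop_1 hop_Zvar eop_1 eop_Zvar linear_pm_simps[OF linear_hop] linear_pm_simps[OF linear_eop]
         scale_pm_add hop_commute[of "k + j" i for k] diff_eq_eq distrib_left scale_pm_commute add_ac)
  then show ?thesis by simp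
qed

lemma hop_eop': "hop i (eop j p) = eop j (hop i p) + scale_pm 2 (eop (i + j) p)"
  using hop_eop[of i j p] by (simp add: algebra_simps)

lemma eop_commute: "eop i (eop j p) = eop j (eop i p)"
proof -
  have "eop i (eop j p) - eop j (eop i p) = 0"
  proof (rule Zpoly_operator_zero[where p = p])
    fix k p assume "eop i (eop j p) - eop j (eop i p) = 0"
    then show "eop i (eop j (Zvar k * p)) - eop j (eop i (Zvar k * p)) = 0"
      using hop_eop[of "k + j" i p] hop_eop[of "k + i" j p]
      by (simp add: eop_Zvar linear_pm_simps[OF linear_eop] diff_eq_eq add_ac)
  qed (auto intro!: linear_pm_intros linear_eop linear_eop' simp: eop_1 linear_pm_simps[OF linear_eop])
  then show ?thesis by simp
qed

fun annihilators :: "affine_basis \<Rightarrow> bool" where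
  "annihilators (Loop sl2_e n) = (n \<ge> 0)"
| "annihilators (Loop sl2_f n) = (n \<ge> 1)"
| "annihilators (Loop sl2_h n) = (n \<ge> 1)"
| "annihilators Central = True"

fun whittaker_char :: "complex \<Rightarrow> complex \<Rightarrow> affine_basis \<Rightarrow> complex" where
  "whittaker_char lam mu (Loop sl2_e n) = (if n = 0 then lam else 0)"
| "whittaker_char lam mu (Loop sl2_f n) = (if n = 1 then mu else 0)"
| "whittaker_char lam mu (Loop sl2_h n) = 0"
| "whittaker_char lam mu Central = - 2"

fun creation_rep :: "affine_basis \<Rightarrow> Zpoly \<Rightarrow> Zpoly" where
  "creation_rep (Loop sl2_e n) p = eop (nat (- n)) p"
| "creation_rep (Loop sl2_f n) p = Zvar (nat (- n)) * p"
| "creation_rep (Loop sl2_h n) p = hop (nat (- n)) p"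
| "creation_rep Central p = 0"

lemma nat_neg_add: "n \<le> 0 \<Longrightarrow> m \<le> 0 \<Longrightarrow> nat (- n - m) = nat (- n) + nat (- m)"
  by linarith

text \<open>The vectors with \<open>annihilators\<close> span the subalgebra of the Whittaker character; its value on a
  bracket of two of them is zero.\<close>

interpretation whittaker: lie_splitting "Collect annihilators" "whittaker_char lam mu" creation_rep 1
  for lam mu
proof
  fix a b p
  assume "a \<notin> Collect annihilators"
  then show "linear_pm (creation_rep a)"
    by (cases a rule: annihilators.cases)
      (auto simp: linear_pm_def linear_pm_simps[OF linear_hop] linear_pm_simps[OF linear_eop] distrib_left scale_pm_commute)
next
  fix a b p
  assume "a \<in> Collect annihilators" and "b \<in> Collect annihilators"
  then show "keys (br a b) \<subseteq> Collect annihilators"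
    by (cases a rule: annihilators.cases; cases b rule: annihilators.cases) auto
next
  fix a b p
  assume "a \<in> Collect annihilators" and "b \<in> Collect annihilators"
  then show "lin_ext (\<lambda>l. scale_pm (whittaker_char lam mu l) p) (br a b) = 0"
    by (cases a rule: annihilators.cases; cases b rule: annihilators.cases)
      (simp_all add: linear_pm_simps[OF linear_lin_ext])
next
  fix a b p
  assume "a \<notin> Collect annihilators" and "b \<notin> Collect annihilators"
  then show "keys (br a b) \<inter> Collect annihilators = {}"
    by (cases a rule: annihilators.cases; cases b rule: annihilators.cases) auto
next
  fix a b p
  assume "a \<notin> Collect annihilators" and "b \<notin> Collect annihilators"
  then show "lin_ext (\<lambda>l. creation_rep l p) (br a b) = creation_rep a (creation_rep b p) - creation_rep b (creation_rep a p)"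
    by (cases a rule: annihilators.cases; cases b rule: annihilators.cases)
      (simp_all add: linear_pm_simps[OF linear_lin_ext] eop_Zvar hop_Zvar nat_neg_add scale_pm_minus_left
        eop_commute hop_commute hop_eop' add.commute)
qed

section \<open>Generators and relations of the enveloping algebra\<close>

lemma uea_scalar_simps:
  "uea_scalar 0 = 0" "uea_scalar 1 = 1" "uea_scalar (r + s) = uea_scalar r + uea_scalar s"
  "uea_scalar (r * s) = uea_scalar r * uea_scalar s" "uea_scalar (- r) = - uea_scalar r"
  "uea_scalar (r - s) = uea_scalar r - uea_scalar s"
proof -
  have *: "x = y \<Longrightarrow> x - y \<in> uea_ideal" for x y by (simp add: uea_ideal_0)
  show "uea_scalar 0 = 0" "uea_scalar 1 = 1" "uea_scalar (r + s) = uea_scalar r + uea_scalar s"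
  "uea_scalar (r * s) = uea_scalar r * uea_scalar s" "uea_scalar (- r) = - uea_scalar r"
  "uea_scalar (r - s) = uea_scalar r - uea_scalar s"
    by (transfer, rule *, simp add: single_add mult_single single_uminus single_diff)+
qed

lemma uea_scalar_of_int: "uea_scalar (of_int i) = of_int i"
proof -
  have "uea_scalar (of_nat n) = of_nat n" for n
    by (induction n) (simp_all add: uea_scalar_simps)
  then show ?thesis by (cases i) (simp_all add: uea_scalar_simps)
qed

lemma uea_scalar_numeral [simp]: "uea_scalar (numeral n) = numeral n"
  using uea_scalar_of_int[of "numeral n"] by simp

lemma uea_scalar_01 [simp]: "uea_scalar 0 = 0" "uea_scalar 1 = 1" "uea_scalar (- r) = - uea_scalar r"
  by (simp_all add: uea_scalar_simps)

lemma uea_scalar_central: "u * uea_scalar r = uea_scalar r * u"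
proof (transfer)
  fix u :: affine_tensor and r
  have "u * single 0 r = single 0 r * u"
    using scale_pm_commute[of u r 1] by (simp add: scale_pm_mult)
  then show "u * single 0 r - single 0 r * u \<in> uea_ideal" by (simp add: uea_ideal_0)
qed

lemma uea_scalar_left_central: "u * (uea_scalar r * v) = uea_scalar r * (u * v)"
  by (metis mult.assoc uea_scalar_central)

lemma uea_incl_add: "uea_incl (x + y) = uea_incl x + uea_incl y"
  by transfer (simp add: linear_pm_simps[OF linear_tensor_incl] uea_ideal_0)

lemma uea_incl_scale: "uea_incl (scale_pm r x) = uea_scalar r * uea_incl x"
  by transfer (simp add: linear_pm_simps[OF linear_tensor_incl] uea_ideal_0 scale_pm_mult)

lemma uea_incl_0 [simp]: "uea_incl 0 = 0"
  using uea_incl_scale[of 0 0] by simp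

lemma uea_incl_commutator: "uea_incl x * uea_incl y - uea_incl y * uea_incl x = uea_incl (affine_bracket x y)"
proof transfer
  fix x y
  show "tensor_incl x * tensor_incl y - tensor_incl y * tensor_incl x - tensor_incl (affine_bracket x y) \<in> uea_ideal"
    unfolding uea_ideal_def by (rule hull_inc) (auto simp: uea_relations_def)
qed

definition uea_gen :: "affine_basis \<Rightarrow> affine_uea" where "uea_gen a = uea_incl (bvec a)"

lemma uea_incl_single: "uea_incl (single a r) = uea_scalar r * uea_gen a"
  using uea_incl_scale[of r "bvec a"] by (simp add: uea_gen_def)

lemma uea_gen_induct [case_names scalar add gen]:
  assumes scalar: "\<And>r. P (uea_scalar r)" and add: "\<And>u v. P u \<Longrightarrow> P v \<Longrightarrow> P (u + v)"
    and gen: "\<And>a u. P u \<Longrightarrow> P (uea_gen a * u)"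
  shows "P u"
proof -
  have "P (abs_affine_uea p)" for p
  proof (induction p rule: poly_mapping_induct')
    case (single k r)
    have "P (abs_affine_uea (single (Word v) r))" for v
    proof (induction v)
      case Nil
      then show ?case using scalar[of r] by (simp add: uea_scalar.abs_eq zero_free_mon_def)
    next
      case (Cons a v)
      have "abs_affine_uea (single (Word (a # v)) r)
          = uea_gen a * abs_affine_uea (single (Word v) r)"
        by (simp add: uea_gen_def uea_incl.abs_eq times_affine_uea.abs_eq mult_single)
      then show ?case using gen[OF Cons] by simp
    qed
    then show ?case by (cases k) simp
  next
    case (add p q)
    from assms(2)[OF this] show ?case by (simp add: plus_affine_uea.abs_eq)
  qed
  then show ?thesis by (metis affine_uea.abs_induct)
qed

definition ue :: "int \<Rightarrow> affine_uea" where "ue n = uea_incl (e_at n)"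
definition uf :: "int \<Rightarrow> affine_uea" where "uf n = uea_incl (f_at n)"
definition uh :: "int \<Rightarrow> affine_uea" where "uh n = uea_incl (h_at n)"
definition uc :: "affine_uea" where "uc = uea_incl central"

lemma uea_gen_eq: "uea_gen (Loop sl2_e n) = ue n" "uea_gen (Loop sl2_f n) = uf n"
  "uea_gen (Loop sl2_h n) = uh n" "uea_gen Central = uc"
  by (simp_all add: ue_def uf_def uh_def uc_def e_at_def f_at_def h_at_def central_def uea_gen_def)

lemma uea_gen_commutator:
  "uea_gen a * uea_gen b = uea_gen b * uea_gen a + uea_incl (br a b)"
  using uea_incl_commutator[of "bvec a" "bvec b"]
  by (simp add: uea_gen_def algebra_simps)

lemma uc_central: "uc * u = u * uc"
proof (induction u rule: uea_gen_induct)
  case (scalar r)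
  show ?case by (simp add: uea_scalar_central)
next
  case (gen a u)
  have "uc * uea_gen a = uea_gen a * uc"
    using uea_gen_commutator[of Central a] by (simp add: uea_gen_eq)
  with gen show ?case by (metis mult.assoc)
qed (simp add: algebra_simps)

lemma ue_uf: "ue m * uf n = uf n * ue m + uh (m + n) + (if m + n = 0 then of_int m * uc else 0)"
  and uh_ue: "uh m * ue n = ue n * uh m + 2 * ue (m + n)"
  and uh_uf: "uh m * uf n = uf n * uh m - 2 * uf (m + n)"
  and uh_uh: "uh m * uh n = uh n * uh m + (if m + n = 0 then 2 * of_int m * uc else 0)"
  and ue_ue: "ue m * ue n = ue n * ue m"
  and uf_uf: "uf m * uf n = uf n * uf m"
proof -
  note c = uea_incl_add uea_incl_single uea_gen_eq uea_scalar_of_int uea_scalar_simps(4)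
  show "ue m * uf n = uf n * ue m + uh (m + n) + (if m + n = 0 then of_int m * uc else 0)"
    using uea_gen_commutator[of "Loop sl2_e m" "Loop sl2_f n"] by (auto simp add: c)
  show "uh m * ue n = ue n * uh m + 2 * ue (m + n)"
    using uea_gen_commutator[of "Loop sl2_h m" "Loop sl2_e n"] by (auto simp add: c)
  show "uh m * uf n = uf n * uh m - 2 * uf (m + n)"
    using uea_gen_commutator[of "Loop sl2_h m" "Loop sl2_f n"] by (auto simp add: c)
  show "uh m * uh n = uh n * uh m + (if m + n = 0 then 2 * of_int m * uc else 0)"
    using uea_gen_commutator[of "Loop sl2_h m" "Loop sl2_h n"] by (auto simp add: c mult.commute[of _ "2::complex"])
  show "ue m * ue n = ue n * ue m" "uf m * uf n = uf n * uf m"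
    using uea_gen_commutator[of "Loop sl2_e m" "Loop sl2_e n"] uea_gen_commutator[of "Loop sl2_f m" "Loop sl2_f n"]
    by (auto simp add: c)
qed

lemma uea_induct [case_names scalar add e f h c]:
  assumes "\<And>r. P (uea_scalar r)" "\<And>u v. P u \<Longrightarrow> P v \<Longrightarrow> P (u + v)"
    and "\<And>n u. P u \<Longrightarrow> P (ue n * u)" "\<And>n u. P u \<Longrightarrow> P (uf n * u)" "\<And>n u. P u \<Longrightarrow> P (uh n * u)"
    and "\<And>u. P u \<Longrightarrow> P (uc * u)"
  shows "P u"
proof (induction u rule: uea_gen_induct)
  case (gen a u)
  then show ?case using assms(3-6)
    by (cases a rule: annihilators.cases) (auto simp: uea_gen_eq)
qed (use assms in auto)

section \<open>Left ideals\<close>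

lemma left_idealD:
  assumes "left_ideal L"
  shows "0 \<in> L" "x \<in> L \<Longrightarrow> y \<in> L \<Longrightarrow> x + y \<in> L" "x \<in> L \<Longrightarrow> a * x \<in> L"
    "x \<in> L \<Longrightarrow> - x \<in> L" "x \<in> L \<Longrightarrow> y \<in> L \<Longrightarrow> x - y \<in> L"
proof -
  show *: "0 \<in> L" "x \<in> L \<Longrightarrow> y \<in> L \<Longrightarrow> x + y \<in> L" "x \<in> L \<Longrightarrow> a * x \<in> L" for x y a
    using assms by (auto simp: left_ideal_def)
  show m: "x \<in> L \<Longrightarrow> - x \<in> L" for x using *(3)[of x "- 1"] by simp
  show "x \<in> L \<Longrightarrow> y \<in> L \<Longrightarrow> x - y \<in> L" using *(2)[of x "- y"] m by simp
qed

lemma left_ideal_sum: "left_ideal L \<Longrightarrow> (\<And>i. i \<in> A \<Longrightarrow> f i \<in> L) \<Longrightarrow> sum f A \<in> L"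
  by (induction A rule: infinite_finite_induct) (auto simp: left_idealD)

lemma left_ideal_hull: "left_ideal (left_ideal hull S)"
  by (rule hull_in) (auto simp: left_ideal_def)

definition mod_eq :: "affine_uea set \<Rightarrow> affine_uea \<Rightarrow> affine_uea \<Rightarrow> bool" where
  "mod_eq L u v \<longleftrightarrow> u - v \<in> L"

locale uea_left_ideal =
  fixes L :: "affine_uea set"
  assumes left_ideal: "left_ideal L"
begin

abbreviation congr :: "affine_uea \<Rightarrow> affine_uea \<Rightarrow> bool" (infix "\<approx>" 50) where
  "u \<approx> v \<equiv> mod_eq L u v"

lemmas mem = left_idealD[OF left_ideal]
lemmas mem_sum = left_ideal_sum[OF left_ideal]

lemma congr_refl [simp, intro]: "u \<approx> u" by (simp add: mod_eq_def mem)
lemma congr_sym: "u \<approx> v \<Longrightarrow> v \<approx> u" using mem(4)[of "u - v"] by (simp add: mod_eq_def)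
lemma congr_trans [trans]: "u \<approx> v \<Longrightarrow> v \<approx> w \<Longrightarrow> u \<approx> w" using mem(2)[of "u - v" "v - w"] by (simp add: mod_eq_def)
lemma congr_add: "u \<approx> v \<Longrightarrow> u' \<approx> v' \<Longrightarrow> u + u' \<approx> v + v'"
  using mem(2)[of "u - v" "u' - v'"] by (simp add: mod_eq_def algebra_simps)
lemma congr_diff: "u \<approx> v \<Longrightarrow> u' \<approx> v' \<Longrightarrow> u - u' \<approx> v - v'"
  using mem(5)[of "u - v" "u' - v'"] by (simp add: mod_eq_def algebra_simps)
lemma congr_mult: "u \<approx> v \<Longrightarrow> a * u \<approx> a * v"
  using mem(3)[of "u - v" a] by (simp add: mod_eq_def algebra_simps)
lemma congr_0: "u \<approx> 0 \<longleftrightarrow> u \<in> L" by (simp add: mod_eq_def)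
lemma congr_sum: "(\<And>i. i \<in> A \<Longrightarrow> f i \<approx> g i) \<Longrightarrow> sum f A \<approx> sum g A"
  by (induction A rule: infinite_finite_induct) (auto intro: congr_add)
end

text \<open>The generators of the Whittaker ideal in uniform notation: the cases \<open>e(0)\<close> and \<open>f(1)\<close> are absorbed by the
  conditionals.\<close>

lemma whittaker_ideal_generators:
  "n \<ge> 0 \<Longrightarrow> ue n - uea_scalar (if n = 0 then lam else 0) \<in> whittaker_ideal lam mu"
  "n \<ge> 1 \<Longrightarrow> uf n - uea_scalar (if n = 1 then mu else 0) \<in> whittaker_ideal lam mu"
  "n \<ge> 1 \<Longrightarrow> uh n \<in> whittaker_ideal lam mu"
  "uc + 2 \<in> whittaker_ideal lam mu"
proof -
  show "ue n - uea_scalar (if n = 0 then lam else 0) \<in> whittaker_ideal lam mu" if "n \<ge> 0"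
    unfolding whittaker_ideal_def by (rule hull_inc) (use that in \<open>auto simp: ue_def\<close>)
  have "uf n = uea_incl (f_at (n - 1 + 1))" by (simp add: uf_def)
  then show "uf n - uea_scalar (if n = 1 then mu else 0) \<in> whittaker_ideal lam mu" if "n \<ge> 1"
    unfolding whittaker_ideal_def by (intro hull_inc) (use that in \<open>auto simp: uf_def intro!: exI[of _ "n - 1"]\<close>)
  show "uh n \<in> whittaker_ideal lam mu" if "n \<ge> 1"
    unfolding whittaker_ideal_def by (rule hull_inc) (use that in \<open>auto simp: uh_def\<close>)
  show "uc + 2 \<in> whittaker_ideal lam mu"
    unfolding whittaker_ideal_def by (rule hull_inc) (auto simp: uc_def)
qed

lemma left_ideal_whittaker: "left_ideal (whittaker_ideal lam mu)"
  unfolding whittaker_ideal_def by (rule left_ideal_hull)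

lemma whittaker_ideal_minimal:
  assumes "left_ideal L" "\<And>n. n \<ge> 0 \<Longrightarrow> ue n - uea_scalar (if n = 0 then lam else 0) \<in> L"
    "\<And>n. n \<ge> 1 \<Longrightarrow> uf n - uea_scalar (if n = 1 then mu else 0) \<in> L"
    "\<And>n. n \<ge> 1 \<Longrightarrow> uh n \<in> L" "uc + 2 \<in> L"
  shows "whittaker_ideal lam mu \<subseteq> L"
  unfolding whittaker_ideal_def
proof (rule hull_minimal)
  have e: "uea_incl (e_at i) \<in> L" if "1 \<le> i" for i using assms(2)[of i] that by (simp add: ue_def)
  have f: "uea_incl (f_at (i + 1)) \<in> L" if "1 \<le> i" for i using assms(3)[of "i + 1"] that by (simp add: uf_def)
  show "{uea_incl (e_at 0) - uea_scalar lam, uea_incl (f_at 1) - uea_scalar mu, uea_incl central + uea_scalar 2} \<union>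
    {uea_incl (e_at i) |i. 1 \<le> i} \<union> {uea_incl (h_at i) |i. 1 \<le> i} \<union> {uea_incl (f_at (i + 1)) |i. 1 \<le> i} \<subseteq> L"
    using e f assms(2)[of 0] assms(3)[of 1] assms(4,5)
    by (auto simp: ue_def uf_def uh_def uc_def)
qed (rule assms)

lift_definition whittaker_functional :: "complex \<Rightarrow> complex \<Rightarrow> affine_uea \<Rightarrow> Zpoly" is whittaker.Psi
proof -
  fix lam mu p q assume "p - q \<in> uea_ideal"
  from whittaker.Psi_uea_ideal[OF this] show "whittaker.Psi lam mu p = whittaker.Psi lam mu q"
    by (simp add: linear_pm_simps[OF whittaker.linear_Psi])
qed

lemma whittaker_functional_add:
  "whittaker_functional lam mu (u + v) = whittaker_functional lam mu u + whittaker_functional lam mu v"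
  by transfer (simp add: linear_pm_simps[OF whittaker.linear_Psi])

lemma whittaker_functional_diff:
  "whittaker_functional lam mu (u - v) = whittaker_functional lam mu u - whittaker_functional lam mu v"
  by transfer (simp add: linear_pm_simps[OF whittaker.linear_Psi])

lemma whittaker_functional_sum:
  "whittaker_functional lam mu (sum g S) = (\<Sum>s\<in>S. whittaker_functional lam mu (g s))"
proof (induction S rule: infinite_finite_induct)
  case (insert x S) then show ?case by (simp add: whittaker_functional_add)
qed (use whittaker_functional_diff[of lam mu 0 0] in auto)

lemma whittaker_functional_scalar:
  "whittaker_functional lam mu (uea_scalar r * u) = scale_pm r (whittaker_functional lam mu u)"
  by transfer (simp add: linear_pm_simps[OF whittaker.linear_Psi] flip: scale_pm_mult)

lemma whittaker_functional_1: "whittaker_functional lam mu 1 = 1"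
  by transfer (rule whittaker.Psi_1)

lemma whittaker_functional_creation:
  "n < 0 \<Longrightarrow> whittaker_functional lam mu (ue n * u) = eop (nat (- n)) (whittaker_functional lam mu u)"
  "n \<le> 0 \<Longrightarrow> whittaker_functional lam mu (uf n * u) = Zvar (nat (- n)) * whittaker_functional lam mu u"
  "n \<le> 0 \<Longrightarrow> whittaker_functional lam mu (uh n * u) = hop (nat (- n)) (whittaker_functional lam mu u)"
proof -
  have gen: "whittaker_functional lam mu (uea_gen a * u) = creation_rep a (whittaker_functional lam mu u)"
    if "\<not> annihilators a" for a
    unfolding uea_gen_def using that by transfer (simp add: whittaker.Psi_M)
  show "n < 0 \<Longrightarrow> whittaker_functional lam mu (ue n * u) = eop (nat (- n)) (whittaker_functional lam mu u)"
    "n \<le> 0 \<Longrightarrow> whittaker_functional lam mu (uf n * u) = Zvar (nat (- n)) * whittaker_functional lam mu u"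
    "n \<le> 0 \<Longrightarrow> whittaker_functional lam mu (uh n * u) = hop (nat (- n)) (whittaker_functional lam mu u)"
    using gen[of "Loop sl2_e n"] gen[of "Loop sl2_f n"] gen[of "Loop sl2_h n"] by (simp_all add: uea_gen_eq)
qed

lemma whittaker_functional_gen_right:
  "annihilators a \<Longrightarrow> whittaker_functional lam mu (u * uea_gen a) = scale_pm (whittaker_char lam mu a) (whittaker_functional lam mu u)"
  unfolding uea_gen_def by (transfer) (simp add: whittaker.Psi_right)

lemma whittaker_functional_ideal: "u \<in> whittaker_ideal lam mu \<Longrightarrow> whittaker_functional lam mu u = 0"
proof -
  let ?L = "{u. \<forall>a. whittaker_functional lam mu (a * u) = 0}"
  have r: "whittaker_functional lam mu (a * uea_scalar r) = scale_pm r (whittaker_functional lam mu a)" for a r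
    by (simp add: uea_scalar_central whittaker_functional_scalar)
  have "whittaker_ideal lam mu \<subseteq> ?L"
  proof (rule whittaker_ideal_minimal)
    show "left_ideal ?L"
      unfolding left_ideal_def
    proof (intro conjI ballI allI)
      show "0 \<in> ?L" using whittaker_functional_add[of lam mu 0 0] by simp
    qed (auto simp: distrib_left whittaker_functional_add simp flip: mult.assoc)
    show "uc + 2 \<in> ?L"
      using whittaker_functional_gen_right[of Central] r[of _ 2]
      by (simp add: uea_gen_eq distrib_left whittaker_functional_add flip: scale_pm_add_left)
    fix n :: int
    show "n \<ge> 0 \<Longrightarrow> ue n - uea_scalar (if n = 0 then lam else 0) \<in> ?L"
      using whittaker_functional_gen_right[of "Loop sl2_e n" lam mu]
      by (auto simp: uea_gen_eq right_diff_distrib whittaker_functional_diff r)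
    show "n \<ge> 1 \<Longrightarrow> uf n - uea_scalar (if n = 1 then mu else 0) \<in> ?L"
      using whittaker_functional_gen_right[of "Loop sl2_f n" lam mu]
      by (auto simp: uea_gen_eq right_diff_distrib whittaker_functional_diff r)
    show "n \<ge> 1 \<Longrightarrow> uh n \<in> ?L"
      using whittaker_functional_gen_right[of "Loop sl2_h n" lam mu]
      by (auto simp: uea_gen_eq)
  qed
  then show "u \<in> whittaker_ideal lam mu \<Longrightarrow> whittaker_functional lam mu u = 0"
    by (metis (mono_tags, lifting) mem_Collect_eq mult_1 subset_iff)
qed

section \<open>The Sugawara operators at the critical level\<close>

lemma ue_uf_left: "ue m * (uf n * u) = uf n * (ue m * u) + uh (m + n) * u + (if m + n = 0 then of_int m * (uc * u) else 0)"
  and uh_ue_left: "uh m * (ue n * u) = ue n * (uh m * u) + 2 * (ue (m + n) * u)"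
  and uh_uf_left: "uh m * (uf n * u) = uf n * (uh m * u) - 2 * (uf (m + n) * u)"
  and uh_uh_left: "uh m * (uh n * u) = uh n * (uh m * u) + (if m + n = 0 then 2 * of_int m * (uc * u) else 0)"
  and ue_ue_left: "ue m * (ue n * u) = ue n * (ue m * u)"
  unfolding mult.assoc[symmetric] ue_uf[of m n] uh_ue[of m n] uh_uf[of m n] uh_uh[of m n] ue_ue[of m n]
  by (auto simp: distrib_right left_diff_distrib)

text \<open>Normal ordered products and the Sugawara sums as elements of the enveloping algebra. Only partial sums exist
  there; on a vector of a Whittaker quotient they become constant.\<close>

definition nop :: "(int \<Rightarrow> affine_uea) \<Rightarrow> int \<Rightarrow> (int \<Rightarrow> affine_uea) \<Rightarrow> int \<Rightarrow> affine_uea" where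
  "nop x k y m = (if k < 0 then x k * y m else y m * x k)"

definition sug_term :: "int \<Rightarrow> int \<Rightarrow> affine_uea" where
  "sug_term n k = nop ue k uf (n - k) + nop uf k ue (n - k) + uea_scalar (1/2) * nop uh k uh (n - k)"

definition sug_partial :: "int \<Rightarrow> int \<Rightarrow> affine_uea" where
  "sug_partial n N = uea_scalar (1/2) * (\<Sum>k = -N..N. sug_term n k)"

text \<open>The bound \<open>\<bar>n\<bar> + 2\<close> exhausts the support of the sum for \<open>T(n)w\<close>: outside it the factor applied first
  to the vector \<open>w\<close> has index at least 3.\<close>

definition sug_elt :: "int \<Rightarrow> affine_uea" where
  "sug_elt n = sug_partial n (\<bar>n\<bar> + 2)"

lemma scalar_half: "uea_scalar (1/2) * (2 * u) = u"
  using uea_scalar_simps(4)[of "1/2" 2] by (simp flip: mult.assoc)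

text \<open>The number of indices for which the shift by \<open>m\<close> changes the normal ordering, counted with sign.\<close>

lemma sum_order_switch: "N \<ge> \<bar>m\<bar> \<Longrightarrow>
  (\<Sum>k = -N..N. if k < 0 \<and> 0 \<le> k + m then 1 else if k + m < 0 \<and> 0 \<le> k then - 1 else 0) = (m::int)"
proof (cases "m \<ge> 0")
  case True
  assume N: "N \<ge> \<bar>m\<bar>"
  have "(\<Sum>k = -N..N. if k < 0 \<and> 0 \<le> k + m then 1 else if k + m < 0 \<and> 0 \<le> k then - 1 else 0)
    = (\<Sum>k = -N..N. if k \<in> {-m..<0} then 1 else (0::int))"
    using True by (intro sum.cong) auto
  also have "\<dots> = (\<Sum>k\<in>{-m..<0}. 1)"
    using True N by (subst sum.inter_restrict[symmetric]) (auto intro!: sum.cong simp del: sum_constant)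
  finally show ?thesis using True by simp
next
  case False
  assume N: "N \<ge> \<bar>m\<bar>"
  have "(\<Sum>k = -N..N. if k < 0 \<and> 0 \<le> k + m then 1 else if k + m < 0 \<and> 0 \<le> k then - 1 else 0)
    = (\<Sum>k = -N..N. if k \<in> {0..<-m} then -1 else (0::int))"
    using False by (intro sum.cong) auto
  also have "\<dots> = (\<Sum>k\<in>{0..<-m}. -1)"
    using False N by (subst sum.inter_restrict[symmetric]) (auto intro!: sum.cong simp del: sum_constant)
  finally show ?thesis using False by simp
qed

locale whittaker_quotient = uea_left_ideal L for L +
  fixes lam mu :: complex
  assumes whittaker_subset: "whittaker_ideal lam mu \<subseteq> L"
begin

lemma e_vac: "n \<ge> 0 \<Longrightarrow> ue n \<approx> uea_scalar (if n = 0 then lam else 0)"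
  and f_vac: "n \<ge> 1 \<Longrightarrow> uf n \<approx> uea_scalar (if n = 1 then mu else 0)"
  and h_vac: "n \<ge> 1 \<Longrightarrow> uh n \<approx> 0"
  using subsetD[OF whittaker_subset whittaker_ideal_generators(1)[of n lam mu]]
    subsetD[OF whittaker_subset whittaker_ideal_generators(2)[of n mu lam]]
    subsetD[OF whittaker_subset whittaker_ideal_generators(3)[of n lam mu]] by (simp_all add: mod_eq_def)

lemma c_act: "uc * u \<approx> - 2 * u"
  using mem(3)[OF subsetD[OF whittaker_subset whittaker_ideal_generators(4)], of u]
  by (simp add: mod_eq_def uc_central algebra_simps mult_2 mult_2_right)

definition smooth :: "(int \<Rightarrow> affine_uea) \<Rightarrow> bool" where
  "smooth x \<longleftrightarrow> (\<forall>u. \<exists>K. \<forall>k\<ge>K. x k * u \<in> L)"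

lemma smooth_efh: "smooth ue" "smooth uf" "smooth uh"
proof -
  have "\<exists>K. \<forall>k\<ge>K. \<forall>x. uea_gen (Loop x k) * u \<in> L" for u
  proof (induction u rule: uea_gen_induct)
    case (scalar r)
    have "uea_gen (Loop x k) * uea_scalar r \<in> L" if "k \<ge> 2" for x k
      using e_vac[of k] f_vac[of k] h_vac[of k] that
      by (cases x) (auto simp: uea_gen_eq uea_scalar_central mod_eq_def intro: mem)
    then show ?case by blast
  next
    case (add u v)
    then obtain K K' where "\<And>k x. k \<ge> K \<Longrightarrow> uea_gen (Loop x k) * u \<in> L" "\<And>k x. k \<ge> K' \<Longrightarrow> uea_gen (Loop x k) * v \<in> L"
      by blast
    then show ?case by (intro exI[of _ "max K K'"]) (simp add: distrib_left mem)
  next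
    case (gen a u)
    then obtain K where K: "\<And>k x. k \<ge> K \<Longrightarrow> uea_gen (Loop x k) * u \<in> L" by blast
    have swap: "uea_gen b * (uea_gen a * u) = uea_gen a * (uea_gen b * u) + uea_incl (br b a) * u" for b
      using arg_cong[OF uea_gen_commutator[of b a], of "\<lambda>y. y * u"] by (simp add: distrib_right mult.assoc)
    show ?case
    proof (cases a)
      case (Loop y n)
      have "uea_incl (br (Loop x k) a) * u \<in> L" if "k \<ge> \<bar>K\<bar> + \<bar>n\<bar> + 1" for x k
        using K[of "k + n"] that unfolding Loop
        by (cases x; cases y) (auto simp: uea_incl_single mult.assoc mem)
      then show ?thesis using K by (intro exI[of _ "\<bar>K\<bar> + \<bar>n\<bar> + 1"]) (auto simp: swap intro!: mem(2) mem(3)[OF K])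
    next
      case Central
      then have "uea_gen (Loop x k) * (uea_gen a * u) = uea_gen a * (uea_gen (Loop x k) * u)" for x k
        using swap[of "Loop x k"] by simp
      then show ?thesis using K by (intro exI[of _ K]) (auto intro: mem(3))
    qed
  qed
  then have "\<exists>K. \<forall>k\<ge>K. uea_gen (Loop x k) * u \<in> L" for x u by blast
  from this[of sl2_e] this[of sl2_f] this[of sl2_h] show "smooth ue" "smooth uf" "smooth uh"
    by (simp_all add: smooth_def uea_gen_eq)
qed

lemma smooth_uminus: "smooth x \<Longrightarrow> smooth (\<lambda>n. - x n)"
  by (auto simp: smooth_def) (metis mem(4) minus_minus)

lemma nop_finite_support:
  assumes "smooth x" "smooth y"
  shows "\<exists>N. \<forall>k. \<bar>k\<bar> \<ge> N \<longrightarrow> nop x k y (n - k) * u \<in> L"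
proof -
  from assms obtain K K' where K: "\<And>k. k \<ge> K \<Longrightarrow> x k * u \<in> L" "\<And>k. k \<ge> K' \<Longrightarrow> y k * u \<in> L"
    unfolding smooth_def by metis
  have "nop x k y (n - k) * u \<in> L" if "\<bar>k\<bar> \<ge> \<bar>K\<bar> + \<bar>K'\<bar> + \<bar>n\<bar>" for k
  proof (cases "k < 0")
    case True
    then show ?thesis using mem(3)[OF K(2)[of "n - k"], of "x k"] that by (auto simp: nop_def mult.assoc)
  next
    case False
    then show ?thesis using mem(3)[OF K(1)[of k], of "y (n - k)"] that by (auto simp: nop_def mult.assoc)
  qed
  then show ?thesis by blast
qed

lemma sum_support:
  fixes P :: "int \<Rightarrow> affine_uea"
  assumes "\<And>k. \<bar>k\<bar> \<ge> N0 \<Longrightarrow> P k \<in> L" and "{-N0..N0} \<subseteq> A" "finite A"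
  shows "sum P A \<approx> sum P {-N0..N0}"
proof -
  have "sum P A = sum P (A - {-N0..N0}) + sum P {-N0..N0}"
    using assms by (intro sum.subset_diff) auto
  moreover have "sum P (A - {-N0..N0}) \<in> L" by (intro mem_sum assms(1)) auto
  ultimately show ?thesis by (simp add: mod_eq_def)
qed

lemma sum_shift:
  fixes P :: "int \<Rightarrow> affine_uea"
  assumes "\<And>k. \<bar>k\<bar> \<ge> N0 \<Longrightarrow> P k \<in> L" and "N \<ge> N0 + \<bar>m\<bar>"
  shows "(\<Sum>k = -N..N. P k - P (k + m)) \<in> L"
proof -
  have "(\<Sum>k = -N..N. P (k + m)) = sum P {-N + m..N + m}"
    by (rule sum.reindex_bij_witness[of _ "\<lambda>k. k - m" "\<lambda>k. k + m"]) auto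
  moreover have "sum P {-N..N} \<approx> sum P {-N0..N0}" "sum P {-N + m..N + m} \<approx> sum P {-N0..N0}"
    using assms(2) by (intro sum_support assms(1); auto)+
  from congr_trans[OF this(1) congr_sym[OF this(2)]]
  have "sum P {-N..N} - sum P {-N + m..N + m} \<in> L" by (simp add: mod_eq_def)
  ultimately show ?thesis by (simp add: sum_subtractf)
qed

text \<open>The heart of the critical level. The commutator of \<open>e(m)\<close> with a summand of \<open>T(n)\<close> is a difference of
  normal ordered products and their shifts by \<open>m\<close>, which telescopes, plus the correction where the shift changes the
  ordering, plus a central term. The corrections add up to \<open>4m e(m+n)\<close>, the central terms to \<open>2mc e(m+n)\<close>.
  The families are variables, since the automorphism exchanging \<open>e\<close> and \<open>f\<close> and negating \<open>h\<close> yields the same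
  for \<open>f(m)\<close>.\<close>

lemma sugawara_commutator:
  fixes e f h :: "int \<Rightarrow> affine_uea"
  assumes ef: "\<And>m n. e m * f n = f n * e m + h (m + n) + (if m + n = 0 then of_int m * uc else 0)"
    and he: "\<And>m n. h m * e n = e n * h m + 2 * e (m + n)"
    and ee: "\<And>m n. e m * e n = e n * e m"
    and smooth: "smooth e" "smooth f" "smooth h"
  defines "T \<equiv> \<lambda>n k. nop e k f (n - k) + nop f k e (n - k) + uea_scalar (1/2) * nop h k h (n - k)"
  shows "\<exists>N0. \<forall>N\<ge>N0. (\<Sum>k = -N..N. e m * T n k - T n k * e m) * u \<in> L"
proof -
  \<comment> \<open>the sign with which index \<open>k\<close> changes the normal ordering under the shift by \<open>m\<close>\<close>
  define s where "s k = (if k < 0 \<and> 0 \<le> k + m then 1 else if k + m < 0 \<and> 0 \<le> k then - 1 else (0::int))" for k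
  define P where "P k = nop e k h (m + n - k)" for k
  define Q where "Q k = nop h k e (m + n - k)" for k
  define br where "br y = e m * y - y * e m" for y
  have br_mult: "br (x * y) = br x * y + x * br y" for x y by (simp add: br_def algebra_simps)
  have br_e: "br (e j) = 0" for j by (simp add: br_def ee[of m])
  have br_f: "br (f j) = h (j + m) + (if j = - m then of_int m * uc else 0)" for j
    by (auto simp: br_def ef add.commute)
  have br_h: "br (h j) = - 2 * e (j + m)" for j by (simp add: br_def he)
  have ci: "x * (of_int m * uc) = of_int m * (uc * x)" for x by (metis mult.assoc mult_of_int_commute uc_central)
  have two: "h j * (2 * y) = 2 * (h j * y)" "h j * - (2 * y) = - (2 * (h j * y))" for j y
    by (simp_all add: mult_2 mult_2_right distrib_left right_diff_distrib)
  have idx: "k + m + (n - k) = m + n" "m + n - (k + m) = n - k" "n - k + m = m + n - k"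
    "n - k + (k + m) = m + n" "n - k = - m \<longleftrightarrow> k = m + n" for k by auto
  have 1: "br (nop e k f (n - k)) = P k + (if k = m + n then of_int m * (uc * e (m + n)) else 0)" for k
    by (auto simp: nop_def P_def br_mult br_e br_f distrib_left distrib_right ci mult.assoc idx)
  have 2: "br (nop f k e (n - k)) = Q (k + m) + of_int (2 * s k) * e (m + n)
     + (if k = - m then of_int m * (uc * e (m + n)) else 0)" for k
  proof -
    have "br (nop f k e (n - k)) = (if k < 0 then h (k + m) * e (n - k) else e (n - k) * h (k + m))
      + (if k = - m then of_int m * (uc * e (m + n)) else 0)"
      by (auto simp: nop_def br_mult br_e br_f distrib_left distrib_right ci mult.assoc idx add.commute[of n m])
    also have "(if k < 0 then h (k + m) * e (n - k) else e (n - k) * h (k + m)) = Q (k + m) + of_int (2 * s k) * e (m + n)"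
      using he[of "k + m" "n - k"] by (auto simp: Q_def nop_def s_def idx)
    finally show ?thesis .
  qed
  have 3: "br (nop h k h (n - k)) = 2 * (of_int (2 * s k) * e (m + n) - Q k - P (k + m))" for k
  proof -
    have "br (nop h k h (n - k)) = - 2 * ((if k < 0 then e (k + m) * h (n - k) else h (n - k) * e (k + m)) + Q k)"
      by (auto simp: nop_def Q_def br_mult br_h distrib_left mult.assoc idx two)
    also have "(if k < 0 then e (k + m) * h (n - k) else h (n - k) * e (k + m)) = P (k + m) - of_int (2 * s k) * e (m + n)"
      using he[of "n - k" "k + m"] by (auto simp: P_def nop_def s_def idx)
    finally show ?thesis by (simp add: algebra_simps)
  qed
  have 4: "e m * T n k - T n k * e m = (P k - P (k + m)) - (Q k - Q (k + m)) + of_int (4 * s k) * e (m + n)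
      + (if k = m + n then of_int m * (uc * e (m + n)) else 0) + (if k = - m then of_int m * (uc * e (m + n)) else 0)" for k
  proof -
    have "e m * T n k - T n k * e m = br (nop e k f (n - k)) + br (nop f k e (n - k))
       + uea_scalar (1/2) * br (nop h k h (n - k))"
      by (simp add: T_def br_def algebra_simps uea_scalar_left_central)
    moreover have "of_int (4 * s k) * x = of_int (2 * s k) * x + of_int (2 * s k) * x" for x :: affine_uea
      by (simp flip: distrib_right of_int_add)
    ultimately show ?thesis unfolding 1 2 3 scalar_half by (simp add: algebra_simps del: of_int_mult)
  qed
  obtain A where A: "\<And>k. \<bar>k\<bar> \<ge> A \<Longrightarrow> P k * u \<in> L"
    using nop_finite_support[OF smooth(1,3), of "m + n" u] by (auto simp: P_def)
  obtain B where B: "\<And>k. \<bar>k\<bar> \<ge> B \<Longrightarrow> Q k * u \<in> L"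
    using nop_finite_support[OF smooth(3,1), of "m + n" u] by (auto simp: Q_def)
  have "(\<Sum>k = -N..N. e m * T n k - T n k * e m) * u \<in> L" if N: "N \<ge> \<bar>A\<bar> + \<bar>B\<bar> + \<bar>m\<bar> + \<bar>n\<bar>" for N
  proof -
    have r: "- N \<le> m + n" "m + n \<le> N" "m \<le> N" "- m \<le> N" using N by auto
    have s: "(\<Sum>k = -N..N. s k) = m" unfolding s_def using N by (intro sum_order_switch) auto
    have SP: "(\<Sum>k = -N..N. P k * u - P (k + m) * u) \<approx> 0"
      unfolding congr_0 by (rule sum_shift[of A "\<lambda>k. P k * u", OF A]) (use N in auto)
    have SQ: "(\<Sum>k = -N..N. Q k * u - Q (k + m) * u) \<approx> 0"
      unfolding congr_0 by (rule sum_shift[of B "\<lambda>k. Q k * u", OF B]) (use N in auto)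
    have "(\<Sum>k = -N..N. e m * T n k - T n k * e m) * u =
        (\<Sum>k = -N..N. P k * u - P (k + m) * u) - (\<Sum>k = -N..N. Q k * u - Q (k + m) * u)
        + of_int (4 * (\<Sum>k = -N..N. s k)) * (e (m + n) * u)
        + (of_int m * (uc * (e (m + n) * u)) + of_int m * (uc * (e (m + n) * u)))"
      using r by (simp add: 4 sum.distrib sum_subtractf sum_distrib_left sum_distrib_right algebra_simps)
    also have "\<dots> \<approx> 0 - 0 + of_int (4 * m) * (e (m + n) * u)
        + (of_int m * (- 2 * (e (m + n) * u)) + of_int m * (- 2 * (e (m + n) * u)))"
      unfolding s by (intro congr_add congr_diff congr_mult c_act congr_refl SP SQ)
    also have "\<dots> = of_int (4 * m + (m * - 2 + m * - 2)) * (e (m + n) * u)"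
      unfolding of_int_add distrib_right of_int_mult by (simp add: mult.assoc)
    also have "\<dots> = 0" by simp
    finally show ?thesis by (simp add: congr_0)
  qed
  then show ?thesis by blast
qed

text \<open>\<open>sug_acts n u t\<close>: on the class of \<open>u\<close>, \<open>T(n)\<close> is defined and gives the class of \<open>t\<close>.\<close>

definition sug_acts :: "int \<Rightarrow> affine_uea \<Rightarrow> affine_uea \<Rightarrow> bool" where
  "sug_acts n u t \<longleftrightarrow> (\<exists>N0. \<forall>N\<ge>N0. sug_partial n N * u \<approx> t)"

lemma sug_actsI: "(\<And>N. N \<ge> N0 \<Longrightarrow> sug_partial n N * u \<approx> t) \<Longrightarrow> sug_acts n u t"
  by (auto simp: sug_acts_def)

lemma sug_acts_combine:
  assumes "sug_acts n u t" "sug_acts n v s"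
    and "\<And>N. sug_partial n N * u \<approx> t \<Longrightarrow> sug_partial n N * v \<approx> s \<Longrightarrow> sug_partial n N * w \<approx> r"
  shows "sug_acts n w r"
proof -
  from assms(1,2) obtain A B where "\<And>N. N \<ge> A \<Longrightarrow> sug_partial n N * u \<approx> t" "\<And>N. N \<ge> B \<Longrightarrow> sug_partial n N * v \<approx> s"
    unfolding sug_acts_def by blast
  then show ?thesis by (intro sug_actsI[of "max A B"] assms(3)) auto
qed

lemma sug_acts_unique: "sug_acts n u t \<Longrightarrow> sug_acts n u s \<Longrightarrow> t \<approx> s"
proof -
  assume "sug_acts n u t" "sug_acts n u s"
  then obtain A B where "\<And>N. N \<ge> A \<Longrightarrow> sug_partial n N * u \<approx> t" "\<And>N. N \<ge> B \<Longrightarrow> sug_partial n N * u \<approx> s"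
    unfolding sug_acts_def by blast
  from this(1)[of "max A B"] this(2)[of "max A B"] show ?thesis by (auto intro: congr_trans congr_sym)
qed

lemma sug_acts_commute:
  assumes "\<exists>N0. \<forall>N\<ge>N0. (\<Sum>k = -N..N. x * sug_term n k - sug_term n k * x) * u \<in> L" and "sug_acts n u t"
  shows "sug_acts n (x * u) (x * t)"
proof -
  from assms obtain A B where A: "\<And>N. N \<ge> A \<Longrightarrow> (\<Sum>k = -N..N. x * sug_term n k - sug_term n k * x) * u \<in> L"
    and B: "\<And>N. N \<ge> B \<Longrightarrow> sug_partial n N * u \<approx> t"
    unfolding sug_acts_def by blast
  show ?thesis
  proof (rule sug_actsI[of "max A B"])
    fix N assume N: "N \<ge> max A B"
    have "sug_partial n N * (x * u) = x * (sug_partial n N * u)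
       - uea_scalar (1/2) * ((\<Sum>k = -N..N. x * sug_term n k - sug_term n k * x) * u)"
      by (simp add: sug_partial_def sum_subtractf sum_distrib_left sum_distrib_right algebra_simps uea_scalar_left_central)
    also have "\<dots> \<approx> x * t - uea_scalar (1/2) * 0"
      using A[of N] B[of N] N by (intro congr_diff congr_mult) (auto simp: congr_0)
    finally show "sug_partial n N * (x * u) \<approx> x * t" by simp
  qed
qed

lemma sug_acts_e: "sug_acts n u t \<Longrightarrow> sug_acts n (ue m * u) (ue m * t)"
  by (rule sug_acts_commute)
    (use sugawara_commutator[OF ue_uf uh_ue ue_ue smooth_efh, of m n u] in \<open>auto simp: sug_term_def\<close>)

lemma sug_acts_f: "sug_acts n u t \<Longrightarrow> sug_acts n (uf m * u) (uf m * t)"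
proof (rule sug_acts_commute)
  have fe: "uf m * ue n = ue n * uf m + - uh (m + n) + (if m + n = 0 then of_int m * uc else 0)" for m n
  proof (cases "m + n = 0")
    case True
    then have n: "n = - m" by simp
    show ?thesis unfolding n using ue_uf[of "- m" m] by (simp add: algebra_simps)
  next
    case False
    then show ?thesis using ue_uf[of n m] by (simp add: algebra_simps)
  qed
  have hf: "- uh m * uf n = uf n * - uh m + 2 * uf (m + n)" for m n
    using uh_uf[of m n] by (simp add: algebra_simps)
  from sugawara_commutator[of uf ue "\<lambda>n. - uh n", OF fe hf uf_uf smooth_efh(2,1) smooth_uminus[OF smooth_efh(3)], of m n u]
  show "\<exists>N0. \<forall>N\<ge>N0. (\<Sum>k = - N..N. uf m * sug_term n k - sug_term n k * uf m) * u \<in> L"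
    by (simp add: sug_term_def nop_def add.commute if_distrib cong: if_cong)
qed

lemma sug_acts_diff: "sug_acts n u t \<Longrightarrow> sug_acts n v s \<Longrightarrow> sug_acts n (u - v) (t - s)"
  by (rule sug_acts_combine, assumption, assumption) (auto simp: right_diff_distrib intro: congr_diff)

lemma sug_term_in_ideal:
  assumes "k > \<bar>n\<bar> + 2 \<or> k < - (\<bar>n\<bar> + 2)" shows "sug_term n k \<in> L"
proof -
  have v: "ue j \<in> L" "uf j \<in> L" "uh j \<in> L" if "j > 2" for j
    using e_vac[of j] f_vac[of j] h_vac[of j] that by (simp_all add: mod_eq_def)
  from assms show ?thesis
  proof
    assume "k > \<bar>n\<bar> + 2"
    then show ?thesis using v[of k] by (auto simp: sug_term_def nop_def intro!: mem)
  next
    assume "k < - (\<bar>n\<bar> + 2)"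
    then show ?thesis using v[of "n - k"] by (auto simp: sug_term_def nop_def intro!: mem)
  qed
qed

lemma sug_acts_1: "sug_acts n 1 (sug_elt n)"
proof (rule sug_actsI[of "\<bar>n\<bar> + 2"])
  fix N assume N: "N \<ge> \<bar>n\<bar> + 2"
  have "sum (sug_term n) {-N..N} = sum (sug_term n) ({-N..N} - {-(\<bar>n\<bar> + 2)..\<bar>n\<bar> + 2}) + sum (sug_term n) {-(\<bar>n\<bar> + 2)..\<bar>n\<bar> + 2}"
    using N by (intro sum.subset_diff) auto
  moreover have "sum (sug_term n) ({-N..N} - {-(\<bar>n\<bar> + 2)..\<bar>n\<bar> + 2}) \<in> L"
    by (intro mem_sum sug_term_in_ideal) auto
  ultimately have "sum (sug_term n) {-N..N} \<approx> sum (sug_term n) {-(\<bar>n\<bar> + 2)..\<bar>n\<bar> + 2}"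
    by (simp add: mod_eq_def)
  then show "sug_partial n N * 1 \<approx> sug_elt n"
    by (simp add: sug_partial_def sug_elt_def congr_mult)
qed

text \<open>The algebra is generated by the \<open>e(m)\<close> and \<open>f(m)\<close> up to the central element, which is a scalar.\<close>

lemma sug_acts_elt: "sug_acts n u (u * sug_elt n)"
proof (induction u rule: uea_induct)
  case (scalar r)
  show ?case using sug_acts_1[of n]
    by (rule sug_acts_combine[of n _ _ 1 "sug_elt n"]) (use sug_acts_1 in \<open>auto simp: uea_scalar_central intro: congr_mult\<close>)
next
  case (add u v)
  then show ?case by (rule sug_acts_combine) (auto simp: distrib_left distrib_right intro: congr_add)
next
  case (e m u) then show ?case using sug_acts_e[of n u] by (simp add: mult.assoc)
next
  case (f m u) then show ?case using sug_acts_f[of n u] by (simp add: mult.assoc)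
next
  case (h m u)
  have "uh m = ue m * uf 0 - uf 0 * ue m" using ue_uf[of m 0] by simp
  then have "uh m * v = ue m * (uf 0 * v) - uf 0 * (ue m * v)" for v by (simp add: left_diff_distrib mult.assoc)
  moreover have "sug_acts n (ue m * (uf 0 * u) - uf 0 * (ue m * u))
      (ue m * (uf 0 * (u * sug_elt n)) - uf 0 * (ue m * (u * sug_elt n)))"
    by (intro sug_acts_diff sug_acts_e sug_acts_f h)
  ultimately show ?case by (simp add: left_diff_distrib mult.assoc)
next
  case (c u)
  show ?case using c c
    by (rule sug_acts_combine) (metis congr_mult mult.assoc uc_central)
qed

text \<open>On an element of \<open>L\<close> the sums vanish, while \<open>T(n)\<close> is right multiplication by \<open>t(n)\<close>.\<close>

lemma sug_elt_right: "u \<in> L \<Longrightarrow> u * sug_elt n \<in> L"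
proof -
  assume "u \<in> L"
  then have "sug_acts n u 0" by (intro sug_actsI[of 0]) (simp add: congr_0 mem)
  from sug_acts_unique[OF sug_acts_elt this] show ?thesis by (simp add: congr_0)
qed

text \<open>The triangular shape of \<open>T(n)w\<close>: \<open>f(n)\<close> occurs with the coefficient \<open>\<lambda>\<close>, all other \<open>f(k)\<close> have \<open>k > n\<close>. Both
  mixed sums contribute the same terms; reordering the second one produces the multiple of \<open>h(n)\<close>.\<close>

lemma sug_elt_nonpos:
  assumes n: "n \<le> 0"
  shows "sug_elt n \<approx> uea_scalar lam * uf n + (\<Sum>j\<in>{n..<0}. ue j * uf (n - j)) + uea_scalar mu * ue (n - 1)
    + uea_scalar (of_int (n + 1) / 2) * uh n + uea_scalar (1/4) * (\<Sum>j\<in>{n..0}. uh j * uh (n - j))"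
proof -
  define N where "N = \<bar>n\<bar> + 2"
  have N: "N = 2 - n" using n by (simp add: N_def)
  define a where "a j = (if j = n - 1 then uea_scalar mu * ue j else if j = 0 then uea_scalar lam * uf n
    else if n \<le> j \<and> j < 0 then ue j * uf (n - j) else 0)" for j
  define S where "S = (\<Sum>j\<in>{n..<0}. ue j * uf (n - j)) + uea_scalar mu * ue (n - 1) + uea_scalar lam * uf n"
  have right: "x * y \<approx> uea_scalar r * x" if "y \<approx> uea_scalar r" for x y r
    using congr_mult[OF that, of x] by (simp add: uea_scalar_central)
  have zero: "x * y \<approx> 0" if "y \<approx> 0" for x y
    using congr_mult[OF that, of x] by simp
  have suma: "sum a A = S" if "{n - 1..0} \<subseteq> A" "finite A" for A
  proof -
    have "sum a A = sum a {n - 1..0}"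
      using that n by (intro sum.mono_neutral_right) (auto simp: a_def)
    also have "{n - 1..0} = insert (n - 1) (insert 0 {n..<0})" using n by auto
    also have "sum a \<dots> = a (n - 1) + (a 0 + sum a {n..<0})" using n by (simp add: sum.insert_if)
    also have "sum a {n..<0} = (\<Sum>j\<in>{n..<0}. ue j * uf (n - j))" by (intro sum.cong) (auto simp: a_def)
    finally show ?thesis using n by (simp add: a_def S_def)
  qed
  have A: "nop ue k uf (n - k) \<approx> a k" for k
  proof -
    consider "k < n - 1" | "k = n - 1" | "n \<le> k" "k < 0" | "k = 0" | "k > 0" by linarith
    then show ?thesis
    proof cases
      case 1
      then show ?thesis using n zero[of "uf (n - k)"] f_vac[of "n - k"] by (simp add: a_def nop_def)
    next
      case 2
      then show ?thesis using n right[of "uf 1" mu] f_vac[of 1] by (simp add: a_def nop_def)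
    next
      case 4
      then show ?thesis using n right[of "ue 0" lam] e_vac[of 0] by (simp add: a_def nop_def)
    next
      case 5
      then show ?thesis using n zero[of "ue k"] e_vac[of k] by (simp add: a_def nop_def)
    qed (auto simp: a_def nop_def)
  qed
  \<comment> \<open>from \<open>f(k)e(n-k) = e(n-k)f(k) - h(n)\<close>, and from \<open>e(0)f(0) = f(0)e(0) + h(0)\<close> when \<open>n = 0\<close>\<close>
  define corr where "corr k = (if n < k \<and> k < 0 then - 1 else if k = 0 \<and> n = 0 then 1 else (0::int))" for k
  have B: "nop uf k ue (n - k) \<approx> a (n - k) + of_int (corr k) * uh n" for k
  proof -
    consider "k < n" | "k = n" "n < 0" | "n < k" "k < 0" | "k = 0" "n < 0" | "k = 0" "n = 0" | "k = 1" | "k > 1"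
      using n by linarith
    then show ?thesis
    proof cases
      case 1
      then show ?thesis using n zero[of "ue (n - k)"] e_vac[of "n - k"] by (simp add: a_def nop_def corr_def)
    next
      case 2
      then show ?thesis using right[of "ue 0" lam] e_vac[of 0] by (simp add: a_def nop_def corr_def)
    next
      case 3
      then show ?thesis using ue_uf[of "n - k" k] by (simp add: a_def nop_def corr_def)
    next
      case 4
      then show ?thesis by (simp add: a_def nop_def corr_def)
    next
      case 5
      then show ?thesis using congr_add[OF right[of "ue 0" lam "uf 0"] congr_refl[of "uh 0"]] e_vac[of 0] ue_uf[of 0 0]
        by (simp add: a_def nop_def corr_def)
    next
      case 6
      then show ?thesis using n right[of "uf 1" mu] f_vac[of 1] by (simp add: a_def nop_def corr_def)
    next
      case 7
      then show ?thesis using n zero[of "uf k"] f_vac[of k] by (simp add: a_def nop_def corr_def)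
    qed
  qed
  have C: "nop uh k uh (n - k) \<approx> (if k \<in> {n..0} then uh k * uh (n - k) else 0)" for k
  proof -
    consider "k < n" | "n \<le> k" "k < 0" | "k = 0" | "k > 0" by linarith
    then show ?thesis
    proof cases
      case 1
      then show ?thesis using n zero[of "uh (n - k)"] h_vac[of "n - k"] by (simp add: nop_def)
    next
      case 4
      then show ?thesis using n zero[of "uh k"] h_vac[of k] by (simp add: nop_def)
    qed (use n uh_uh[of 0 n] in \<open>auto simp: nop_def\<close>)
  qed
  have "(\<Sum>k = -N..N. nop ue k uf (n - k)) \<approx> S"
    using suma[of "{-N..N}"] congr_sum[of "{-N..N}" _ a, OF A] n N by simp
  moreover have "(\<Sum>k = -N..N. nop uf k ue (n - k)) \<approx> S + of_int (n + 1) * uh n"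
  proof -
    have "(\<Sum>k = -N..N. a (n - k)) = sum a {n - N..n + N}"
      by (rule sum.reindex_bij_witness[of _ "\<lambda>k. n - k" "\<lambda>k. n - k"]) auto
    moreover have "(\<Sum>k = -N..N. corr k) = n + 1"
    proof (cases "n = 0")
      case True
      have "(\<Sum>k = -N..N. corr k) = (\<Sum>k\<in>{0}. corr k)"
        using True N by (intro sum.mono_neutral_right) (auto simp: corr_def)
      then show ?thesis using True by (simp add: corr_def)
    next
      case False
      have "(\<Sum>k = -N..N. corr k) = (\<Sum>k\<in>{n<..<0}. corr k)"
        using False N n by (intro sum.mono_neutral_right) (auto simp: corr_def)
      also have "\<dots> = (\<Sum>k\<in>{n<..<0}. - 1)" by (intro sum.cong) (auto simp: corr_def)
      finally show ?thesis using False n by simp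
    qed
    ultimately have "(\<Sum>k = -N..N. a (n - k) + of_int (corr k) * uh n) = S + of_int (n + 1) * uh n"
      using suma[of "{n - N..n + N}"] n N by (simp add: sum.distrib flip: sum_distrib_right of_int_sum)
    with congr_sum[of "{-N..N}" "\<lambda>k. nop uf k ue (n - k)", OF B] show ?thesis by simp
  qed
  moreover have "(\<Sum>k = -N..N. nop uh k uh (n - k)) \<approx> (\<Sum>j\<in>{n..0}. uh j * uh (n - j))"
  proof -
    have "(\<Sum>k = -N..N. if k \<in> {n..0} then uh k * uh (n - k) else 0) = (\<Sum>j\<in>{n..0}. uh j * uh (n - j))"
      using n N by (subst sum.inter_restrict[symmetric]) (auto intro!: sum.cong)
    with congr_sum[of "{-N..N}" "\<lambda>k. nop uh k uh (n - k)", OF C] show ?thesis by simp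
  qed
  ultimately have "(\<Sum>k = -N..N. sug_term n k) \<approx> S + (S + of_int (n + 1) * uh n)
      + uea_scalar (1/2) * (\<Sum>j\<in>{n..0}. uh j * uh (n - j))"
    unfolding sug_term_def sum.distrib sum_distrib_left[symmetric]
    by (intro congr_add congr_mult)
  from congr_mult[OF this, of "uea_scalar (1/2)"]
  have "sug_elt n \<approx> uea_scalar (1/2) * (S + (S + of_int (n + 1) * uh n)
      + uea_scalar (1/2) * (\<Sum>j\<in>{n..0}. uh j * uh (n - j)))"
    by (simp add: sug_elt_def sug_partial_def N_def)
  also have "\<dots> = S + uea_scalar (of_int (n + 1) / 2) * uh n + uea_scalar (1/4) * (\<Sum>j\<in>{n..0}. uh j * uh (n - j))"
  proof -
    have "uea_scalar (1/2) * S + uea_scalar (1/2) * S = S"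
      using uea_scalar_simps(3)[of "1/2" "1/2"] by (simp flip: distrib_right)
    moreover have "uea_scalar (1/2) * (of_int (n + 1) * uh n) = uea_scalar (of_int (n + 1) / 2) * uh n"
      using uea_scalar_simps(4)[of "1/2" "of_int (n + 1)"] by (simp only: uea_scalar_of_int mult.assoc[symmetric]) simp
    moreover have "uea_scalar (1/2) * (uea_scalar (1/2) * y) = uea_scalar (1/4) * y" for y
      using uea_scalar_simps(4)[of "1/2" "1/2"] by (simp flip: mult.assoc)
    ultimately show ?thesis by (simp add: distrib_left flip: add.assoc)
  qed
  finally show ?thesis by (simp add: S_def ac_simps)
qed

lemma sug_elt_one: "sug_elt 1 \<approx> uea_scalar (lam * mu)"
proof -
  have right: "x * y \<approx> uea_scalar r * x" if "y \<approx> uea_scalar r" for x y r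
    using congr_mult[OF that, of x] by (simp add: uea_scalar_central)
  have zero: "x * y \<approx> 0" if "y \<approx> 0" for x y
    using congr_mult[OF that, of x] by simp
  have fe: "uf 1 * ue 0 \<approx> uea_scalar (lam * mu)"
    using congr_trans[OF right[of "ue 0" lam "uf 1"] congr_mult[OF f_vac[of 1], of "uea_scalar lam"]] e_vac[of 0]
    by (simp add: uea_scalar_simps)
  have ef: "ue 0 * uf 1 \<approx> uea_scalar (lam * mu)"
    using congr_trans[OF right[of "uf 1" mu "ue 0"] congr_mult[OF e_vac[of 0], of "uea_scalar mu"]] f_vac[of 1]
    by (simp add: uea_scalar_simps(4)[symmetric] mult.commute[of lam])
  have A: "nop ue k uf (1 - k) \<approx> (if k = 0 then uea_scalar (lam * mu) else 0)" for k
  proof -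
    consider "k < 0" | "k = 0" | "k > 0" by linarith
    then show ?thesis
      by cases (use zero[of "uf (1 - k)"] f_vac[of "1 - k"] fe zero[of "ue k"] e_vac[of k] in \<open>auto simp: nop_def\<close>)
  qed
  have B: "nop uf k ue (1 - k) \<approx> (if k = 1 then uea_scalar (lam * mu) else 0)" for k
  proof -
    have 0: "ue 1 * uf 0 \<approx> 0"
      using congr_add[OF zero[of "ue 1" "uf 0"] h_vac[of 1]] e_vac[of 1] ue_uf[of 1 0] by simp
    consider "k < 0" | "k = 0" | "k = 1" | "k > 1" by linarith
    then show ?thesis
      by cases (use zero[of "ue (1 - k)"] e_vac[of "1 - k"] 0 ef zero[of "uf k"] f_vac[of k] in \<open>auto simp: nop_def\<close>)
  qed
  have C: "nop uh k uh (1 - k) \<approx> 0" for k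
  proof -
    have 0: "uh 1 * uh 0 \<approx> 0"
      using zero[of "uh 1" "uh 0"] h_vac[of 1] uh_uh[of 1 0] by simp
    consider "k < 0" | "k = 0" | "k > 0" by linarith
    then show ?thesis
      by cases (use zero[of "uh (1 - k)"] h_vac[of "1 - k"] 0 zero[of "uh k"] h_vac[of k] in \<open>auto simp: nop_def\<close>)
  qed
  have "(\<Sum>k = -3..3. sug_term 1 k) \<approx> (\<Sum>k = -3..3. (if k = (0::int) then uea_scalar (lam * mu) else 0)
      + (if k = 1 then uea_scalar (lam * mu) else 0) + uea_scalar (1/2) * 0)"
    unfolding sug_term_def by (intro congr_sum congr_add congr_mult A B C)
  then have "(\<Sum>k = -3..3. sug_term 1 k) \<approx> 2 * uea_scalar (lam * mu)"
    by (simp add: sum.distrib mult_2)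
  from congr_mult[OF this, of "uea_scalar (1/2)"] show ?thesis
    by (simp add: sug_elt_def sug_partial_def scalar_half)
qed

end

section \<open>Lowering operators\<close>

lemma whittaker_quotient_universal: "whittaker_quotient (whittaker_ideal lam mu) lam mu"
  by unfold_locales (simp_all add: left_ideal_whittaker)

text \<open>Products of commuting elements indexed by a multiset: monomials in the creation operators, and in the
  annihilation operators that lower them.\<close>

definition mprod :: "(nat \<Rightarrow> affine_uea) \<Rightarrow> nat multiset \<Rightarrow> affine_uea" where
  "mprod f M = fold_mset (\<lambda>i u. f i * u) 1 M"

lemma mprod_empty [simp]: "mprod f {#} = 1" by (simp add: mprod_def)

lemma mprod_add:
  assumes "\<And>i j. f i * f j = f j * f i"
  shows "mprod f (add_mset i M) = f i * mprod f M"
proof -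
  interpret comp_fun_commute "\<lambda>i u. f i * u"
    by standard (auto simp: fun_eq_iff assms simp flip: mult.assoc)
  show ?thesis by (simp add: mprod_def)
qed

definition hmon :: "nat multiset \<Rightarrow> affine_uea" where "hmon = mprod (\<lambda>j. uh (- int j))"
definition emon :: "nat multiset \<Rightarrow> affine_uea" where "emon = mprod (\<lambda>a. ue (- int a))"
definition hlow :: "nat multiset \<Rightarrow> affine_uea" where "hlow = mprod (\<lambda>i. uh (int i))"
definition elow :: "complex \<Rightarrow> nat multiset \<Rightarrow> affine_uea" where
  "elow lam = mprod (\<lambda>i. ue (int i) - uea_scalar (if i = 0 then lam else 0))"

lemma uh_uh_nonneg: "uh (int i) * uh (int j) = uh (int j) * uh (int i)"
  using uh_uh[of "int i" "int j"] by (cases "i = 0") auto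
lemma uh_uh_nonpos: "uh (- int i) * uh (- int j) = uh (- int j) * uh (- int i)"
  using uh_uh[of "- int i" "- int j"] by (cases "i = 0") auto

lemma hmon_add: "hmon (add_mset j K) = uh (- int j) * hmon K"
  unfolding hmon_def by (rule mprod_add) (rule uh_uh_nonpos)
lemma emon_add: "emon (add_mset a A) = ue (- int a) * emon A"
  unfolding emon_def by (rule mprod_add) (rule ue_ue)
lemma hlow_add: "hlow (add_mset i I) = uh (int i) * hlow I"
  unfolding hlow_def by (rule mprod_add) (rule uh_uh_nonneg)
lemma elow_add: "elow lam (add_mset i I) = (ue (int i) - uea_scalar (if i = 0 then lam else 0)) * elow lam I"
  unfolding elow_def by (rule mprod_add) (simp add: algebra_simps uea_scalar_central[of "ue n" for n] ue_ue flip: uea_scalar_simps(4))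

lemma mon_empty [simp]: "hmon {#} = 1" "emon {#} = 1" "hlow {#} = 1" "elow lam {#} = 1"
  by (simp_all add: hmon_def emon_def hlow_def elow_def)

lemma uh_hlow: "uh (int i) * hlow I = hlow I * uh (int i)"
  by (induction I) (simp_all add: hlow_add, metis mult.assoc uh_uh_nonneg)

lemma sum_mset_mult: "sum_mset (image_mset f M) * x = (\<Sum>m\<in>#M. f m * x)" for x :: "'b::semiring_0"
  by (induction M) (simp_all add: algebra_simps)

lemma elow_uh: "elow lam I * uh (- int j)
  = uh (- int j) * elow lam I - 2 * (\<Sum>i\<in>#I. ue (int i - int j) * elow lam (I - {#i#}))"
proof (induction I)
  case (add i I)
  let ?d = "ue (int i) - uea_scalar (if i = 0 then lam else 0)"
  have d: "?d * uh (- int j) = uh (- int j) * ?d - 2 * ue (int i - int j)"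
    using uh_ue[of "- int j" "int i"] by (simp add: algebra_simps uea_scalar_central[of "uh n" for n])
  have sum: "(\<Sum>k\<in>#I. ue (int k - int j) * elow lam (add_mset i I - {#k#}))
    = ?d * (\<Sum>k\<in>#I. ue (int k - int j) * elow lam (I - {#k#}))"
    unfolding mult_sum_mset
  proof (intro arg_cong[where f = sum_mset] image_mset_cong)
    fix k assume "k \<in># I"
    then have "add_mset i I - {#k#} = add_mset i (I - {#k#})" by simp
    moreover have "ue (int k - int j) * ?d = ?d * ue (int k - int j)"
      by (simp add: algebra_simps uea_scalar_central[of "ue n" for n] ue_ue)
    ultimately show "ue (int k - int j) * elow lam (add_mset i I - {#k#}) = ?d * (ue (int k - int j) * elow lam (I - {#k#}))"
      by (metis elow_add mult.assoc)
  qed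
  have "elow lam (add_mset i I) * uh (- int j) = ?d * (elow lam I * uh (- int j))"
    by (simp add: elow_add mult.assoc)
  also have "\<dots> = (?d * uh (- int j)) * elow lam I - ?d * (2 * (\<Sum>k\<in>#I. ue (int k - int j) * elow lam (I - {#k#})))"
    by (simp add: add right_diff_distrib mult.assoc)
  also have "?d * (2 * (\<Sum>k\<in>#I. ue (int k - int j) * elow lam (I - {#k#})))
     = 2 * (\<Sum>k\<in>#I. ue (int k - int j) * elow lam (add_mset i I - {#k#}))"
    by (simp add: sum mult_2 mult_2_right distrib_left)
  finally show ?case unfolding d by (simp add: elow_add distrib_left left_diff_distrib mult.assoc algebra_simps)
qed simp

lemma uh_emon: "uh n * emon A = emon A * uh n + 2 * (\<Sum>a\<in>#A. ue (n - int a) * emon (A - {#a#}))"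
proof (induction A)
  case (add b A)
  have sum: "(\<Sum>a\<in>#A. ue (n - int a) * emon (add_mset b A - {#a#}))
    = ue (- int b) * (\<Sum>a\<in>#A. ue (n - int a) * emon (A - {#a#}))"
    unfolding mult_sum_mset
  proof (intro arg_cong[where f = sum_mset] image_mset_cong)
    fix a assume "a \<in># A"
    then show "ue (n - int a) * emon (add_mset b A - {#a#}) = ue (- int b) * (ue (n - int a) * emon (A - {#a#}))"
      using ue_ue_left[of "n - int a" "- int b"] by (simp add: emon_add)
  qed
  have "uh n * emon (add_mset b A) = ue (- int b) * (uh n * emon A) + 2 * (ue (n - int b) * emon A)"
    by (simp add: emon_add uh_ue_left)
  also have "\<dots> = emon (add_mset b A) * uh n + 2 * (ue (n - int b) * emon A
     + ue (- int b) * (\<Sum>a\<in>#A. ue (n - int a) * emon (A - {#a#})))"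
    by (simp add: add emon_add distrib_left mult.assoc mult_2 mult_2_right)
  finally show ?case by (simp add: sum)
qed simp

lemma finite_argmax:
  fixes f :: "'b \<Rightarrow> nat"
  assumes "finite S" "S \<noteq> {}"
  obtains x where "x \<in> S" "\<And>y. y \<in> S \<Longrightarrow> f y \<le> f x"
proof -
  have "Max (f ` S) \<in> f ` S" using assms by (intro Max_in) auto
  then obtain x where "x \<in> S" "f x = Max (f ` S)" by auto
  with assms that[of x] show ?thesis by (metis Max_ge finite_imageI imageI)
qed

context whittaker_quotient
begin

text \<open>Two kinds of vectors: those on which only the \<open>e(i)\<close>, \<open>i \<ge> 0\<close>, act by the Whittaker character, and Whittaker
  vectors. The former are stable under all \<open>e(n)\<close>, so they contain every \<open>e\<^sub>A z\<close> with \<open>z\<close> a Whittaker vector.\<close>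

definition eigen :: "affine_uea \<Rightarrow> bool" where
  "eigen y \<longleftrightarrow> (\<forall>i\<ge>0. ue i * y \<approx> uea_scalar (if i = 0 then lam else 0) * y)"

definition whit :: "affine_uea \<Rightarrow> bool" where
  "whit z \<longleftrightarrow> (\<forall>u\<in>whittaker_ideal lam mu. u * z \<in> L)"

lemma eigenD: "eigen y \<Longrightarrow> i \<ge> 0 \<Longrightarrow> ue i * y \<approx> uea_scalar (if i = 0 then lam else 0) * y"
  unfolding eigen_def by blast
lemma mem_sum_mset: "(\<And>i. i \<in># I \<Longrightarrow> f i \<in> L) \<Longrightarrow> (\<Sum>i\<in>#I. f i) \<in> L"
  by (induction I) (auto simp: mem)
lemma eigen_L: "y \<in> L \<Longrightarrow> eigen y"
  by (auto simp: eigen_def mod_eq_def intro!: mem)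
lemma eigen_add: "eigen y \<Longrightarrow> eigen y' \<Longrightarrow> eigen (y + y')"
  unfolding eigen_def distrib_left by (intro allI impI congr_add) auto
lemma eigen_sum_mset: "(\<And>s. s \<in># S \<Longrightarrow> eigen (f s)) \<Longrightarrow> eigen (\<Sum>s\<in>#S. f s)"
  by (induction S) (auto intro: eigen_add eigen_L mem)
lemma eigen_scalar: "eigen y \<Longrightarrow> eigen (uea_scalar r * y)"
  unfolding eigen_def
proof (intro allI impI)
  fix i :: int assume "\<forall>i\<ge>0. ue i * y \<approx> uea_scalar (if i = 0 then lam else 0) * y" "0 \<le> i"
  then have "uea_scalar r * (ue i * y) \<approx> uea_scalar r * (uea_scalar (if i = 0 then lam else 0) * y)"
    by (intro congr_mult) blast
  then show "ue i * (uea_scalar r * y) \<approx> uea_scalar (if i = 0 then lam else 0) * (uea_scalar r * y)"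
    by (metis uea_scalar_left_central)
qed
lemma eigen_e: "eigen y \<Longrightarrow> eigen (ue n * y)"
  unfolding eigen_def
proof (intro allI impI)
  fix i :: int assume "\<forall>i\<ge>0. ue i * y \<approx> uea_scalar (if i = 0 then lam else 0) * y" "0 \<le> i"
  then have "ue n * (ue i * y) \<approx> ue n * (uea_scalar (if i = 0 then lam else 0) * y)" by (intro congr_mult) auto
  then show "ue i * (ue n * y) \<approx> uea_scalar (if i = 0 then lam else 0) * (ue n * y)"
    by (metis uea_scalar_left_central ue_ue_left)
qed

lemma eigen_emon: "eigen y \<Longrightarrow> eigen (emon A * y)"
  by (induction A) (auto simp: emon_add mult.assoc intro: eigen_e)

lemma whit_e: "whit z \<Longrightarrow> n \<ge> 0 \<Longrightarrow> ue n * z \<approx> uea_scalar (if n = 0 then lam else 0) * z"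
  and whit_f: "whit z \<Longrightarrow> n \<ge> 1 \<Longrightarrow> uf n * z \<approx> uea_scalar (if n = 1 then mu else 0) * z"
  and whit_h: "whit z \<Longrightarrow> n \<ge> 1 \<Longrightarrow> uh n * z \<in> L"
  using whittaker_ideal_generators(1)[of n lam mu] whittaker_ideal_generators(2)[of n mu lam]
    whittaker_ideal_generators(3)[of n lam mu]
  by (auto simp: whit_def mod_eq_def simp flip: left_diff_distrib)

lemma whit_eigen: "whit z \<Longrightarrow> eigen z"
  by (simp add: eigen_def whit_e)

lemma elow_eigen: "eigen y \<Longrightarrow> I \<noteq> {#} \<Longrightarrow> elow lam I * y \<in> L"
proof (induction I)
  case (add i I)
  have "eigen (elow lam I * y)"
    by (cases "I = {#}") (use add in \<open>auto intro: eigen_L\<close>)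
  then have "(ue (int i) - uea_scalar (if i = 0 then lam else 0)) * (elow lam I * y) \<in> L"
    using eigenD[of "elow lam I * y" "int i"] by (simp add: mod_eq_def left_diff_distrib)
  then show ?case by (simp add: elow_add mult.assoc)
qed simp

text \<open>Moving \<open>h(-j)\<close> to the left past the \<open>e(i) - \<lambda>\<delta>\<^sub>i\<^sub>0\<close> replaces one of these by \<open>-2e(i-j)\<close>, so each of them removes
  exactly one factor of \<open>h\<^sub>J\<close>; too many of them give zero. If the numbers agree, \<open>e(i-j)\<close> acts
  on a vector of the first kind: it is zero for \<open>i > j\<close>, and \<open>\<lambda>\<close> for \<open>i = j\<close>. A term with \<open>i < j\<close> leaves an index sum
  too small for the remaining lowering operators, so that only \<open>J = I\<close> can survive.\<close>

lemma elow_hmon_aux: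
  assumes "eigen y"
  shows "size J \<le> size I \<Longrightarrow> eigen (elow lam I * (hmon J * y)) \<and>
    (size J < size I \<or> (sum_mset J < sum_mset I \<or> sum_mset J = sum_mset I \<and> J \<noteq> I) \<longrightarrow> elow lam I * (hmon J * y) \<in> L)"
proof (induction J arbitrary: I)
  case empty
  show ?case using elow_eigen[OF assms, of I] assms eigen_L by (cases "I = {#}") auto
next
  case (add j J)
  let ?t = "\<lambda>i. ue (int i - int j) * (elow lam (I - {#i#}) * (hmon J * y))"
  have expand: "elow lam I * (hmon (add_mset j J) * y) = uh (- int j) * (elow lam I * (hmon J * y)) - 2 * (\<Sum>i\<in>#I. ?t i)"
  proof -
    have "elow lam I * (hmon (add_mset j J) * y) = (elow lam I * uh (- int j)) * (hmon J * y)"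
      by (simp add: hmon_add mult.assoc)
    then show ?thesis by (simp add: elow_uh left_diff_distrib sum_mset_mult mult.assoc)
  qed
  have 1: "uh (- int j) * (elow lam I * (hmon J * y)) \<in> L"
    using add.IH[of I] add.prems by (simp add: mem(3))
  have sz: "size J \<le> size (I - {#i#})" "size (add_mset j J) < size I \<Longrightarrow> size J < size (I - {#i#})" if "i \<in># I" for i
    using add.prems that by (auto simp: size_Diff_singleton)
  have ei: "eigen (?t i)" if "i \<in># I" for i
    using add.IH[OF sz(1)[OF that]] by (auto intro: eigen_e)
  have "eigen (- 2 * (\<Sum>i\<in>#I. ?t i))"
    using eigen_scalar[OF eigen_sum_mset[of I ?t], of "- 2"] ei by simp
  then have "eigen (elow lam I * (hmon (add_mset j J) * y))"
    unfolding expand using eigen_add[OF eigen_L[OF 1]] by fastforce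
  moreover have "elow lam I * (hmon (add_mset j J) * y) \<in> L"
    if h: "size (add_mset j J) < size I \<or> (sum_mset (add_mset j J) < sum_mset I \<or> sum_mset (add_mset j J) = sum_mset I \<and> add_mset j J \<noteq> I)"
  proof -
    have "?t i \<in> L" if i: "i \<in># I" for i
    proof (cases "size (add_mset j J) < size I")
      case True
      then show ?thesis using add.IH[OF sz(1)[OF i]] sz(2)[OF i] by (simp add: mem(3))
    next
      case False
      obtain I' where I': "I = add_mset i I'" using i by (metis multi_member_split)
      consider "i > j" | "i = j" | "i < j" by linarith
      then show ?thesis
      proof cases
        case 1
        have "eigen (elow lam (I - {#i#}) * (hmon J * y))" using add.IH[OF sz(1)[OF i]] by blast
        from eigenD[OF this, of "int i - int j"] 1 show ?thesis by (simp add: congr_0)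
      next
        case 2
        then show ?thesis using add.IH[OF sz(1)[OF i]] h False I' by (auto intro: mem(3))
      next
        case 3
        then show ?thesis using add.IH[OF sz(1)[OF i]] h False I' by (auto intro: mem(3))
      qed
    qed
    then have "(\<Sum>i\<in>#I. ?t i) \<in> L" by (rule mem_sum_mset)
    from mem(5)[OF 1 mem(3)[OF this, of 2]] show ?thesis unfolding expand .
  qed
  ultimately show ?case by blast
qed

lemma sum_mset_count_congr:
  assumes "\<And>i. i \<in># I \<Longrightarrow> i \<noteq> j \<Longrightarrow> f i \<approx> 0" "f j \<approx> x"
  shows "(\<Sum>i\<in>#I. f i) \<approx> uea_scalar (of_nat (count I j)) * x"
  using assms(1)
proof (induction I)
  case (add i I)
  then have "(\<Sum>i\<in>#I. f i) \<approx> uea_scalar (of_nat (count I j)) * x" by simp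
  moreover have "f i \<approx> (if i = j then x else 0)" using add.prems assms(2) by auto
  ultimately have "f i + (\<Sum>i\<in>#I. f i) \<approx> (if i = j then x else 0) + uea_scalar (of_nat (count I j)) * x"
    by (rule congr_add[rotated])
  then show ?case by (auto simp: uea_scalar_simps distrib_right)
qed simp

text \<open>The constant is a product of factors \<open>-2\<lambda>\<close> and of the factorials of the multiplicities.\<close>

lemma elow_hmon_same:
  assumes lam: "lam \<noteq> 0"
  shows "\<exists>c. c \<noteq> 0 \<and> (\<forall>y. eigen y \<longrightarrow> elow lam I * (hmon I * y) \<approx> uea_scalar c * y)"
proof (induction I)
  case empty
  show ?case by (rule exI[of _ 1]) simp
next
  case (add j J)
  then obtain c where c: "c \<noteq> 0" "\<And>y. eigen y \<Longrightarrow> elow lam J * (hmon J * y) \<approx> uea_scalar c * y" by blast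
  let ?I = "add_mset j J"
  have "elow lam ?I * (hmon ?I * y) \<approx> uea_scalar (- 2 * of_nat (count ?I j) * lam * c) * y" if y: "eigen y" for y
  proof -
    let ?t = "\<lambda>i. ue (int i - int j) * (elow lam (?I - {#i#}) * (hmon J * y))"
    have "elow lam ?I * (hmon ?I * y) = (elow lam ?I * uh (- int j)) * (hmon J * y)"
      by (simp add: hmon_add mult.assoc)
    also have "\<dots> = uh (- int j) * (elow lam ?I * (hmon J * y)) - 2 * (\<Sum>i\<in>#?I. ?t i)"
      unfolding elow_uh[of lam ?I] left_diff_distrib mult.assoc sum_mset_mult ..
    also have "\<dots> \<approx> 0 - 2 * (uea_scalar (of_nat (count ?I j)) * (uea_scalar lam * (uea_scalar c * y)))"
    proof (intro congr_diff congr_mult sum_mset_count_congr)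
      show "uh (- int j) * (elow lam ?I * (hmon J * y)) \<approx> 0"
        using elow_hmon_aux[OF y, of J ?I] by (simp add: congr_0 mem)
      show "?t j \<approx> uea_scalar lam * (uea_scalar c * y)"
      proof -
        have "eigen (elow lam J * (hmon J * y))" using elow_hmon_aux[OF y, of J J] by simp
        then have "ue 0 * (elow lam J * (hmon J * y)) \<approx> uea_scalar lam * (elow lam J * (hmon J * y))"
          by (auto simp: eigen_def)
        also have "\<dots> \<approx> uea_scalar lam * (uea_scalar c * y)" by (intro congr_mult c(2) y)
        finally show ?thesis by simp
      qed
      fix i assume i: "i \<in># ?I" "i \<noteq> j"
      then have iJ: "i \<in># J" by auto
      then have "size (?I - {#i#}) = size J" by (simp add: size_Diff_singleton) (metis Suc_pred iJ nonempty_has_size empty_iff set_mset_empty)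
      note aux = elow_hmon_aux[OF y, of J "?I - {#i#}"]
      show "?t i \<approx> 0"
      proof (cases "i > j")
        case True
        have "eigen (elow lam (?I - {#i#}) * (hmon J * y))" using aux \<open>size _ = _\<close> by simp
        then have "?t i \<approx> uea_scalar (if int i - int j = 0 then lam else 0) * (elow lam (?I - {#i#}) * (hmon J * y))"
          unfolding eigen_def using True by (metis diff_ge_0_iff_ge less_imp_le of_nat_le_iff)
        then show ?thesis using True by simp
      next
        case False
        obtain J' where "J = add_mset i J'" using iJ by (metis multi_member_split)
        then have "sum_mset J < sum_mset (?I - {#i#})" using False i by simp
        then show ?thesis using aux \<open>size _ = _\<close> by (simp add: congr_0 mem)
      qed
    qed
    also have "\<dots> = uea_scalar (- 2 * of_nat (count ?I j) * lam * c) * y"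
      by (simp only: uea_scalar_simps(4,5) uea_scalar_numeral mult.assoc) simp
    finally show ?thesis .
  qed
  moreover have "- 2 * of_nat (count ?I j) * lam * c \<noteq> 0" using lam c(1)
    by (simp only: mult_eq_0_iff of_nat_eq_0_iff count_eq_zero_iff) simp
  ultimately show ?case by blast
qed

lemma hlow_emon_expand:
  assumes "whit z" and that: "i > 0"
  shows "hlow (add_mset i I) * (emon A * z) \<approx>
     2 * (\<Sum>a\<in>#A. hlow I * (ue (int i - int a) * (emon (A - {#a#}) * z)))"
proof -
  have "hlow (add_mset i I) * (emon A * z) = hlow I * ((uh (int i) * emon A) * z)"
    by (simp add: hlow_add uh_hlow mult.assoc)
  also have "\<dots> = hlow I * (emon A * (uh (int i) * z)) + hlow I * (2 * (\<Sum>a\<in>#A. ue (int i - int a) * (emon (A - {#a#}) * z)))"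
    by (simp add: uh_emon distrib_right distrib_left sum_mset_mult mult.assoc)
  also have "\<dots> \<approx> 0 + hlow I * (2 * (\<Sum>a\<in>#A. ue (int i - int a) * (emon (A - {#a#}) * z)))"
    using whit_h[OF assms(1), of "int i"] that by (intro congr_add) (auto simp: congr_0 intro!: mem(3))
  also have "\<dots> = 2 * (\<Sum>a\<in>#A. hlow I * (ue (int i - int a) * (emon (A - {#a#}) * z)))"
    by (simp add: mult_2 mult_2_right distrib_left mult_sum_mset)
  finally show ?thesis .
qed

lemma hlow_emon_term:
  assumes z: "whit z" and a: "a \<in># A" and i: "i > 0"
  shows "a < i \<Longrightarrow> hlow I * (ue (int i - int a) * (emon (A - {#a#}) * z)) \<approx> 0"
    "a = i \<Longrightarrow> hlow I * (ue (int i - int a) * (emon (A - {#a#}) * z)) \<approx> uea_scalar lam * (hlow I * (emon (A - {#a#}) * z))"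
    "a > i \<Longrightarrow> hlow I * (ue (int i - int a) * (emon (A - {#a#}) * z)) = hlow I * (emon (add_mset (a - i) (A - {#a#})) * z)"
proof -
  have eig: "ue k * (emon (A - {#a#}) * z) \<approx> uea_scalar (if k = 0 then lam else 0) * (emon (A - {#a#}) * z)" if "k \<ge> 0" for k
    using eigen_emon[OF whit_eigen[OF z], of "A - {#a#}"] that by (auto simp: eigen_def)
  show "a < i \<Longrightarrow> hlow I * (ue (int i - int a) * (emon (A - {#a#}) * z)) \<approx> 0"
    using congr_mult[OF eig[of "int i - int a"], of "hlow I"] by simp
  show "a = i \<Longrightarrow> hlow I * (ue (int i - int a) * (emon (A - {#a#}) * z)) \<approx> uea_scalar lam * (hlow I * (emon (A - {#a#}) * z))"
    using congr_mult[OF eig[of 0], of "hlow I"] by (simp add: uea_scalar_left_central)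
  show "a > i \<Longrightarrow> hlow I * (ue (int i - int a) * (emon (A - {#a#}) * z)) = hlow I * (emon (add_mset (a - i) (A - {#a#})) * z)"
    by (simp add: emon_add mult.assoc of_nat_diff)
qed

text \<open>Each \<open>h(i)\<close> turns one factor \<open>e(-a)\<close> into \<open>2e(i-a)\<close>, which lowers the index sum by \<open>i\<close>. It removes a factor only
  if \<open>a = i\<close>; so a complete reduction needs at least as many operators as factors, and equally many only if
  the multisets agree.\<close>

lemma hlow_emon_zero:
  assumes z: "whit z"
  shows "0 \<notin># I \<Longrightarrow> 0 \<notin># A \<Longrightarrow>
    sum_mset A < sum_mset I \<or> sum_mset A = sum_mset I \<and> (size A > size I \<or> size A = size I \<and> A \<noteq> I) \<Longrightarrow>
    hlow I * (emon A * z) \<approx> 0"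
proof (induction I arbitrary: A)
  case empty
  then show ?case by (cases A) auto
next
  case (add i I)
  have i: "i > 0" using add.prems by auto
  have "hlow I * (ue (int i - int a) * (emon (A - {#a#}) * z)) \<approx> 0" if a: "a \<in># A" for a
  proof -
    obtain A' where A': "A = add_mset a A'" using a by (metis multi_member_split)
    consider "a < i" | "a = i" | "a > i" by linarith
    then show ?thesis
    proof cases
      case 1
      then show ?thesis by (rule hlow_emon_term(1)[OF z a i])
    next
      case 2
      have "hlow I * (emon A' * z) \<approx> 0" using add.prems A' 2 by (intro add.IH) auto
      from congr_trans[OF hlow_emon_term(2)[OF z a i 2] congr_mult[of _ 0]] this A' show ?thesis by simp
    next
      case 3
      have "hlow I * (emon (add_mset (a - i) A') * z) \<approx> 0" using add.prems A' 3 by (intro add.IH) auto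
      then show ?thesis using hlow_emon_term(3)[OF z a i 3, of I] A' by simp
    qed
  qed
  then have "(\<Sum>a\<in>#A. hlow I * (ue (int i - int a) * (emon (A - {#a#}) * z))) \<approx> 0"
    by (simp add: congr_0 mem_sum_mset)
  then show ?case using congr_trans[OF hlow_emon_expand[OF z i] congr_mult[of _ 0 2]] by simp
qed

lemma hlow_emon_same:
  assumes lam: "lam \<noteq> 0" and "0 \<notin># I"
  shows "\<exists>c. c \<noteq> 0 \<and> (\<forall>z. whit z \<longrightarrow> hlow I * (emon I * z) \<approx> uea_scalar c * z)"
  using assms(2)
proof (induction I)
  case empty
  show ?case by (rule exI[of _ 1]) simp
next
  case (add i I)
  then obtain c where c: "c \<noteq> 0" "\<And>z. whit z \<Longrightarrow> hlow I * (emon I * z) \<approx> uea_scalar c * z" by auto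
  let ?I = "add_mset i I"
  have i: "i > 0" using add.prems by auto
  have "hlow ?I * (emon ?I * z) \<approx> uea_scalar (2 * of_nat (count ?I i) * lam * c) * z" if z: "whit z" for z
  proof -
    let ?t = "\<lambda>a. hlow I * (ue (int i - int a) * (emon (?I - {#a#}) * z))"
    have "(\<Sum>a\<in>#?I. ?t a) \<approx> uea_scalar (of_nat (count ?I i)) * (uea_scalar lam * (uea_scalar c * z))"
    proof (rule sum_mset_count_congr)
      have "?t i \<approx> uea_scalar lam * (hlow I * (emon I * z))" using hlow_emon_term(2)[OF z _ i, of i ?I I] by simp
      also have "\<dots> \<approx> uea_scalar lam * (uea_scalar c * z)" by (intro congr_mult c z)
      finally show "?t i \<approx> uea_scalar lam * (uea_scalar c * z)" .
      fix a assume a: "a \<in># ?I" "a \<noteq> i"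
      then obtain I' where I': "I = add_mset a I'" by (metis insert_noteq_member multi_member_split)
      show "?t a \<approx> 0"
      proof (cases "a < i")
        case True
        then show ?thesis by (rule hlow_emon_term(1)[OF z a(1) i])
      next
        case False
        then have "hlow I * (emon (add_mset (a - i) (?I - {#a#})) * z) \<approx> 0"
          using add.prems a I' by (intro hlow_emon_zero z) auto
        then show ?thesis using hlow_emon_term(3)[OF z a(1) i, of I] False a by simp
      qed
    qed
    from congr_trans[OF hlow_emon_expand[OF z i] congr_mult[OF this]] show ?thesis
      by (simp only: uea_scalar_simps(4) uea_scalar_numeral mult.assoc)
  qed
  moreover have "2 * of_nat (count ?I i) * lam * c \<noteq> 0" using lam c(1)
    by (simp only: mult_eq_0_iff of_nat_eq_0_iff count_eq_zero_iff) simp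
  ultimately show ?case by blast
qed

text \<open>The multiset \<open>K\<close> of the surviving term has the largest size and then the largest sum; after the \<open>h\<close> are
  removed, \<open>A\<close> has the largest sum and then the smallest size.\<close>

theorem lowering:
  assumes lam: "lam \<noteq> 0" and S: "finite S" and A: "\<And>K A. (K, A) \<in> S \<Longrightarrow> 0 \<notin># A"
    and whit: "\<And>s. s \<in> S \<Longrightarrow> whit (z s)" and nz: "s1 \<in> S" "z s1 \<notin> L"
  obtains u s c where "s \<in> S" "z s \<notin> L" "c \<noteq> 0"
    "u * (\<Sum>(K, A)\<in>S. hmon K * (emon A * z (K, A))) \<approx> uea_scalar c * z s"
proof -
  define S' where "S' = {s \<in> S. z s \<notin> L}"
  have S': "finite S'" "S' \<noteq> {}" using S nz unfolding S'_def by (simp, blast)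
  let ?T = "\<lambda>(K, A). hmon K * (emon A * z (K, A))"
  have "sum ?T S = sum ?T (S - S') + sum ?T S'"
    using S by (intro sum.subset_diff) (auto simp: S'_def)
  moreover have "sum ?T (S - S') \<in> L" by (rule mem_sum) (auto simp: S'_def intro!: mem(3))
  ultimately have red: "sum ?T S \<approx> sum ?T S'" by (simp add: mod_eq_def)
  obtain s0 where s0: "s0 \<in> S'" "\<And>s. s \<in> S' \<Longrightarrow> size (fst s) \<le> size (fst s0)"
    using finite_argmax[OF S', of "\<lambda>s. size (fst s)"] by blast
  define S2 where "S2 = {s \<in> S'. size (fst s) = size (fst s0)}"
  have "finite S2" "s0 \<in> S2" using S' s0(1) by (auto simp: S2_def)
  then obtain s2 where "s2 \<in> S2" "\<And>s. s \<in> S2 \<Longrightarrow> sum_mset (fst s) \<le> sum_mset (fst s2)"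
    using finite_argmax[of S2 "\<lambda>s. sum_mset (fst s)"] by (metis empty_iff)
  then have s2: "s2 \<in> S'" "size (fst s2) = size (fst s0)"
      "\<And>s. s \<in> S' \<Longrightarrow> size (fst s) = size (fst s0) \<Longrightarrow> sum_mset (fst s) \<le> sum_mset (fst s2)"
    by (simp_all add: S2_def)
  define K0 where "K0 = fst s2"
  define R where "R = {A. (K0, A) \<in> S'}"
  have R: "finite R" "R \<noteq> {}"
  proof -
    have "R = snd ` {s \<in> S'. fst s = K0}" by (force simp: R_def)
    then show "finite R" using S' by simp
    show "R \<noteq> {}" using s2(1) by (auto simp: R_def K0_def) (metis prod.collapse)
  qed
  obtain c where c: "c \<noteq> 0" "\<And>y. eigen y \<Longrightarrow> elow lam K0 * (hmon K0 * y) \<approx> uea_scalar c * y"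
    using elow_hmon_same[OF lam, of K0] by blast
  have eig: "eigen (emon A * z (K, A))" if "(K, A) \<in> S'" for K A
    using that whit by (auto simp: S'_def intro: eigen_emon whit_eigen)
  have "elow lam K0 * sum ?T S' = (\<Sum>s\<in>S'. elow lam K0 * ?T s)" by (rule sum_distrib_left)
  also have "\<dots> \<approx> (\<Sum>s\<in>S'. if fst s = K0 then uea_scalar c * (emon (snd s) * z s) else 0)"
  proof (rule congr_sum)
    fix s assume s: "s \<in> S'"
    obtain K A where KA: "s = (K, A)" by (cases s)
    show "elow lam K0 * ?T s \<approx> (if fst s = K0 then uea_scalar c * (emon (snd s) * z s) else 0)"
    proof (cases "K = K0")
      case True
      then show ?thesis using c(2)[OF eig[of K A]] s KA by simp
    next
      case False
      have "size K \<le> size K0" using s0(2)[OF s] s2(2) KA by (simp add: K0_def)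
      moreover have "size K = size K0 \<Longrightarrow> sum_mset K \<le> sum_mset K0"
        using s2(2) s2(3)[OF s] KA by (simp add: K0_def)
      ultimately show ?thesis using elow_hmon_aux[OF eig[of K A], of K K0] s KA False
        by (auto simp: congr_0 le_less)
    qed
  qed
  also have "\<dots> = (\<Sum>s\<in>{s \<in> S'. fst s = K0}. uea_scalar c * (emon (snd s) * z s))"
    using S' by (simp add: sum.inter_filter)
  also have "\<dots> = (\<Sum>A\<in>R. uea_scalar c * (emon A * z (K0, A)))"
    by (rule sum.reindex_bij_witness[of _ "\<lambda>A. (K0, A)" snd]) (auto simp: R_def)
  finally have E: "elow lam K0 * sum ?T S' \<approx> (\<Sum>A\<in>R. uea_scalar c * (emon A * z (K0, A)))" .
  obtain A1 where A1: "A1 \<in> R" "\<And>A. A \<in> R \<Longrightarrow> sum_mset A \<le> sum_mset A1"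
    using finite_argmax[OF R, of sum_mset] by blast
  let ?R1 = "{A \<in> R. sum_mset A = sum_mset A1}"
  obtain A0 where A0: "A0 \<in> ?R1" "\<And>A. A \<in> ?R1 \<Longrightarrow> size A0 \<le> size A"
    using ex_has_least_nat[of "\<lambda>A. A \<in> ?R1" A1 size] A1 by blast
  have A0R: "A0 \<in> R" using A0 by auto
  have pos: "0 \<notin># A" if "A \<in> R" for A using that A by (auto simp: R_def S'_def)
  have wh: "whit (z (K0, A))" if "A \<in> R" for A using that whit by (auto simp: R_def S'_def)
  obtain c' where c': "c' \<noteq> 0" "\<And>z. whit z \<Longrightarrow> hlow A0 * (emon A0 * z) \<approx> uea_scalar c' * z"
    using hlow_emon_same[OF lam pos[OF A0R]] by blast
  have "hlow A0 * (\<Sum>A\<in>R. uea_scalar c * (emon A * z (K0, A))) = (\<Sum>A\<in>R. uea_scalar c * (hlow A0 * (emon A * z (K0, A))))"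
    by (simp add: sum_distrib_left uea_scalar_left_central)
  also have "\<dots> \<approx> (\<Sum>A\<in>R. uea_scalar c * (if A = A0 then uea_scalar c' * z (K0, A) else 0))"
  proof (intro congr_sum congr_mult)
    fix A assume AR: "A \<in> R"
    show "hlow A0 * (emon A * z (K0, A)) \<approx> (if A = A0 then uea_scalar c' * z (K0, A) else 0)"
    proof (cases "A = A0")
      case True
      then show ?thesis using c'(2)[OF wh[OF AR]] by simp
    next
      case False
      have "sum_mset A < sum_mset A0 \<or> sum_mset A = sum_mset A0 \<and> (size A > size A0 \<or> size A = size A0 \<and> A \<noteq> A0)"
        using A1(2)[OF AR] A0(1) A0(2)[of A] AR False by (auto simp: le_less)
      then show ?thesis using hlow_emon_zero[OF wh[OF AR] pos[OF A0R] pos[OF AR]] False by simp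
    qed
  qed
  also have "\<dots> = uea_scalar (c * c') * z (K0, A0)"
    using R A0R by (simp add: if_distrib[of "\<lambda>x. uea_scalar c * x"] uea_scalar_simps(4) mult.assoc cong: if_cong)
  finally have F: "hlow A0 * (\<Sum>A\<in>R. uea_scalar c * (emon A * z (K0, A))) \<approx> uea_scalar (c * c') * z (K0, A0)" .
  have "(hlow A0 * elow lam K0) * sum ?T S \<approx> hlow A0 * (elow lam K0 * sum ?T S')"
    unfolding mult.assoc by (intro congr_mult red)
  also have "\<dots> \<approx> uea_scalar (c * c') * z (K0, A0)"
    using congr_trans[OF congr_mult[OF E] F] .
  finally show ?thesis
    using that[of "(K0, A0)" "c * c'" "hlow A0 * elow lam K0"] A0R c(1) c'(1) by (auto simp: R_def S'_def)
qed

end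

section \<open>Polynomials in the Sugawara operators\<close>

definition tmon :: "nat multiset \<Rightarrow> affine_uea" where
  "tmon M = prod_list (map (\<lambda>m. sug_elt (- int m)) (sorted_list_of_multiset M))"

text \<open>Evaluation of a polynomial at the commuting elements: \<open>X\<^sub>m\<close> goes to \<open>t(-m)\<close>. They commute only modulo \<open>J\<close>, so a
  monomial is multiplied in increasing order of its indices.\<close>

definition tau :: "Zpoly \<Rightarrow> affine_uea" where
  "tau p = (\<Sum>M\<in>keys p. uea_scalar (lookup p M) * tmon M)"

lemma tau_superset:
  "finite A \<Longrightarrow> keys p \<subseteq> A \<Longrightarrow> tau p = (\<Sum>M\<in>A. uea_scalar (lookup p M) * tmon M)"
  unfolding tau_def by (intro sum.mono_neutral_left) (auto simp: in_keys_iff)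

lemma tau_add: "tau (p + q) = tau p + tau q"
proof -
  define A where "A = keys p \<union> keys q"
  have A: "finite A" "keys p \<subseteq> A" "keys q \<subseteq> A" "keys (p + q) \<subseteq> A"
    using Poly_Mapping.keys_add[of p q] by (auto simp: A_def)
  show ?thesis
    using A by (simp add: tau_superset[OF A(1)] lookup_add uea_scalar_simps distrib_right sum.distrib)
qed

lemma tau_scale: "tau (scale_pm r p) = uea_scalar r * tau p"
proof -
  have "keys (scale_pm r p) \<subseteq> keys p" by (auto simp: in_keys_iff)
  from tau_superset[OF finite_keys this] show ?thesis
    by (simp add: tau_def sum_distrib_left uea_scalar_simps mult.assoc)
qed

lemma tau_single: "tau (single M r) = uea_scalar r * tmon M"
  by (cases "r = 0") (simp_all add: tau_def)

lemma tau_1: "tau 1 = 1"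
  using tau_single[of "{#}" 1] by (simp add: tmon_def)

lemma tau_0: "tau 0 = 0" by (simp add: tau_def)

lemma tau_diff: "tau (p - q) = tau p - tau q"
  using tau_add[of "p - q" q] by simp

text \<open>Ideals of the polynomial ring, which scalars and variables generate: stability under these
  is stability under every polynomial.\<close>

definition Zideal :: "Zpoly set \<Rightarrow> bool" where
  "Zideal I \<longleftrightarrow> 0 \<in> I \<and> (\<forall>p\<in>I. \<forall>q\<in>I. p + q \<in> I) \<and> (\<forall>p\<in>I. \<forall>r. scale_pm r p \<in> I) \<and> (\<forall>p\<in>I. \<forall>m. Zvar m * p \<in> I)"

context whittaker_quotient
begin

lemma whit_1: "whit 1"
  using whittaker_subset by (auto simp: whit_def)
lemma whit_add: "whit z \<Longrightarrow> whit z' \<Longrightarrow> whit (z + z')"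
  by (auto simp: whit_def distrib_left intro: mem)
lemma whit_L: "z \<in> L \<Longrightarrow> whit z"
  by (auto simp: whit_def intro: mem)
lemma whit_sum: "(\<And>s. s \<in> S \<Longrightarrow> whit (f s)) \<Longrightarrow> whit (sum f S)"
  by (induction S rule: infinite_finite_induct) (auto intro: whit_add whit_L mem)
lemma whit_scalar: "whit z \<Longrightarrow> whit (uea_scalar r * z)"
  unfolding whit_def uea_scalar_left_central by (blast intro: mem(3))
lemma whit_sug: "whit z \<Longrightarrow> whit (z * sug_elt n)"
  unfolding whit_def by (metis mult.assoc sug_elt_right)

lemma whit_congr_mult:
  assumes "mod_eq (whittaker_ideal lam mu) u v" "whit z" shows "u * z \<approx> v * z"
  using assms by (auto simp: mod_eq_def whit_def simp flip: left_diff_distrib)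

text \<open>On a Whittaker vector left multiplication by \<open>t(n)\<close> is the operator \<open>T(n)\<close>, and this is right multiplication
  by \<open>t(n)\<close> everywhere.\<close>

lemma sug_elt_central: "whit z \<Longrightarrow> sug_elt n * z \<approx> z * sug_elt n"
proof -
  assume z: "whit z"
  interpret J: whittaker_quotient "whittaker_ideal lam mu" lam mu by (rule whittaker_quotient_universal)
  from J.sug_acts_1[of n] obtain A where A: "\<And>N. N \<ge> A \<Longrightarrow> mod_eq (whittaker_ideal lam mu) (sug_partial n N) (sug_elt n)"
    by (auto simp: J.sug_acts_def)
  have "sug_acts n z (sug_elt n * z)"
    by (rule sug_actsI[of A]) (use A z whit_congr_mult in blast)
  from sug_acts_unique[OF this sug_acts_elt] show ?thesis .
qed

lemma whit_prod_list: "whit (prod_list (map (\<lambda>m. sug_elt (- int m)) xs))"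
proof (induction xs rule: rev_induct)
  case (snoc x xs)
  then show ?case using whit_sug[OF snoc] by simp
qed (simp add: whit_1)

lemma prod_list_right: "u \<in> L \<Longrightarrow> u * prod_list (map (\<lambda>m. sug_elt (- int m)) xs) \<in> L"
  by (induction xs arbitrary: u) (auto simp: sug_elt_right simp flip: mult.assoc)

lemma prod_list_insort: "prod_list (map (\<lambda>m. sug_elt (- int m)) (insort m xs))
   \<approx> sug_elt (- int m) * prod_list (map (\<lambda>m. sug_elt (- int m)) xs)"
proof (induction xs)
  case (Cons x xs)
  let ?t = "\<lambda>m. sug_elt (- int m)" and ?p = "\<lambda>xs. prod_list (map (\<lambda>m. sug_elt (- int m)) xs)"
  have "?t x * ?p (insort m xs) \<approx> ?t x * (?t m * ?p xs)" by (rule congr_mult[OF Cons])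
  also have "?t x * (?t m * ?p xs) \<approx> ?t m * (?t x * ?p xs)"
  proof -
    have "whit (?t m)" using whit_sug[OF whit_1, of "- int m"] by simp
    from sug_elt_central[OF this, of "- int x"] prod_list_right[of "?t x * ?t m - ?t m * ?t x" xs]
    show ?thesis by (simp add: mod_eq_def left_diff_distrib mult.assoc)
  qed
  finally show ?case by simp
qed simp

lemma tmon_add: "tmon (add_mset m M) \<approx> sug_elt (- int m) * tmon M"
  unfolding tmon_def sorted_list_of_multiset_insert by (rule prod_list_insort)

lemma whit_tmon: "whit (tmon M)" unfolding tmon_def by (rule whit_prod_list)

lemma whit_tau: "whit (tau p)"
  unfolding tau_def by (intro whit_sum whit_scalar whit_tmon)

lemma tau_Zvar_left: "tau (Zvar m * p) \<approx> sug_elt (- int m) * tau p"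
proof (induction p rule: poly_mapping_induct')
  case (single M r)
  have "Zvar m * single M r = single (add_mset m M) r"
    by (simp add: Zvar_def Zmon_def mult_single)
  then show ?case using congr_mult[OF tmon_add, of "uea_scalar r"] by (simp add: tau_single uea_scalar_left_central)
next
  case (add p q)
  then show ?case by (simp add: distrib_left tau_add congr_add)
qed

lemma tau_Zvar: "tau (Zvar m) \<approx> sug_elt (- int m)"
  using tau_Zvar_left[of m 1] by (simp add: tau_1)

subsection \<open>Spanning by ordered monomials\<close>

text \<open>The span of the ordered monomials with coefficients in a set \<open>I\<close> of polynomials. Taking for \<open>I\<close> an ideal gives
  an upper bound for left ideals (\<open>central_ideal_proper\<close>), taking all polynomials gives spanning.\<close>

inductive_set spanned :: "Zpoly set \<Rightarrow> affine_uea set" for I where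
  spanned_L: "v \<in> L \<Longrightarrow> v \<in> spanned I"
| spanned_mon: "p \<in> I \<Longrightarrow> 0 \<notin># A \<Longrightarrow> hmon K * (emon A * tau p) \<in> spanned I"
| spanned_add: "u \<in> spanned I \<Longrightarrow> v \<in> spanned I \<Longrightarrow> u + v \<in> spanned I"

lemma spanned_congr: "u \<approx> v \<Longrightarrow> v \<in> spanned I \<Longrightarrow> u \<in> spanned I"
  using spanned_add[OF spanned_L[of "u - v"], of v I] by (simp add: mod_eq_def)

lemma spanned_sum: "(\<And>s. s \<in> S \<Longrightarrow> f s \<in> spanned I) \<Longrightarrow> sum f S \<in> spanned I"
  by (induction S rule: infinite_finite_induct) (auto intro: spanned_add spanned_L mem)

context
  fixes I assumes I: "Zideal I" and lam: "lam \<noteq> 0"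
begin

lemma spanned_scalar: "v \<in> spanned I \<Longrightarrow> uea_scalar r * v \<in> spanned I"
proof (induction rule: spanned.induct)
  case (spanned_L v) then show ?case by (intro spanned.spanned_L mem(3))
next
  case (spanned_mon p A K)
  have "hmon K * (emon A * tau (scale_pm r p)) \<in> spanned I"
    using I spanned_mon by (intro spanned.spanned_mon) (auto simp: Zideal_def)
  then show ?case by (simp add: tau_scale uea_scalar_left_central)
qed (auto simp: distrib_left intro: spanned_add)

lemma spanned_diff: "u \<in> spanned I \<Longrightarrow> v \<in> spanned I \<Longrightarrow> u - v \<in> spanned I"
  using spanned_add[of u I "- v"] spanned_scalar[of v "- 1"] by simp

lemma spanned_two: "v \<in> spanned I \<Longrightarrow> 2 * v \<in> spanned I"
  using spanned_scalar[of v 2] by simp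

lemma spanned_c: "v \<in> spanned I \<Longrightarrow> of_int n * (uc * v) \<in> spanned I"
proof -
  assume v: "v \<in> spanned I"
  have "uc * v \<in> spanned I" by (rule spanned_congr[OF c_act]) (use spanned_scalar[OF v, of "- 2"] in simp)
  from spanned_scalar[OF this, of "of_int n"] show ?thesis by (simp add: uea_scalar_of_int)
qed

lemma spanned_hneg: "v \<in> spanned I \<Longrightarrow> uh (- int j) * v \<in> spanned I"
proof (induction rule: spanned.induct)
  case (spanned_L v) then show ?case by (intro spanned.spanned_L mem(3))
next
  case (spanned_mon p A K)
  then show ?case using spanned.spanned_mon[of p I A "add_mset j K"] by (simp add: hmon_add mult.assoc)
qed (auto simp: distrib_left intro: spanned_add)

lemma spanned_e_tau:
  assumes p: "p \<in> I" and A: "0 \<notin># A" shows "ue n * (emon A * tau p) \<in> spanned I"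
proof (cases "n < 0")
  case True
  then have "ue n * (emon A * tau p) = hmon {#} * (emon (add_mset (nat (- n)) A) * tau p)"
    by (simp add: emon_add mult.assoc)
  then show ?thesis using spanned_mon[OF p, of "add_mset (nat (- n)) A" "{#}"] A True by simp
next
  case False
  have "ue n * (emon A * tau p) \<approx> uea_scalar (if n = 0 then lam else 0) * (emon A * tau p)"
    using eigenD[OF eigen_emon[OF whit_eigen[OF whit_tau]], of n] False by simp
  moreover have "emon A * tau p \<in> spanned I" using spanned_mon[OF p A, of "{#}"] by simp
  ultimately show ?thesis using spanned_congr spanned_scalar by blast
qed

lemma spanned_e: "v \<in> spanned I \<Longrightarrow> ue n * v \<in> spanned I"
proof (induction rule: spanned.induct)
  case (spanned_L v) then show ?case by (intro spanned.spanned_L mem(3))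
next
  case (spanned_mon p A K)
  show ?case
  proof (induction K arbitrary: n)
    case empty
    then show ?case using spanned_e_tau[OF spanned_mon] by simp
  next
    case (add j K)
    have "ue n * (hmon (add_mset j K) * (emon A * tau p)) = uh (- int j) * (ue n * (hmon K * (emon A * tau p)))
       - 2 * (ue (- int j + n) * (hmon K * (emon A * tau p)))"
      by (simp add: hmon_add mult.assoc uh_ue_left)
    then show ?case using add by (metis spanned_diff spanned_hneg spanned_two)
  qed
qed (auto simp: distrib_left intro: spanned_add)

lemma spanned_h_tau:
  assumes p: "p \<in> I" and n: "n \<ge> 1" and A: "0 \<notin># A" shows "uh n * (emon A * tau p) \<in> spanned I"
  using A
proof (induction A)
  case empty
  show ?case using whit_h[OF whit_tau n] by (simp add: spanned_L)
next
  case (add a A)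
  have "uh n * (emon (add_mset a A) * tau p) = ue (- int a) * (uh n * (emon A * tau p)) + 2 * (ue (n - int a) * (emon A * tau p))"
    by (simp add: emon_add mult.assoc uh_ue_left)
  moreover have "emon A * tau p \<in> spanned I" using spanned_mon[OF p, of A "{#}"] add by simp
  ultimately show ?case using add by (auto intro!: spanned_add spanned_e spanned_two)
qed

lemma spanned_h: "v \<in> spanned I \<Longrightarrow> uh n * v \<in> spanned I"
proof (cases "n \<ge> 1")
  case False
  then have "n = - int (nat (- n))" by simp
  then show "v \<in> spanned I \<Longrightarrow> uh n * v \<in> spanned I" using spanned_hneg by metis
next
  case n: True
  show "v \<in> spanned I \<Longrightarrow> uh n * v \<in> spanned I"
  proof (induction rule: spanned.induct)
    case (spanned_L v) then show ?case by (intro spanned.spanned_L mem(3))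
  next
    case (spanned_mon p A K)
    show ?case
    proof (induction K)
      case empty
      then show ?case using spanned_h_tau[OF spanned_mon(1) n spanned_mon(2)] by simp
    next
      case (add j K)
      have X: "hmon K * (emon A * tau p) \<in> spanned I" using spanned_mon by (rule spanned.spanned_mon)
      have "uh n * (hmon (add_mset j K) * (emon A * tau p)) = uh (- int j) * (uh n * (hmon K * (emon A * tau p)))
       + (if n + - int j = 0 then 2 * (of_int n * (uc * (hmon K * (emon A * tau p)))) else 0)"
        unfolding hmon_add mult.assoc by (subst uh_uh_left) (simp add: mult.assoc)
      then show ?case
        using spanned_add[OF spanned_hneg[OF add.IH, of j] spanned_two[OF spanned_c[OF X, of n]]]
          spanned_hneg[OF add.IH, of j]
        by (auto split: if_splits)
    qed
  qed (auto simp: distrib_left intro: spanned_add)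
qed

text \<open>By induction downwards in \<open>n\<close>: the formula for \<open>t(n)\<close> is solved for \<open>f(n)\<close>, and \<open>t(n)\<close> itself multiplies the
  polynomial by a variable.\<close>

lemma spanned_f_tau:
  assumes p: "p \<in> I" shows "uf n * tau p \<in> spanned I"
proof (induction "nat (2 - n)" arbitrary: n rule: less_induct)
  case less
  have tp: "tau p \<in> spanned I" using spanned_mon[OF p, of "{#}" "{#}"] by simp
  interpret J: whittaker_quotient "whittaker_ideal lam mu" lam mu by (rule whittaker_quotient_universal)
  show ?case
  proof (cases "n \<ge> 1")
    case True
    from spanned_congr[OF whit_f[OF whit_tau True] spanned_scalar[OF tp]] show ?thesis .
  next
    case False
    then have n: "n \<le> 0" by simp
    define r where "r = (\<Sum>j\<in>{n..<0}. ue j * (uf (n - j) * tau p)) + uea_scalar mu * (ue (n - 1) * tau p)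
      + uea_scalar (of_int (n + 1) / 2) * (uh n * tau p) + uea_scalar (1/4) * (\<Sum>j\<in>{n..0}. uh j * (uh (n - j) * tau p))"
    have "sug_elt n * tau p \<approx> uea_scalar lam * (uf n * tau p) + r"
      using whit_congr_mult[OF J.sug_elt_nonpos[OF n] whit_tau[of p]]
      by (simp add: r_def distrib_right sum_distrib_right mult.assoc add.assoc)
    moreover have "tau (Zvar (nat (- n)) * p) \<approx> sug_elt n * tau p"
      using tau_Zvar_left[of "nat (- n)" p] n by simp
    ultimately have "tau (Zvar (nat (- n)) * p) - r \<approx> uea_scalar lam * (uf n * tau p)"
      using congr_diff[OF congr_trans congr_refl[of r]] by fastforce
    from congr_sym[OF congr_mult[OF this, of "uea_scalar (1/lam)"]]
    have "uf n * tau p \<approx> uea_scalar (1/lam) * (tau (Zvar (nat (- n)) * p) - r)"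
      using lam uea_scalar_simps(4)[of "1/lam" lam] by (simp flip: mult.assoc)
    moreover have "tau (Zvar (nat (- n)) * p) \<in> spanned I"
      using spanned_mon[of "Zvar (nat (- n)) * p" I "{#}" "{#}"] I p by (simp add: Zideal_def)
    moreover have "r \<in> spanned I"
      unfolding r_def using less n
      by (intro spanned_add spanned_sum spanned_scalar spanned_e spanned_h tp) auto
    ultimately show ?thesis using spanned_congr spanned_scalar spanned_diff by blast
  qed
qed

lemma spanned_f: "v \<in> spanned I \<Longrightarrow> uf n * v \<in> spanned I"
proof (induction rule: spanned.induct)
  case (spanned_L v) then show ?case by (intro spanned.spanned_L mem(3))
next
  case (spanned_mon p A K)
  have 1: "uf n * (emon A * tau p) \<in> spanned I" for n
    using spanned_mon(2)
  proof (induction A arbitrary: n)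
    case empty
    then show ?case using spanned_f_tau[OF spanned_mon(1)] by simp
  next
    case (add a A)
    have X: "emon A * tau p \<in> spanned I" using spanned.spanned_mon[OF spanned_mon(1), of A "{#}"] add by simp
    have "uf n * (emon (add_mset a A) * tau p) = ue (- int a) * (uf n * (emon A * tau p)) - uh (- int a + n) * (emon A * tau p)
       - (if - int a + n = 0 then of_int (- int a) * (uc * (emon A * tau p)) else 0)"
      unfolding emon_add mult.assoc ue_uf_left[of "- int a" n] by simp
    moreover have "uf n * (emon A * tau p) \<in> spanned I" using add by simp
    ultimately show ?case using X
      by (auto intro!: spanned_diff spanned_e spanned_h spanned_c simp del: of_int_minus of_int_of_nat_eq)
  qed
  show ?case
  proof (induction K arbitrary: n)
    case empty
    then show ?case using 1 by simp
  next
    case (add j K)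
    have "uf n * (hmon (add_mset j K) * (emon A * tau p)) = uh (- int j) * (uf n * (hmon K * (emon A * tau p)))
       + 2 * (uf (- int j + n) * (hmon K * (emon A * tau p)))"
      by (simp add: hmon_add mult.assoc uh_uf_left)
    then show ?case using add by (metis spanned_add spanned_hneg spanned_two)
  qed
qed (auto simp: distrib_left intro: spanned_add)

lemma left_ideal_spanned: "left_ideal (spanned I)"
proof -
  have "a * v \<in> spanned I" if v: "v \<in> spanned I" for a v
  proof (induction a rule: uea_induct)
    case (scalar r) show ?case by (rule spanned_scalar[OF v])
  next
    case (c u) then show ?case using spanned_c[of "u * v" 1] by (simp add: mult.assoc)
  qed (auto simp: distrib_right mult.assoc intro: spanned_add spanned_e spanned_f spanned_h)
  then show ?thesis
    unfolding left_ideal_def by (auto intro: spanned_add spanned_L mem)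
qed

lemma spanned_family:
  "v \<in> spanned I \<Longrightarrow> \<exists>S p. finite S \<and> (\<forall>K A. (K, A) \<in> S \<longrightarrow> 0 \<notin># A) \<and> (\<forall>s. p s \<in> I) \<and> (\<forall>s. s \<notin> S \<longrightarrow> p s = 0) \<and>
     v \<approx> (\<Sum>(K, A)\<in>S. hmon K * (emon A * tau (p (K, A))))"
proof (induction rule: spanned.induct)
  case (spanned_L v)
  then show ?case using I by (intro exI[of _ "{}"] exI[of _ "\<lambda>_. 0"]) (auto simp: congr_0 Zideal_def)
next
  case (spanned_mon p A K)
  then show ?case using I
    by (intro exI[of _ "{(K, A)}"] exI[of _ "\<lambda>s. if s = (K, A) then p else 0"]) (auto simp: Zideal_def)
next
  case (spanned_add u v)
  then obtain S p S' p' where S: "finite S" "\<And>K A. (K, A) \<in> S \<Longrightarrow> 0 \<notin># A" "\<And>s. p s \<in> I" "\<And>s. s \<notin> S \<Longrightarrow> p s = 0"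
     "u \<approx> (\<Sum>(K, A)\<in>S. hmon K * (emon A * tau (p (K, A))))"
   and S': "finite S'" "\<And>K A. (K, A) \<in> S' \<Longrightarrow> 0 \<notin># A" "\<And>s. p' s \<in> I" "\<And>s. s \<notin> S' \<Longrightarrow> p' s = 0"
     "v \<approx> (\<Sum>(K, A)\<in>S'. hmon K * (emon A * tau (p' (K, A))))"
    by blast
  have ext: "(\<Sum>(K, A)\<in>S. hmon K * (emon A * tau (p (K, A)))) = (\<Sum>(K, A)\<in>S \<union> S'. hmon K * (emon A * tau (p (K, A))))"
    "(\<Sum>(K, A)\<in>S'. hmon K * (emon A * tau (p' (K, A)))) = (\<Sum>(K, A)\<in>S \<union> S'. hmon K * (emon A * tau (p' (K, A))))"
    using S(1,4) S'(1,4) by (intro sum.mono_neutral_left; auto simp: tau_0)+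
  have "u + v \<approx> (\<Sum>(K, A)\<in>S \<union> S'. hmon K * (emon A * tau (p (K, A) + p' (K, A))))"
    using congr_add[OF S(5) S'(5)] unfolding ext
    by (simp add: tau_add distrib_left sum.distrib case_prod_unfold)
  then show ?case using S S' I
    by (intro exI[of _ "S \<union> S'"] exI[of _ "\<lambda>s. p s + p' s"]) (auto simp: Zideal_def)
qed

end

end

section \<open>Algebraic independence of the Sugawara operators\<close>

definition degree_le :: "nat \<Rightarrow> Zpoly \<Rightarrow> bool" where
  "degree_le d p \<longleftrightarrow> (\<forall>M\<in>keys p. size M \<le> d)"

lemma degree_le_add: "degree_le d p \<Longrightarrow> degree_le d q \<Longrightarrow> degree_le d (p + q)"
  using Poly_Mapping.keys_add[of p q] by (auto simp: degree_le_def)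
lemma degree_le_0: "degree_le d 0" by (simp add: degree_le_def)
lemma degree_le_scale: "degree_le d p \<Longrightarrow> degree_le d (scale_pm r p)"
  by (auto simp: degree_le_def in_keys_iff)
lemma degree_le_sum: "(\<And>i. i \<in> S \<Longrightarrow> degree_le d (f i)) \<Longrightarrow> degree_le d (sum f S)"
  by (induction S rule: infinite_finite_induct) (auto intro: degree_le_add degree_le_0)
lemma degree_le_sum_mset: "(\<And>i. i \<in># S \<Longrightarrow> degree_le d (f i)) \<Longrightarrow> degree_le d (\<Sum>i\<in>#S. f i)"
  by (induction S) (auto intro: degree_le_add degree_le_0)
lemma degree_le_mono: "degree_le d p \<Longrightarrow> d \<le> e \<Longrightarrow> degree_le e p"
  by (force simp: degree_le_def)
lemma degree_le_Zmon: "size M \<le> d \<Longrightarrow> degree_le d (Zmon M)"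
  by (simp add: degree_le_def Zmon_def)

lemma degree_le_lin_ext:
  "degree_le d p \<Longrightarrow> (\<And>M. size M \<le> d \<Longrightarrow> degree_le e (g M)) \<Longrightarrow> degree_le e (lin_ext g p)"
  unfolding lin_ext_def by (rule degree_le_sum) (auto simp: degree_le_def[of d] intro: degree_le_scale)

lemma degree_le_Zvar: "degree_le d p \<Longrightarrow> degree_le (Suc d) (Zvar m * p)"
proof -
  assume p: "degree_le d p"
  have "Zvar m * p = lin_ext (\<lambda>M. Zmon (add_mset m M)) p"
    by (rule linear_Zpoly_eqI[where p = p]) (auto intro!: linear_pm_intros simp: Zmon_def Zvar_def mult_single)
  moreover have "degree_le (Suc d) (lin_ext (\<lambda>M. Zmon (add_mset m M)) p)"
    by (rule degree_le_lin_ext[OF p]) (simp add: degree_le_Zmon)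
  ultimately show ?thesis by simp
qed

lemma size_remove: "m \<in># M \<Longrightarrow> Suc (size (M - {#m#})) = size M"
  by (metis insert_DiffM size_add_mset)

lemma degree_le_hop: "degree_le d p \<Longrightarrow> degree_le d (hop i p)"
  unfolding hop_def
proof (rule degree_le_lin_ext)
  fix M :: "nat multiset" assume "size M \<le> d"
  then show "degree_le d (hop_mon i M)"
    unfolding hop_mon_def
    by (intro degree_le_sum_mset degree_le_scale) (metis Zmon_add degree_le_Zmon size_add_mset size_remove)
qed

lemma degree_le_eop: "degree_le (Suc d) p \<Longrightarrow> degree_le d (eop i p)"
  unfolding eop_def
proof (rule degree_le_lin_ext)
  fix M :: "nat multiset" assume "size M \<le> Suc d"
  then show "degree_le d (eop_mon i M)"
    unfolding eop_mon_def
    by (intro degree_le_sum_mset degree_le_scale degree_le_hop degree_le_Zmon) (metis Suc_le_mono size_remove)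
qed

text \<open>Every term of \<open>t(n)\<close> besides \<open>\<lambda>f(n)\<close> keeps the degree or lowers it: \<open>h(-i)\<close> preserves it, \<open>e(-j)\<close> lowers it by one,
  and only an \<open>f\<close> raises it, by one.\<close>

lemma functional_sug_elt:
  assumes n: "n \<le> 0" and d: "degree_le d (whittaker_functional lam mu u)" and whit: "\<And>v. v \<in> whittaker_ideal lam mu \<Longrightarrow> v * u \<in> whittaker_ideal lam mu"
  shows "degree_le d (whittaker_functional lam mu (sug_elt n * u)
     - scale_pm lam (Zvar (nat (- n)) * whittaker_functional lam mu u))"
proof -
  interpret J: whittaker_quotient "whittaker_ideal lam mu" lam mu by (rule whittaker_quotient_universal)
  let ?F = "whittaker_functional lam mu"
  define r where "r = (\<Sum>j\<in>{n..<0}. ue j * (uf (n - j) * u)) + uea_scalar mu * (ue (n - 1) * u)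
      + uea_scalar (of_int (n + 1) / 2) * (uh n * u) + uea_scalar (1/4) * (\<Sum>j\<in>{n..0}. uh j * (uh (n - j) * u))"
  have "sug_elt n * u - (uea_scalar lam * (uf n * u) + r) \<in> whittaker_ideal lam mu"
    using whit[OF J.sug_elt_nonpos[OF n, unfolded mod_eq_def]]
    by (simp add: r_def distrib_right left_diff_distrib sum_distrib_right mult.assoc add.assoc)
  from whittaker_functional_ideal[OF this]
  have "?F (sug_elt n * u) = scale_pm lam (Zvar (nat (- n)) * ?F u) + ?F r"
    using n by (simp add: whittaker_functional_diff whittaker_functional_add whittaker_functional_scalar whittaker_functional_creation)
  moreover have "degree_le d (?F r)"
  proof -
    have "degree_le d (\<Sum>j\<in>{n..<0}. ?F (ue j * (uf (n - j) * u)))"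
      by (intro degree_le_sum) (auto simp: whittaker_functional_creation intro!: degree_le_eop degree_le_Zvar d)
    moreover have "degree_le d (?F (ue (n - 1) * u))"
      using n degree_le_mono[OF d, of "Suc d"] by (simp add: whittaker_functional_creation degree_le_eop)
    moreover have "degree_le d (?F (uh n * u))"
      using n d by (simp add: whittaker_functional_creation degree_le_hop)
    moreover have "degree_le d (\<Sum>j\<in>{n..0}. ?F (uh j * (uh (n - j) * u)))"
      by (intro degree_le_sum) (auto simp: whittaker_functional_creation intro!: degree_le_hop d)
    ultimately show ?thesis
      by (simp add: r_def whittaker_functional_add whittaker_functional_scalar whittaker_functional_sum degree_le_add degree_le_scale)
  qed
  ultimately show ?thesis by simp
qed

lemma functional_tmon:
  "\<exists>q. whittaker_functional lam mu (tmon M) = scale_pm (lam ^ size M) (Zmon M) + q \<and> (\<forall>N\<in>keys q. size N < size M)"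
proof (induction M)
  case empty
  show ?case by (simp add: tmon_def whittaker_functional_1 Zmon_empty)
next
  case (add m M)
  interpret J: whittaker_quotient "whittaker_ideal lam mu" lam mu by (rule whittaker_quotient_universal)
  let ?F = "whittaker_functional lam mu"
  from add obtain q where q: "?F (tmon M) = scale_pm (lam ^ size M) (Zmon M) + q" "\<forall>N\<in>keys q. size N < size M" by blast
  have d: "degree_le (size M) (?F (tmon M))"
    unfolding q(1) using q(2) by (intro degree_le_add degree_le_scale degree_le_Zmon) (auto simp: degree_le_def)
  define r where "r = ?F (sug_elt (- int m) * tmon M) - scale_pm lam (Zvar m * ?F (tmon M))"
  have r: "degree_le (size M) r"
    using functional_sug_elt[OF _ d, of "- int m"] J.whit_tmon[of M] by (simp add: J.whit_def r_def)
  have "?F (tmon (add_mset m M)) = ?F (sug_elt (- int m) * tmon M)"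
    using whittaker_functional_ideal[OF J.tmon_add[of m M, unfolded mod_eq_def]] by (simp add: whittaker_functional_diff)
  also have "\<dots> = scale_pm (lam ^ size (add_mset m M)) (Zmon (add_mset m M)) + (scale_pm lam (Zvar m * q) + r)"
    by (simp add: r_def q(1) distrib_left scale_pm_add scale_pm_commute Zmon_add)
  finally have "?F (tmon (add_mset m M)) = scale_pm (lam ^ size (add_mset m M)) (Zmon (add_mset m M)) + (scale_pm lam (Zvar m * q) + r)" .
  moreover have "degree_le (size M) (scale_pm lam (Zvar m * q) + r)"
  proof (cases "size M")
    case 0
    then have "q = 0" using q(2) by (auto simp flip: Poly_Mapping.keys_eq_empty)
    then show ?thesis using r by simp
  next
    case (Suc k)
    then have "degree_le k q" using q(2) by (auto simp: degree_le_def)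
    then show ?thesis using r degree_le_Zvar[of k q m] Suc by (auto intro!: degree_le_add degree_le_scale)
  qed
  ultimately show ?case by (auto simp: degree_le_def less_Suc_eq_le)
qed

text \<open>A monomial of maximal degree in \<open>p\<close> cannot be cancelled.\<close>

theorem tau_injective:
  assumes lam: "lam \<noteq> 0" and p: "tau p \<in> whittaker_ideal lam mu"
  shows "p = 0"
proof (rule ccontr)
  assume "p \<noteq> 0"
  then have "keys p \<noteq> {}" by simp
  then obtain M where M: "M \<in> keys p" "\<And>N. N \<in> keys p \<Longrightarrow> size N \<le> size M"
    using finite_argmax[OF finite_keys, of p size] by blast
  let ?F = "whittaker_functional lam mu"
  have F: "?F (tau p) = lin_ext (\<lambda>N. ?F (tmon N)) p"
  proof -
    show ?thesis by (simp add: tau_def lin_ext_def whittaker_functional_scalar whittaker_functional_sum)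
  qed
  have "lookup (?F (tmon N)) M = (if N = M then lam ^ size M else 0)" if "N \<in> keys p" for N
  proof -
    obtain q where q: "?F (tmon N) = scale_pm (lam ^ size N) (Zmon N) + q" "\<forall>K\<in>keys q. size K < size N"
      using functional_tmon by blast
    have "M \<notin> keys q" using q(2) M(2)[OF that] by (auto simp: not_less)
    then show ?thesis by (auto simp: q(1) lookup_add Zmon_def lookup_single when_def in_keys_iff)
  qed
  note coeff = this
  have "lookup (?F (tau p)) M = (\<Sum>N\<in>keys p. lookup p N * (if N = M then lam ^ size M else 0))"
    unfolding F lin_ext_def lookup_sum by (intro sum.cong) (simp_all add: coeff)
  also have "\<dots> = lookup p M * lam ^ size M"
    using M(1) by (simp add: if_distrib cong: if_cong)
  finally have "lookup (?F (tau p)) M = lookup p M * lam ^ size M" .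
  moreover have "?F (tau p) = 0" by (rule whittaker_functional_ideal[OF p])
  ultimately show False using lam M(1) by (simp add: in_keys_iff)
qed

section \<open>The left ideals of the Whittaker modules\<close>

definition Zeval :: "(int \<Rightarrow> complex) \<Rightarrow> Zpoly \<Rightarrow> complex" where
  "Zeval d p = (\<Sum>M\<in>keys p. lookup p M * (\<Prod>m\<in>#M. d (- int m)))"

lemma Zeval_superset:
  "finite A \<Longrightarrow> keys p \<subseteq> A \<Longrightarrow> Zeval d p = (\<Sum>M\<in>A. lookup p M * (\<Prod>m\<in>#M. d (- int m)))"
  unfolding Zeval_def by (intro sum.mono_neutral_left) (auto simp: in_keys_iff)

lemma Zeval_add: "Zeval d (p + q) = Zeval d p + Zeval d q"
proof -
  define A where "A = keys p \<union> keys q"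
  have A: "finite A" "keys p \<subseteq> A" "keys q \<subseteq> A" "keys (p + q) \<subseteq> A"
    using Poly_Mapping.keys_add[of p q] by (auto simp: A_def)
  show ?thesis
    using A by (simp add: Zeval_superset[OF A(1)] lookup_add distrib_right sum.distrib)
qed

lemma Zeval_scale: "Zeval d (scale_pm r p) = r * Zeval d p"
proof -
  have "keys (scale_pm r p) \<subseteq> keys p" by (auto simp: in_keys_iff)
  from Zeval_superset[OF finite_keys this] show ?thesis by (simp add: Zeval_def sum_distrib_left mult.assoc)
qed

lemma Zeval_single: "Zeval d (single M r) = r * (\<Prod>m\<in>#M. d (- int m))"
  by (cases "r = 0") (simp_all add: Zeval_def)

lemma Zeval_0: "Zeval d 0 = 0" by (simp add: Zeval_def)
lemma Zeval_1: "Zeval d 1 = 1" using Zeval_single[of d "{#}" 1] by simp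

lemma Zeval_Zvar: "Zeval d (Zvar m * p) = d (- int m) * Zeval d p"
proof (induction p rule: poly_mapping_induct')
  case (single M r)
  have "Zvar m * single M r = single (add_mset m M) r"
    by (simp add: Zvar_def Zmon_def mult_single)
  then show ?case by (simp add: Zeval_single)
qed (simp add: distrib_left Zeval_add)

text \<open>The left ideal of the module with \<open>T(n) = d n\<close>.\<close>

definition central_ideal :: "complex \<Rightarrow> complex \<Rightarrow> (int \<Rightarrow> complex) \<Rightarrow> affine_uea set" where
  "central_ideal lam mu d = left_ideal hull (whittaker_ideal lam mu \<union> {sug_elt n - uea_scalar (d n) | n. n \<le> 0})"

lemma left_ideal_central: "left_ideal (central_ideal lam mu d)"
  unfolding central_ideal_def by (rule left_ideal_hull)

lemma central_ideal_whittaker: "whittaker_ideal lam mu \<subseteq> central_ideal lam mu d"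
  unfolding central_ideal_def by (meson Un_subset_iff hull_subset)

lemma whittaker_quotient_central: "whittaker_quotient (central_ideal lam mu d) lam mu"
  by unfold_locales (simp_all add: left_ideal_central central_ideal_whittaker)

lemma central_ideal_sug: "n \<le> 0 \<Longrightarrow> sug_elt n - uea_scalar (d n) \<in> central_ideal lam mu d"
  unfolding central_ideal_def by (rule hull_inc) blast

lemma central_ideal_minimal:
  "left_ideal L \<Longrightarrow> whittaker_ideal lam mu \<subseteq> L \<Longrightarrow> (\<And>n. n \<le> 0 \<Longrightarrow> sug_elt n - uea_scalar (d n) \<in> L)
   \<Longrightarrow> central_ideal lam mu d \<subseteq> L"
  unfolding central_ideal_def by (rule hull_minimal) auto

text \<open>The ideal lies in the span of the monomials with coefficients vanishing at \<open>d\<close>. If it contains 1, then subtracting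
  1 gives a relation modulo \<open>J\<close>, whose coefficients are zero by \<open>lowering\<close> and by the independence of
  the \<open>t(n)\<close>; so the constant polynomial 1 vanishes at \<open>d\<close>.\<close>

lemma central_ideal_proper:
  assumes lam: "lam \<noteq> 0"
  shows "1 \<notin> central_ideal lam mu d"
proof
  let ?J = "whittaker_ideal lam mu"
  assume one: "1 \<in> central_ideal lam mu d"
  interpret J: whittaker_quotient "?J" lam mu by (rule whittaker_quotient_universal)
  define I where "I = {p. Zeval d p = 0}"
  have I: "Zideal I" by (simp add: Zideal_def I_def Zeval_add Zeval_scale Zeval_Zvar Zeval_0)
  have "central_ideal lam mu d \<subseteq> J.spanned I"
  proof (rule central_ideal_minimal)
    show "left_ideal (J.spanned I)" by (rule J.left_ideal_spanned[OF I lam])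
    show "?J \<subseteq> J.spanned I" by (auto intro: J.spanned_L)
    fix n :: int assume n: "n \<le> 0"
    have "Zeval d (Zvar (nat (- n)) - scale_pm (d n) 1) = 0"
      using Zeval_Zvar[of d "nat (- n)" 1] Zeval_add[of d "Zvar (nat (- n)) - scale_pm (d n) 1" "scale_pm (d n) 1"] n
      by (simp add: Zeval_1 Zeval_scale)
    then have "tau (Zvar (nat (- n)) - scale_pm (d n) 1) \<in> J.spanned I"
      using J.spanned_mon[of "Zvar (nat (- n)) - scale_pm (d n) 1" I "{#}" "{#}"] by (simp add: I_def)
    moreover have "mod_eq (?J) (sug_elt n - uea_scalar (d n)) (tau (Zvar (nat (- n)) - scale_pm (d n) 1))"
      using J.congr_diff[OF J.congr_sym[OF J.tau_Zvar[of "nat (- n)"]] J.congr_refl] n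
      by (simp add: tau_diff tau_scale tau_1)
    ultimately show "sug_elt n - uea_scalar (d n) \<in> J.spanned I" by (rule J.spanned_congr[rotated])
  qed
  with one have "1 \<in> J.spanned I" by blast
  from J.spanned_family[OF I lam this] obtain S p where S: "finite S" "\<And>K A. (K, A) \<in> S \<Longrightarrow> 0 \<notin># A"
    "\<And>s. p s \<in> I" "\<And>s. s \<notin> S \<Longrightarrow> p s = 0"
    "mod_eq (?J) 1 (\<Sum>(K, A)\<in>S. hmon K * (emon A * tau (p (K, A))))"
    by blast
  define S' where "S' = insert ({#}, {#}) S"
  \<comment> \<open>the coefficients of the relation: those of 1 minus the unit at the empty monomial\<close>
  define q where "q s = p s - (if s = ({#}, {#}) then 1 else 0)" for s
  have fin: "finite S'" by (simp add: S'_def S)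
  have "(\<Sum>(K, A)\<in>S. hmon K * (emon A * tau (p (K, A)))) = (\<Sum>(K, A)\<in>S'. hmon K * (emon A * tau (p (K, A))))"
    using S by (intro sum.mono_neutral_left) (auto simp: S'_def tau_0)
  also have "\<dots> = (\<Sum>(K, A)\<in>S'. hmon K * (emon A * tau (q (K, A))) + (if (K, A) = ({#}, {#}) then 1 else 0))"
    by (intro sum.cong) (auto simp: q_def tau_diff tau_1 tau_0)
  also have "\<dots> = (\<Sum>(K, A)\<in>S'. hmon K * (emon A * tau (q (K, A)))) + 1"
    using fin by (simp add: sum.distrib case_prod_unfold prod_eq_iff[symmetric] S'_def del: prod.inject)
  finally have rel: "(\<Sum>(K, A)\<in>S'. hmon K * (emon A * tau (q (K, A)))) \<in> ?J"
    using J.mem(4)[OF S(5)[unfolded mod_eq_def]] by simp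
  have "tau (q s) \<in> ?J" if s: "s \<in> S'" for s
  proof (rule ccontr)
    assume "tau (q s) \<notin> ?J"
    from J.lowering[where z = "\<lambda>s. tau (q s)", OF lam fin _ J.whit_tau s this]
    obtain u s' c where s': "s' \<in> S'" "tau (q s') \<notin> ?J" "c \<noteq> 0"
      "mod_eq (?J) (u * (\<Sum>(K, A)\<in>S'. hmon K * (emon A * tau (q (K, A))))) (uea_scalar c * tau (q s'))"
      using S(2) unfolding S'_def by (metis (no_types, lifting) Pair_inject empty_iff insert_iff set_mset_empty)
    have "uea_scalar c * tau (q s') \<in> ?J"
      using J.congr_sym[OF s'(4)] J.mem(2)[OF _ J.mem(3)[OF rel, of u]] by (fastforce simp: mod_eq_def)
    from J.mem(3)[OF this, of "uea_scalar (1/c)"] have "tau (q s') \<in> ?J"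
      using s'(3) uea_scalar_simps(4)[of "1/c" c] by (simp flip: mult.assoc)
    with s'(2) show False by simp
  qed
  then have "tau (q ({#}, {#})) \<in> ?J" by (simp add: S'_def)
  from tau_injective[OF lam this] have "q ({#}, {#}) = 0" .
  then have "p ({#}, {#}) = 1" by (simp add: q_def)
  with S(3)[of "({#}, {#})"] show False by (simp add: I_def Zeval_1)
qed

lemma tau_central: "tau p - uea_scalar (Zeval d p) \<in> central_ideal lam mu d"
proof (induction p rule: poly_mapping_induct')
  case (single M r)
  interpret L: whittaker_quotient "central_ideal lam mu d" lam mu by (rule whittaker_quotient_central)
  have "mod_eq (central_ideal lam mu d) (tmon M) (uea_scalar (\<Prod>m\<in>#M. d (- int m)))"
  proof (induction M)
    case empty show ?case by (simp add: tmon_def)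
  next
    case (add m M)
    have "mod_eq (central_ideal lam mu d) (sug_elt (- int m) * tmon M) (tmon M * sug_elt (- int m))"
      by (rule L.sug_elt_central[OF L.whit_tmon])
    also have "mod_eq (central_ideal lam mu d) (tmon M * sug_elt (- int m)) (tmon M * uea_scalar (d (- int m)))"
      by (rule L.congr_mult) (simp add: mod_eq_def central_ideal_sug)
    also have "tmon M * uea_scalar (d (- int m)) = uea_scalar (d (- int m)) * tmon M" by (rule uea_scalar_central)
    also have "mod_eq (central_ideal lam mu d) (uea_scalar (d (- int m)) * tmon M) (uea_scalar (\<Prod>m\<in>#add_mset m M. d (- int m)))"
      using L.congr_mult[OF add] by (simp add: uea_scalar_simps)
    finally show ?case using L.congr_trans[OF L.tmon_add] by blast
  qed
  from L.congr_mult[OF this, of "uea_scalar r"] show ?case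
    by (simp add: tau_single Zeval_single uea_scalar_simps mod_eq_def)
next
  case (add p q)
  from left_idealD(2)[OF left_ideal_central add] show ?case
    by (simp add: tau_add Zeval_add uea_scalar_simps algebra_simps)
qed

text \<open>Modulo this ideal the coefficients are scalars, so lowering an element outside it yields 1.\<close>

lemma central_ideal_maximal:
  assumes lam: "lam \<noteq> 0" and L': "left_ideal L'" "central_ideal lam mu d \<subseteq> L'"
  shows "L' = central_ideal lam mu d \<or> L' = UNIV"
proof (rule disjCI)
  let ?C = "central_ideal lam mu d"
  assume "L' \<noteq> UNIV"
  then have one: "1 \<notin> L'" using left_idealD(3)[OF L'(1), of 1] by auto
  interpret L: whittaker_quotient "?C" lam mu by (rule whittaker_quotient_central)
  have I: "Zideal UNIV" by (simp add: Zideal_def)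
  show "L' = ?C"
  proof (rule antisym[OF subsetI L'(2)], rule ccontr)
    fix v assume v: "v \<in> L'" "v \<notin> ?C"
    have "1 \<in> L.spanned UNIV" using L.spanned_mon[of 1 UNIV "{#}" "{#}"] by (simp add: tau_1)
    from left_idealD(3)[OF L.left_ideal_spanned[OF I lam] this, of v] have "v \<in> L.spanned UNIV" by simp
    from L.spanned_family[OF I lam this] obtain S p where S: "finite S" "\<And>K A. (K, A) \<in> S \<Longrightarrow> 0 \<notin># A"
      "mod_eq (?C) v (\<Sum>(K, A)\<in>S. hmon K * (emon A * tau (p (K, A))))"
      by blast
    have "\<exists>s\<in>S. tau (p s) \<notin> ?C"
    proof (rule ccontr)
      assume "\<not> ?thesis"
      then have "(\<Sum>(K, A)\<in>S. hmon K * (emon A * tau (p (K, A)))) \<in> ?C"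
        by (intro L.mem_sum) (auto intro!: L.mem(3))
      from L.mem(2)[OF S(3)[unfolded mod_eq_def] this] v(2) show False by simp
    qed
    then obtain s where s: "s \<in> S" "tau (p s) \<notin> ?C" by blast
    obtain u s' c where s': "tau (p s') \<notin> ?C" "c \<noteq> 0"
      "mod_eq (?C) (u * (\<Sum>(K, A)\<in>S. hmon K * (emon A * tau (p (K, A))))) (uea_scalar c * tau (p s'))"
      by (rule L.lowering[where z = "\<lambda>s. tau (p s)", OF lam S(1,2) L.whit_tau s])
    define z where "z = Zeval d (p s')"
    have tz: "mod_eq (?C) (tau (p s')) (uea_scalar z)"
      using tau_central by (simp add: mod_eq_def z_def)
    have z: "z \<noteq> 0" using tz s'(1) by (auto simp: L.congr_0)
    have "mod_eq (?C) (u * v) (uea_scalar c * tau (p s'))"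
      using L.congr_trans[OF L.congr_mult[OF S(3)] s'(3)] .
    also have "mod_eq (?C) (uea_scalar c * tau (p s')) (uea_scalar (c * z))"
      using L.congr_mult[OF tz] by (simp add: uea_scalar_simps)
    finally have "u * v - uea_scalar (c * z) \<in> L'" using L'(2) by (auto simp: mod_eq_def)
    from left_idealD(5)[OF L'(1) left_idealD(3)[OF L'(1) v(1), of u] this] have "uea_scalar (c * z) \<in> L'" by simp
    from left_idealD(3)[OF L'(1) this, of "uea_scalar (1 / (c * z))"] have "1 \<in> L'"
      using z s'(2) uea_scalar_simps(4)[of "1 / (c * z)" "c * z"] by simp
    with one show False by simp
  qed
qed

section \<open>Dixmier's form of the lemma of Schur\<close>

instance sl2_basis :: countable by countable_datatype
instance affine_basis :: countable by countable_datatype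
instance free_mon :: (countable) countable by countable_datatype

definition peval :: "affine_uea \<Rightarrow> complex poly \<Rightarrow> affine_uea" where
  "peval t p = fold_coeffs (\<lambda>c u. uea_scalar c + t * u) p 0"

lemma peval_0 [simp]: "peval t 0 = 0" by (simp add: peval_def)
lemma peval_pCons [simp]: "peval t (pCons c p) = uea_scalar c + t * peval t p"
  by (cases "c = 0 \<and> p = 0") (auto simp: peval_def)

lemma peval_add: "peval t (p + q) = peval t p + peval t q"
  by (induction p q rule: poly_induct2) (simp_all add: uea_scalar_simps algebra_simps)
lemma peval_smult: "peval t (smult r p) = uea_scalar r * peval t p"
  by (induction p)
    (simp_all add: uea_scalar_simps(4) distrib_left uea_scalar_left_central[of t])
lemma peval_diff: "peval t (p - q) = peval t p - peval t q"
  using peval_add[of t "p - q" q] by simp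
lemma peval_commute: "peval t p * t = t * peval t p"
  by (induction p) (simp_all add: uea_scalar_central[of t] algebra_simps)

lemma peval_linear_factor: "peval t ([:- r, 1:] * p) = peval t p * (t - uea_scalar r)"
  by (simp add: peval_add peval_diff peval_smult right_diff_distrib peval_commute uea_scalar_central)

text \<open>If no \<open>t - a\<close> lies in \<open>L\<close>, right multiplication by each of them is bijective on \<open>U/L\<close>. The inverse
  images \<open>g a\<close> of 1 are linearly independent, as in a partial fraction decomposition: multiplying a relation by
  \<open>t - b\<close> removes \<open>g b\<close>, and a polynomial in \<open>t\<close> splits into linear factors. But there are
  uncountably many of them, and \<open>U\<close> has countable dimension.\<close>

lemma schur_scalar:
  assumes L: "left_ideal L" "1 \<notin> L" and max: "\<And>L'. left_ideal L' \<Longrightarrow> L \<subseteq> L' \<Longrightarrow> L' = L \<or> L' = UNIV"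
    and t: "\<And>u. u \<in> L \<Longrightarrow> u * t \<in> L"
  shows "\<exists>a. t - uea_scalar a \<in> L"
proof (rule ccontr)
  assume neg: "\<not> ?thesis"
  interpret L: uea_left_ideal L by unfold_locales (rule L)
  have inj: "u \<in> L" if "u * (t - uea_scalar a) \<in> L" for u a
  proof -
    let ?L = "{u. u * (t - uea_scalar a) \<in> L}"
    have "left_ideal ?L" by (auto simp: left_ideal_def distrib_right mult.assoc intro: L.mem)
    moreover have "L \<subseteq> ?L"
      by (auto simp: right_diff_distrib uea_scalar_central intro: L.mem(5) t L.mem(3))
    moreover have "1 \<notin> ?L" using neg by simp
    ultimately have "?L = L" using max by blast
    with that show ?thesis by blast
  qed
  have "\<exists>g. g * (t - uea_scalar a) - 1 \<in> L" for a
  proof -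
    let ?L = "{v. \<exists>g. v - g * (t - uea_scalar a) \<in> L}"
    have "left_ideal ?L"
      unfolding left_ideal_def
    proof (intro conjI ballI allI)
      show "0 \<in> ?L" by (auto intro!: exI[of _ 0] simp: L.mem)
      fix x y assume "x \<in> ?L" "y \<in> ?L"
      then obtain g h where "x - g * (t - uea_scalar a) \<in> L" "y - h * (t - uea_scalar a) \<in> L" by blast
      from L.mem(2)[OF this] show "x + y \<in> ?L" by (auto intro!: exI[of _ "g + h"] simp: algebra_simps)
    next
      fix b x assume "x \<in> ?L"
      then obtain g where "x - g * (t - uea_scalar a) \<in> L" by blast
      from L.mem(3)[OF this, of b] show "b * x \<in> ?L" by (auto intro!: exI[of _ "b * g"] simp: algebra_simps)
    qed
    moreover have "L \<subseteq> ?L" by (auto intro!: exI[of _ 0])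
    moreover have "t - uea_scalar a \<in> ?L" by (auto intro!: exI[of _ 1] simp: L.mem(1))
    ultimately have "?L = UNIV" using max[of ?L] neg by blast
    then obtain g where "1 - g * (t - uea_scalar a) \<in> L" by blast
    from L.mem(4)[OF this] show ?thesis by (intro exI[of _ g]) simp
  qed
  then obtain g where g: "\<And>a. g a * (t - uea_scalar a) - 1 \<in> L" by metis
  have poly0: "p = 0" if "peval t p \<in> L" for p
    using that
  proof (induction "degree p" arbitrary: p rule: less_induct)
    case less
    show ?case
    proof (cases "degree p = 0")
      case True
      then obtain c where p: "p = [:c:]" by (metis degree_eq_zeroE)
      with less.prems have "uea_scalar c \<in> L" by simp
      from L.mem(3)[OF this, of "uea_scalar (1/c)"] have "c \<noteq> 0 \<Longrightarrow> 1 \<in> L"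
        using uea_scalar_simps(4)[of "1/c" c] by simp
      with L(2) p show ?thesis by auto
    next
      case False
      then obtain r where "poly p r = 0" using fundamental_theorem_of_algebra[of p] by (auto simp: constant_degree)
      then obtain q where q: "p = [:- r, 1:] * q" by (metis dvdE poly_eq_0_iff_dvd)
      with False have "q \<noteq> 0" by auto
      then have "degree p = degree q + 1" unfolding q by (subst degree_mult_eq) auto
      moreover have "peval t q \<in> L" using inj less.prems unfolding q peval_linear_factor .
      ultimately show ?thesis using less.hyps[of q] \<open>q \<noteq> 0\<close> by simp
    qed
  qed
  \<comment> \<open>the polynomial \<open>p\<close> absorbs the constants that appear when a term is removed\<close>
  have indep: "finite A \<Longrightarrow> peval t p + (\<Sum>a\<in>A. uea_scalar (k a) * g a) \<in> L \<Longrightarrow> p = 0 \<and> (\<forall>a\<in>A. k a = 0)" for A p k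
  proof (induction A arbitrary: p k rule: finite_induct)
    case empty
    then show ?case using poly0 by simp
  next
    case (insert b A)
    let ?s = "\<Sum>a\<in>insert b A. uea_scalar (k a) * g a"
    have ga: "mod_eq L (g a * (t - uea_scalar b)) (1 + uea_scalar (a - b) * g a)" for a
      using g[of a] by (simp add: mod_eq_def algebra_simps uea_scalar_simps uea_scalar_central[of "g a"])
    have "(peval t p + ?s) * (t - uea_scalar b) \<in> L"
      using t[OF insert.prems] L.mem(3)[OF insert.prems, of "uea_scalar b"]
      by (auto simp: right_diff_distrib uea_scalar_central intro: L.mem(5))
    moreover have "mod_eq L ((peval t p + ?s) * (t - uea_scalar b))
       (peval t ([:- b, 1:] * p) + (\<Sum>a\<in>insert b A. uea_scalar (k a) * (1 + uea_scalar (a - b) * g a)))"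
      unfolding peval_linear_factor distrib_right sum_distrib_right mult.assoc
      by (intro L.congr_add L.congr_sum L.congr_mult ga L.congr_refl)
    ultimately have "peval t ([:- b, 1:] * p) + (\<Sum>a\<in>insert b A. uea_scalar (k a) * (1 + uea_scalar (a - b) * g a)) \<in> L"
      using L.congr_trans[OF L.congr_sym, of _ _ 0] by (simp only: L.congr_0)
    also have "(\<Sum>a\<in>insert b A. uea_scalar (k a) * (1 + uea_scalar (a - b) * g a))
      = uea_scalar (\<Sum>a\<in>insert b A. k a) + (\<Sum>a\<in>A. uea_scalar (k a * (a - b)) * g a)"
    proof -
      have sum: "uea_scalar (sum k B) = (\<Sum>a\<in>B. uea_scalar (k a))" for B
        by (induction B rule: infinite_finite_induct) (simp_all add: uea_scalar_simps)
      have "(\<Sum>a\<in>insert b A. uea_scalar (k a) * (1 + uea_scalar (a - b) * g a))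
        = (\<Sum>a\<in>insert b A. uea_scalar (k a)) + (\<Sum>a\<in>insert b A. uea_scalar (k a * (a - b)) * g a)"
        by (simp only: distrib_left mult_1_right sum.distrib uea_scalar_simps(4) mult.assoc)
      also have "(\<Sum>a\<in>insert b A. uea_scalar (k a * (a - b)) * g a) = (\<Sum>a\<in>A. uea_scalar (k a * (a - b)) * g a)"
        using insert.hyps by simp
      finally show ?thesis by (simp only: sum)
    qed
    finally have "peval t ([:- b, 1:] * p + [:\<Sum>a\<in>insert b A. k a:]) + (\<Sum>a\<in>A. uea_scalar (k a * (a - b)) * g a) \<in> L"
      by (simp only: peval_add add.assoc) simp
    from insert.IH[OF this] have 1: "[:- b, 1:] * p + [:\<Sum>a\<in>insert b A. k a:] = 0" "\<forall>a\<in>A. k a = 0"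
      using insert.hyps by auto
    then have sum: "(\<Sum>a\<in>insert b A. k a) = k b" using insert.hyps by simp
    have "poly ([:- b, 1:] * p + [:\<Sum>a\<in>insert b A. k a:]) b = 0" using 1(1) by simp
    then have "k b = 0" by (simp add: sum del: mult_pCons_left)
    with 1 sum show ?case by (auto simp del: mult_pCons_left)
  qed
  interpret uea: vector_space "\<lambda>r u. uea_scalar r * u"
    by unfold_locales (simp_all add: algebra_simps uea_scalar_simps)
  define b :: "nat \<Rightarrow> affine_uea" where "b n = abs_affine_uea (single (from_nat n) 1)" for n
  have "\<exists>m. u \<in> uea.span (b ` {..<m})" for u
  proof -
    have "\<exists>m. abs_affine_uea p \<in> uea.span (b ` {..<m})" for p
    proof (induction p rule: poly_mapping_induct')
      case (single w r)
      have "abs_affine_uea (single w r) = uea_scalar r * b (to_nat w)"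
        by (simp add: b_def uea_scalar.abs_eq times_affine_uea.abs_eq mult_single)
      moreover have "b (to_nat w) \<in> uea.span (b ` {..<Suc (to_nat w)})" by (rule uea.span_base) simp
      ultimately show ?case using uea.span_scale by metis
    next
      case (add p q)
      then obtain m m' where "abs_affine_uea p \<in> uea.span (b ` {..<m})" "abs_affine_uea q \<in> uea.span (b ` {..<m'})" by blast
      then have "abs_affine_uea p \<in> uea.span (b ` {..<max m m'})" "abs_affine_uea q \<in> uea.span (b ` {..<max m m'})"
        using uea.span_mono[of "b ` {..<m}" "b ` {..<max m m'}"] uea.span_mono[of "b ` {..<m'}" "b ` {..<max m m'}"]
        by (auto simp: image_mono)
      from uea.span_add[OF this] show ?case by (auto simp: plus_affine_uea.abs_eq)
    qed
    then show ?thesis by (rule affine_uea.abs_induct[where P = "\<lambda>u. \<exists>m. u \<in> uea.span (b ` {..<m})"])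
  qed
  \<comment> \<open>one of countably many finite dimensional spaces contains \<open>g a\<close> for infinitely many \<open>a\<close>\<close>
  then have "UNIV = (\<Union>m. {a. g (complex_of_real a) \<in> uea.span (b ` {..<m})})" by blast
  note cover = this
  have "\<exists>m. infinite {a. g (complex_of_real a) \<in> uea.span (b ` {..<m})}"
  proof (rule ccontr)
    assume "\<not> ?thesis"
    then have "countable (\<Union>m. {a. g (complex_of_real a) \<in> uea.span (b ` {..<m})})"
      by (intro countable_UN) (auto intro: countable_finite)
    with uncountable_UNIV_real show False by (simp only: flip: cover)
  qed
  then obtain m where "infinite {a. g (complex_of_real a) \<in> uea.span (b ` {..<m})}" by blast
  from infinite_arbitrarily_large[OF this, of "Suc m"] obtain A where
    A: "finite A" "card A = Suc m" "A \<subseteq> {a. g (complex_of_real a) \<in> uea.span (b ` {..<m})}" by blast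
  define B where "B = complex_of_real ` A"
  have B: "finite B" "card B = Suc m" "\<And>a. a \<in> B \<Longrightarrow> g a \<in> uea.span (b ` {..<m})"
    using A by (auto simp: B_def card_image inj_on_def)
  have rel: "\<forall>a\<in>B. k a = 0" if "(\<Sum>a\<in>B. uea_scalar (k a) * g a) = 0" for k
    using indep[OF B(1), of 0 k] that by (simp add: L.mem)
  have injg: "inj_on g B"
  proof (rule inj_onI, rule ccontr)
    fix x y assume xy: "x \<in> B" "y \<in> B" "g x = g y" "x \<noteq> y"
    define k where "k a = (if a = x then 1 else 0) - (if a = y then 1 else (0::complex))" for a
    have "(\<Sum>a\<in>B. uea_scalar (k a) * g a) = (\<Sum>a\<in>B. (if a = x then g a else 0) - (if a = y then g a else 0))"
      by (intro sum.cong) (auto simp: k_def)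
    also have "\<dots> = 0" using xy B(1) by (simp add: sum_subtractf)
    finally have "k x = 0" using rel xy(1) by blast
    with xy(4) show False by (simp add: k_def)
  qed
  have "uea.independent (g ` B)"
    unfolding uea.dependent_finite[OF finite_imageI[OF B(1)]]
  proof safe
    fix k v assume "(\<Sum>v\<in>g ` B. uea_scalar (k v) * v) = 0"
    and v: "v \<in> B" "k (g v) \<noteq> 0"
    then have "(\<Sum>a\<in>B. uea_scalar (k (g a)) * g a) = 0" using injg by (simp add: sum.reindex)
    from rel[OF this] v show False by blast
  qed
  from uea.independent_span_bound[OF _ this, of "b ` {..<m}"] B(3) have "card (g ` B) \<le> card (b ` {..<m})" by auto
  also have "\<dots> \<le> m" by (metis card_image_le card_lessThan finite_lessThan)
  finally show False using injg B(2) by (simp add: card_image)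
qed

theorem maximal_ideal_central:
  assumes lam: "lam \<noteq> 0" and L: "left_ideal L" "whittaker_ideal lam mu \<subseteq> L" "1 \<notin> L"
    and max: "\<And>L'. left_ideal L' \<Longrightarrow> L \<subseteq> L' \<Longrightarrow> L' = L \<or> L' = UNIV"
  shows "\<exists>d. L = central_ideal lam mu d"
proof -
  interpret whittaker_quotient L lam mu by unfold_locales (rule L)+
  have "\<exists>a. sug_elt n - uea_scalar a \<in> L" for n
    by (rule schur_scalar[OF L(1,3) max]) (auto intro: sug_elt_right)
  then obtain d where d: "\<And>n. sug_elt n - uea_scalar (d n) \<in> L" by metis
  then have "central_ideal lam mu d \<subseteq> L" by (intro central_ideal_minimal L)
  from central_ideal_maximal[OF lam L(1) this] L(3) show ?thesis by auto
qed

section \<open>Invariants of isomorphism classes\<close>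

text \<open>Since \<open>ad e(0)\<close> maps \<open>f\<close> to \<open>h\<close>, \<open>h\<close> to \<open>e\<close> and \<open>e\<close> to 0, the vectors killed by a power of \<open>e(0) - \<lambda>\<close> form
  a submodule, and it contains \<open>w\<close>.\<close>

lemma (in whittaker_quotient) e0_locally_nilpotent: "\<exists>N. (ue 0 - uea_scalar lam) ^ N * u \<in> L"
proof -
  let ?E = "ue 0 - uea_scalar lam"
  define nil where "nil u \<longleftrightarrow> (\<exists>N. ?E ^ N * u \<in> L)" for u
  have step: "nil u" if "nil (?E * u)" for u
    using that unfolding nil_def by (metis mult.assoc power_Suc2)
  have up: "?E ^ (N + k) * u \<in> L" if "?E ^ N * u \<in> L" for N k u
    using mem(3)[OF that, of "?E ^ k"] by (simp add: power_add add.commute[of N] mult.assoc)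
  have add: "nil (u + v)" if uv: "nil u" "nil v" for u v
  proof -
    from uv obtain M N where "?E ^ M * u \<in> L" "?E ^ N * v \<in> L" by (auto simp: nil_def)
    from up[OF this(1), of N] up[OF this(2), of M] have "?E ^ (M + N) * (u + v) \<in> L"
      by (simp add: distrib_left add.commute[of M] mem)
    then show ?thesis by (auto simp: nil_def)
  qed
  have E: "?E * (ue m * u) = ue m * (?E * u) + 0 * u" "?E * (uh m * u) = uh m * (?E * u) + (- 2 * ue m) * u"
    "?E * (uf m * u) = uf m * (?E * u) + uh m * u" "?E * (uc * u) = uc * (?E * u) + 0 * u" for m u
    using uh_ue_left[of m 0 u] ue_uf_left[of 0 m u]
    by (auto simp: left_diff_distrib right_diff_distrib ue_ue_left[of 0] uea_scalar_left_central mult.assoc)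
       (metis mult.assoc uc_central)
  have comm: "nil (x * u)" if "\<And>u. ?E * (x * u) = x * (?E * u) + y * u" "\<And>u. nil u \<Longrightarrow> nil (y * u)" "nil u" for x y u
  proof -
    from \<open>nil u\<close> obtain N where "?E ^ N * u \<in> L" by (auto simp: nil_def)
    then show ?thesis
    proof (induction N arbitrary: u)
      case 0
      then show ?case by (auto simp: nil_def intro!: exI[of _ 0] mem)
    next
      case (Suc N)
      have "nil (x * (?E * u))" using Suc by (simp add: power_Suc2 mult.assoc del: power_Suc)
      moreover have "nil (y * u)" using Suc.prems by (intro that(2)) (unfold nil_def, blast)
      ultimately have "nil (?E * (x * u))" using add that(1) by simp
      then show ?case by (rule step)
    qed
  qed
  have zero: "nil (0 * u)" for u by (auto simp: nil_def mem)
  note e = comm[OF E(1) zero] and c = comm[OF E(4) zero]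
  have scal: "nil (uea_scalar r * u)" if "nil u" for r u
    by (rule comm[OF _ zero that]) (simp add: uea_scalar_left_central[of ?E])
  have h: "nil (uh m * u)" if "nil u" for m u
    by (rule comm[OF E(2) _ that]) (use scal[OF e, of _ "- 2"] in \<open>simp add: mult.assoc\<close>)
  note f = comm[OF E(3) h]
  have "nil u"
  proof (induction u rule: uea_induct)
    case (scalar r)
    have "?E * uea_scalar r \<in> L" using mem(3)[OF e_vac[of 0, unfolded mod_eq_def], of "uea_scalar r"]
      by (simp add: uea_scalar_central)
    then show ?case by (auto simp: nil_def intro!: exI[of _ 1])
  qed (auto intro: add e f h c)
  then show ?thesis by (simp add: nil_def)
qed

lemma uea_scalar_notin:
  "left_ideal L \<Longrightarrow> v \<notin> L \<Longrightarrow> uea_scalar r * v \<in> L \<Longrightarrow> r = 0"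
  using left_idealD(3)[of L "uea_scalar r * v" "uea_scalar (1/r)"] uea_scalar_simps(4)[of "1/r" r]
  by (cases "r = 0") (auto simp flip: mult.assoc)

text \<open>A homomorphism \<open>U/L \<rightarrow> U/L'\<close> is right multiplication by some \<open>v0\<close>. It is enough to compare the
  action of the \<open>t(n)\<close> and of \<open>e(0)\<close> on \<open>v0\<close>.\<close>

theorem iso_invariants:
  assumes L: "L = central_ideal lam mu d" and L': "L' = central_ideal lam' mu' d'"
    and v0: "v0 \<notin> L'" and hom: "\<And>u. u \<in> L \<Longrightarrow> u * v0 \<in> L'" and lam: "lam \<noteq> 0"
  shows "lam = lam' \<and> mu = mu' \<and> (\<forall>n\<le>0. d n = d' n)"
proof -
  interpret L: whittaker_quotient L lam mu
    by unfold_locales (simp_all add: left_ideal_central central_ideal_whittaker L)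
  interpret L': whittaker_quotient L' lam' mu'
    by unfold_locales (simp_all add: left_ideal_central central_ideal_whittaker L')
  have sug: "sug_elt n * v0 - v0 * sug_elt n \<in> L'" for n
  proof -
    from L.sug_acts_1[of n] obtain A where A: "\<And>N. N \<ge> A \<Longrightarrow> sug_partial n N - sug_elt n \<in> L"
      by (auto simp: L.sug_acts_def mod_eq_def)
    have "L'.sug_acts n v0 (sug_elt n * v0)"
      by (rule L'.sug_actsI[of A]) (use hom[OF A] in \<open>simp add: mod_eq_def left_diff_distrib\<close>)
    from L'.sug_acts_unique[OF this L'.sug_acts_elt] show ?thesis by (simp add: mod_eq_def)
  qed
  have eq: "a = b" if "sug_elt n - uea_scalar a \<in> L" "sug_elt n - uea_scalar b \<in> L'" for n a b
  proof -
    have "sug_elt n * v0 - uea_scalar a * v0 \<in> L'" using hom[OF that(1)] by (simp add: left_diff_distrib)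
    moreover have "v0 * sug_elt n - uea_scalar b * v0 \<in> L'"
      using L'.mem(3)[OF that(2), of v0] by (simp add: right_diff_distrib uea_scalar_central)
    ultimately have "(sug_elt n * v0 - uea_scalar a * v0) - (sug_elt n * v0 - v0 * sug_elt n) - (v0 * sug_elt n - uea_scalar b * v0) \<in> L'"
      using L'.mem(5)[OF L'.mem(5)[OF _ sug]] by blast
    from L'.mem(4)[OF this] have "uea_scalar (a - b) * v0 \<in> L'" by (simp add: uea_scalar_simps algebra_simps)
    from uea_scalar_notin[OF L'.left_ideal v0 this] show ?thesis by simp
  qed
  have lameq: "lam = lam'"
  proof -
    obtain N where N: "(ue 0 - uea_scalar lam') ^ N * v0 \<in> L'" using L'.e0_locally_nilpotent by blast
    have E: "mod_eq L' ((ue 0 - uea_scalar lam') * v0) (uea_scalar (lam - lam') * v0)"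
      using hom[OF L.e_vac[of 0, unfolded mod_eq_def]] by (simp add: mod_eq_def uea_scalar_simps algebra_simps)
    have "mod_eq L' ((ue 0 - uea_scalar lam') ^ N * v0) (uea_scalar ((lam - lam') ^ N) * v0)"
    proof (induction N)
      case (Suc N)
      have "mod_eq L' ((ue 0 - uea_scalar lam') ^ Suc N * v0) ((ue 0 - uea_scalar lam') * (uea_scalar ((lam - lam') ^ N) * v0))"
        using L'.congr_mult[OF Suc] by (simp add: mult.assoc)
      also have "\<dots> = uea_scalar ((lam - lam') ^ N) * ((ue 0 - uea_scalar lam') * v0)" by (rule uea_scalar_left_central)
      also have "mod_eq L' \<dots> (uea_scalar ((lam - lam') ^ Suc N) * v0)"
        using L'.congr_mult[OF E, of "uea_scalar ((lam - lam') ^ N)"]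
        by (simp add: uea_scalar_simps(4)[symmetric] mult.commute flip: mult.assoc)
      finally show ?case .
    qed simp
    with N have "uea_scalar ((lam - lam') ^ N) * v0 \<in> L'"
      using L'.mem(5)[OF N] by (fastforce simp: mod_eq_def)
    from uea_scalar_notin[OF L'.left_ideal v0 this] show ?thesis by simp
  qed
  have "lam * mu = lam' * mu'"
    using eq[of 1 "lam * mu" "lam' * mu'"] L.sug_elt_one L'.sug_elt_one by (simp add: mod_eq_def)
  then have "mu = mu'" using lam lameq by simp
  moreover have "d n = d' n" if "n \<le> 0" for n
    using eq[of n "d n" "d' n"] central_ideal_sug[OF that] by (auto simp: L L')
  ultimately show ?thesis using lameq by blast
qed

section \<open>From left ideals to modules\<close>

text \<open>\<open>f\<close> induces an isomorphism of \<open>U/L\<close> with \<open>Q\<close>. This replaces coset computations, also for quotients of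
  quotients, by membership in \<open>L\<close>.\<close>

definition presents :: "(affine_uea \<Rightarrow> 'v) \<Rightarrow> affine_uea set \<Rightarrow> 'v affine_module \<Rightarrow> bool" where
  "presents f L Q \<longleftrightarrow> left_ideal L \<and> carrier Q = range f \<and> \<zero>\<^bsub>Q\<^esub> = f 0 \<and>
     (\<forall>u v. f (u + v) = f u \<oplus>\<^bsub>Q\<^esub> f v) \<and> (\<forall>r u. f (uea_scalar r * u) = r \<odot>\<^bsub>Q\<^esub> f u) \<and>
     (\<forall>x u. f (uea_incl x * u) = act Q x (f u)) \<and> (\<forall>u v. f u = f v \<longleftrightarrow> u - v \<in> L)"

lemma presentsD:
  assumes "presents f L Q"
  shows "left_ideal L" "carrier Q = range f" "\<zero>\<^bsub>Q\<^esub> = f 0"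
    "f u \<oplus>\<^bsub>Q\<^esub> f v = f (u + v)" "r \<odot>\<^bsub>Q\<^esub> f u = f (uea_scalar r * u)" "act Q x (f u) = f (uea_incl x * u)"
    "f u = f v \<longleftrightarrow> u - v \<in> L"
  using assms by (simp_all add: presents_def)

lemma complex_ring_simps:
  "carrier complex_ring = UNIV" "add complex_ring = (+)" "monoid.mult complex_ring = (*)" "one complex_ring = 1" "ring.zero complex_ring = 0"
  by (simp_all add: ring_of_type_algebra_def)

lemma presents_module:
  assumes P: "presents f L Q"
  shows "Module.module complex_ring Q"
proof -
  note p = presentsD[OF P]
  have abelian: "abelian_group Q"
  proof (rule abelian_groupI)
    fix x assume "x \<in> carrier Q"
    then obtain u where "x = f u" by (auto simp: p)
    then show "\<exists>y\<in>carrier Q. y \<oplus>\<^bsub>Q\<^esub> x = \<zero>\<^bsub>Q\<^esub>" by (intro bexI[of _ "f (- u)"]) (auto simp: p(2-6))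
  qed (auto simp: p ac_simps rangeI)
  have car: "\<exists>u. x = f u" if "x \<in> carrier Q" for x
    using that by (auto simp: p(2))
  show ?thesis
  proof (rule moduleI)
    show "cring complex_ring" by (rule cring_from_type_algebra)
    show "abelian_group Q" by (rule abelian)
    fix a b :: complex and x y
    assume "x \<in> carrier Q" "y \<in> carrier Q"
    then obtain u v where xy: "x = f u" "y = f v" using car by blast
    show "a \<odot>\<^bsub>Q\<^esub> x \<in> carrier Q" unfolding xy p(2,5) by (rule rangeI)
    show "(a \<oplus>\<^bsub>complex_ring\<^esub> b) \<odot>\<^bsub>Q\<^esub> x = a \<odot>\<^bsub>Q\<^esub> x \<oplus>\<^bsub>Q\<^esub> b \<odot>\<^bsub>Q\<^esub> x"
      "a \<odot>\<^bsub>Q\<^esub> (x \<oplus>\<^bsub>Q\<^esub> y) = a \<odot>\<^bsub>Q\<^esub> x \<oplus>\<^bsub>Q\<^esub> a \<odot>\<^bsub>Q\<^esub> y"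
      "(a \<otimes>\<^bsub>complex_ring\<^esub> b) \<odot>\<^bsub>Q\<^esub> x = a \<odot>\<^bsub>Q\<^esub> (b \<odot>\<^bsub>Q\<^esub> x)"
      "\<one>\<^bsub>complex_ring\<^esub> \<odot>\<^bsub>Q\<^esub> x = x"
      unfolding xy p(4,5) complex_ring_simps
      by (simp_all add: distrib_left distrib_right uea_scalar_simps mult.assoc)
  qed
qed

lemma presents_minus:
  assumes P: "presents f L Q"
  shows "f u \<ominus>\<^bsub>Q\<^esub> f v = f (u - v)"
proof -
  note p = presentsD[OF P]
  interpret Q: Module.module complex_ring Q by (rule presents_module[OF P])
  have "\<ominus>\<^bsub>Q\<^esub> f v = f (- v)" by (rule Q.minus_equality) (simp_all add: p rangeI)
  then show ?thesis by (simp add: a_minus_def p)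
qed

lemma presents_affine_module:
  assumes P: "presents f L Q"
  shows "is_affine_module Q"
proof -
  note p = presentsD[OF P]
  have "f ((uea_incl x * uea_incl y - uea_incl y * uea_incl x) * u) = f (uea_incl x * (uea_incl y * u)) \<ominus>\<^bsub>Q\<^esub> f (uea_incl y * (uea_incl x * u))" for x y u
    by (simp add: presents_minus[OF P] left_diff_distrib mult.assoc)
  then show ?thesis
    unfolding is_affine_module_def
    by (auto simp: presents_module[OF P] p distrib_left distrib_right uea_incl_add uea_incl_scale
       uea_scalar_left_central mult.assoc uea_incl_commutator)
qed

lemma presents_submodule_ideal:
  assumes P: "presents f L Q" and N: "is_submodule Q N"
  shows "left_ideal {u. f u \<in> N}" "L \<subseteq> {u. f u \<in> N}" "N = f ` {u. f u \<in> N}"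
proof -
  note p = presentsD[OF P]
  interpret Q: Module.module complex_ring Q by (rule presents_module[OF P])
  from N have sub: "submodule N complex_ring Q" and act: "\<And>x v. v \<in> N \<Longrightarrow> act Q x v \<in> N" by (auto simp: is_submodule_def)
  note e = Q.submoduleE[OF sub]
  have add: "f (u + v) \<in> N" if "f u \<in> N" "f v \<in> N" for u v using e(5)[OF that] by (simp add: p)
  have scal: "f (uea_scalar r * u) \<in> N" if "f u \<in> N" for r u
    using e(4)[OF _ that, of r] by (simp add: p complex_ring_simps)
  have zero: "f 0 \<in> N"
  proof -
    obtain x where "x \<in> N" using e(2) by blast
    then obtain u where "f u \<in> N" using e(1) by (auto simp: p)
    from scal[OF this, of 0] show ?thesis by simp
  qed
  have "f (a * u) \<in> N" if "f u \<in> N" for a u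
  proof (induction a rule: uea_gen_induct)
    case (gen b v)
    have "f (uea_gen b * v * u) = act Q (bvec b) (f (v * u))"
      by (simp add: p uea_gen_def mult.assoc)
    then show ?case using act gen by simp
  qed (use that in \<open>simp_all add: scal add distrib_right\<close>)
  with zero add show "left_ideal {u. f u \<in> N}" by (auto simp: left_ideal_def)
  show "L \<subseteq> {u. f u \<in> N}"
  proof
    fix u assume "u \<in> L"
    then have "f u = f 0" by (simp add: p(7))
    with zero show "u \<in> {u. f u \<in> N}" by simp
  qed
  show "N = f ` {u. f u \<in> N}" using e(1) by (auto simp: p)
qed

lemma presents_ideal_submodule:
  assumes P: "presents f L Q" and L': "left_ideal L'"
  shows "is_submodule Q (f ` L')"
proof -
  note p = presentsD[OF P]
  interpret Q: Module.module complex_ring Q by (rule presents_module[OF P])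
  have "submodule (f ` L') complex_ring Q"
  proof (rule Q.submoduleI)
    show "\<zero>\<^bsub>Q\<^esub> \<in> f ` L'" using left_idealD(1)[OF L'] by (auto simp: p)
    fix a assume "a \<in> f ` L'"
    then obtain u where u: "a = f u" "u \<in> L'" by blast
    have "\<ominus>\<^bsub>Q\<^esub> f u = f (- u)" by (rule Q.minus_equality) (simp_all add: p rangeI)
    then show "\<ominus>\<^bsub>Q\<^esub> a \<in> f ` L'" using u left_idealD(4)[OF L'] by auto
  qed (use left_idealD(2,3)[OF L'] in \<open>auto simp: p intro!: imageI\<close>)
  then show ?thesis using left_idealD(3)[OF L'] by (auto simp: is_submodule_def p)
qed

lemma presents_preimage: "presents f L Q \<Longrightarrow> left_ideal L' \<Longrightarrow> L \<subseteq> L' \<Longrightarrow> {u. f u \<in> f ` L'} = L'"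
proof (safe intro!: imageI)
  fix u v assume P: "presents f L Q" and L': "left_ideal L'" "L \<subseteq> L'" and uv: "f u = f v" "v \<in> L'"
  then have "u - v \<in> L'" using presentsD(7)[OF P] by auto
  from left_idealD(2)[OF L'(1) this uv(2)] show "u \<in> L'" by simp
qed

lemma presents_simple_iff:
  assumes P: "presents f L Q"
  shows "simple_module Q \<longleftrightarrow> 1 \<notin> L \<and> (\<forall>L'. left_ideal L' \<longrightarrow> L \<subseteq> L' \<longrightarrow> L' = L \<or> L' = UNIV)"
proof -
  note p = presentsD[OF P]
  have zero: "f ` L = {\<zero>\<^bsub>Q\<^esub>}"
    using p(7)[of _ 0] left_idealD(1)[OF p(1)] by (auto simp: p(3))
  have "carrier Q = {\<zero>\<^bsub>Q\<^esub>} \<longleftrightarrow> 1 \<in> L"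
  proof
    assume "carrier Q = {\<zero>\<^bsub>Q\<^esub>}"
    then have "f 1 = f 0" using p(2,3) rangeI[of f 1] by simp
    then show "1 \<in> L" by (simp add: p(7))
  next
    assume "1 \<in> L"
    then have "u \<in> L" for u using left_idealD(3)[OF p(1), of 1 u] by simp
    then have "L = UNIV" by blast
    with zero show "carrier Q = {\<zero>\<^bsub>Q\<^esub>}" by (simp add: p)
  qed
  moreover have "(\<forall>N. is_submodule Q N \<longrightarrow> N = {\<zero>\<^bsub>Q\<^esub>} \<or> N = carrier Q) \<longleftrightarrow>
      (\<forall>L'. left_ideal L' \<longrightarrow> L \<subseteq> L' \<longrightarrow> L' = L \<or> L' = UNIV)"
  proof (intro iffI allI impI)
    fix L' assume N: "\<forall>N. is_submodule Q N \<longrightarrow> N = {\<zero>\<^bsub>Q\<^esub>} \<or> N = carrier Q" and L': "left_ideal L'" "L \<subseteq> L'"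
    from N presents_ideal_submodule[OF P L'(1)] have "f ` L' = f ` L \<or> f ` L' = f ` UNIV" by (simp add: zero p)
    then have "{u. f u \<in> f ` L'} = {u. f u \<in> f ` L} \<or> {u. f u \<in> f ` L'} = UNIV" by auto
    then show "L' = L \<or> L' = UNIV" using presents_preimage[OF P L'] presents_preimage[OF P p(1)] by simp
  next
    fix N assume max: "\<forall>L'. left_ideal L' \<longrightarrow> L \<subseteq> L' \<longrightarrow> L' = L \<or> L' = UNIV" and N: "is_submodule Q N"
    note i = presents_submodule_ideal[OF P N]
    from max i have "{u. f u \<in> N} = L \<or> {u. f u \<in> N} = UNIV" by blast
    then show "N = {\<zero>\<^bsub>Q\<^esub>} \<or> N = carrier Q" using i(3) zero p(2) by metis
  qed
  ultimately show ?thesis using presents_affine_module[OF P] by (simp add: simple_module_def)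
qed

lemma presents_quotient:
  assumes P: "presents f L Q" and N: "is_submodule Q N"
  shows "presents (\<lambda>u. N +>\<^bsub>Q\<^esub> f u) {u. f u \<in> N} (quotient_module Q N)"
proof -
  note p = presentsD[OF P]
  define K where "K = {u. f u \<in> N}"
  note i = presents_submodule_ideal[OF P N, folded K_def]
  note k = left_idealD[OF i(1)]
  have coset: "N +>\<^bsub>Q\<^esub> f u = f ` {w. w - u \<in> K}" for u
  proof
    show "N +>\<^bsub>Q\<^esub> f u \<subseteq> f ` {w. w - u \<in> K}"
    proof
      fix x assume "x \<in> N +>\<^bsub>Q\<^esub> f u"
      then obtain n where n: "n \<in> N" "x = n \<oplus>\<^bsub>Q\<^esub> f u" by (auto simp: a_r_coset_def')
      then obtain v where "v \<in> K" "n = f v" using i(3) by blast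
      with n show "x \<in> f ` {w. w - u \<in> K}" by (auto simp: p intro!: imageI)
    qed
    show "f ` {w. w - u \<in> K} \<subseteq> N +>\<^bsub>Q\<^esub> f u"
    proof safe
      fix w assume "w - u \<in> K"
      then have "f (w - u) \<in> N" "f w = f (w - u) \<oplus>\<^bsub>Q\<^esub> f u" by (simp_all add: K_def p)
      then show "f w \<in> N +>\<^bsub>Q\<^esub> f u" by (auto simp: a_r_coset_def')
    qed
  qed
  have eq: "f ` {w. w - u \<in> K} = f ` {w. w - v \<in> K} \<longleftrightarrow> u - v \<in> K" for u v
  proof
    assume "f ` {w. w - u \<in> K} = f ` {w. w - v \<in> K}"
    then have "f u \<in> f ` {w. w - v \<in> K}" using k(1) by auto
    then obtain w where "f u = f w" "w - v \<in> K" by auto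
    then have "(u - w) + (w - v) \<in> K" using i(2) p(7) by (intro k(2)) auto
    then show "u - v \<in> K" by simp
  next
    assume uv: "u - v \<in> K"
    have "w - u \<in> K \<longleftrightarrow> w - v \<in> K" for w
      using k(2)[OF _ uv, of "w - u"] k(5)[OF _ uv, of "w - v"] by auto
    then show "f ` {w. w - u \<in> K} = f ` {w. w - v \<in> K}" by simp
  qed
  have union: "(\<Union>v\<in>f ` {w. w - u \<in> K}. N +>\<^bsub>Q\<^esub> g v) = N +>\<^bsub>Q\<^esub> g (f u)"
    if g: "\<And>w. g (f w) = f (a * w)" for g a u
  proof -
    have "N +>\<^bsub>Q\<^esub> g (f w) = N +>\<^bsub>Q\<^esub> g (f u)" if "w - u \<in> K" for w
      unfolding g coset eq using k(3)[OF that, of a] by (simp add: right_diff_distrib)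
    moreover have "f u \<in> f ` {w. w - u \<in> K}" using k(1) by (intro imageI) simp
    ultimately show ?thesis by blast
  qed
  show ?thesis
    unfolding presents_def K_def[symmetric]
  proof (intro conjI allI)
    show "left_ideal K" by (rule i)
    show "carrier (quotient_module Q N) = range (\<lambda>u. N +>\<^bsub>Q\<^esub> f u)"
      by (auto simp: quotient_module_def A_RCOSETS_def' p)
    show "\<zero>\<^bsub>quotient_module Q N\<^esub> = N +>\<^bsub>Q\<^esub> f 0"
      unfolding coset using i(3) by (simp add: quotient_module_def)
    show "(N +>\<^bsub>Q\<^esub> f u = N +>\<^bsub>Q\<^esub> f v) = (u - v \<in> K)" for u v by (simp add: coset eq)
    show "N +>\<^bsub>Q\<^esub> f (uea_scalar r * u) = r \<odot>\<^bsub>quotient_module Q N\<^esub> (N +>\<^bsub>Q\<^esub> f u)" for r u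
      using union[of "\<lambda>v. r \<odot>\<^bsub>Q\<^esub> v" "uea_scalar r" u] by (simp add: quotient_module_def p(5) coset[of u])
    show "N +>\<^bsub>Q\<^esub> f (uea_incl x * u) = act (quotient_module Q N) x (N +>\<^bsub>Q\<^esub> f u)" for x u
      using union[of "\<lambda>v. act Q x v" "uea_incl x" u] by (simp add: quotient_module_def p(6) coset[of u])
    show "N +>\<^bsub>Q\<^esub> f (u + v) = (N +>\<^bsub>Q\<^esub> f u) \<oplus>\<^bsub>quotient_module Q N\<^esub> (N +>\<^bsub>Q\<^esub> f v)" for u v
    proof -
      have "f ` {w. w - (u + v) \<in> K} = (\<Union>x\<in>f ` {w. w - u \<in> K}. \<Union>y\<in>f ` {w. w - v \<in> K}. {x \<oplus>\<^bsub>Q\<^esub> y})"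
      proof safe
        fix w assume w: "w - (u + v) \<in> K"
        have "f w = f (w - v) \<oplus>\<^bsub>Q\<^esub> f v" by (simp add: p)
        moreover have "w - v - u \<in> K" "v - v \<in> K" using w k(1) by (simp_all add: algebra_simps)
        ultimately show "f w \<in> (\<Union>x\<in>f ` {w. w - u \<in> K}. \<Union>y\<in>f ` {w. w - v \<in> K}. {x \<oplus>\<^bsub>Q\<^esub> y})" by blast
      next
        fix w z assume "w - u \<in> K" "z - v \<in> K"
        from k(2)[OF this] show "f w \<oplus>\<^bsub>Q\<^esub> f z \<in> f ` {w. w - (u + v) \<in> K}"
          by (auto simp: p algebra_simps intro!: imageI)
      qed
      then show ?thesis by (simp add: quotient_module_def set_add_def' coset)
    qed
  qed
qed

lemma presents_uea: "presents (\<lambda>u. u) {0} uea_module"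
  by (auto simp: presents_def uea_module_def left_ideal_def)

lemma presents_iso:
  assumes P: "presents f L Q" and P': "presents g L' Q'" and iso: "module_iso Q Q'"
  obtains v0 where "\<And>u. u \<in> L \<longleftrightarrow> u * v0 \<in> L'"
proof -
  note p = presentsD[OF P] and q = presentsD[OF P']
  from iso obtain \<phi> where bij: "bij_betw \<phi> (range f) (range g)"
    and \<phi>: "\<And>u v. \<phi> (f (u + v)) = \<phi> (f u) \<oplus>\<^bsub>Q'\<^esub> \<phi> (f v)" "\<And>r u. \<phi> (f (uea_scalar r * u)) = r \<odot>\<^bsub>Q'\<^esub> \<phi> (f u)"
      "\<And>x u. \<phi> (f (uea_incl x * u)) = act Q' x (\<phi> (f u))"
    unfolding module_iso_def p(2) q(2) by (auto simp: p(4-6))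
  have "\<phi> (f 1) \<in> range g" using bij_betw_apply[OF bij] by (simp add: rangeI)
  then obtain v0 where v0: "\<phi> (f 1) = g v0" by blast
  have hom: "\<phi> (f u) = g (u * v0)" for u
  proof (induction u rule: uea_gen_induct)
    case (scalar r)
    show ?case using \<phi>(2)[of r 1] by (simp add: v0 q(5))
  next
    case (add u v)
    then show ?case by (simp add: \<phi>(1) q(4) distrib_right)
  next
    case (gen a u)
    then show ?case by (simp add: uea_gen_def \<phi>(3) q(6) mult.assoc)
  qed
  have "u \<in> L \<longleftrightarrow> u * v0 \<in> L'" for u
  proof -
    have "u \<in> L \<longleftrightarrow> f u = f 0" by (simp add: p(7))
    also have "\<dots> \<longleftrightarrow> \<phi> (f u) = \<phi> (f 0)" using bij by (auto simp: bij_betw_def inj_on_def)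
    also have "\<dots> \<longleftrightarrow> u * v0 \<in> L'" by (simp add: hom q(7))
    finally show ?thesis .
  qed
  then show ?thesis by (rule that)
qed

lemma module_iso_refl: "module_iso Q Q"
  unfolding module_iso_def by (intro exI[of _ id]) simp

section \<open>Whittaker modules\<close>

definition whittaker_class :: "complex \<Rightarrow> complex \<Rightarrow> affine_uea \<Rightarrow> affine_uea set" where
  "whittaker_class lam mu u = whittaker_ideal lam mu +>\<^bsub>uea_module\<^esub> u"

lemma presents_universal: "presents (whittaker_class lam mu) (whittaker_ideal lam mu) (universal_whittaker lam mu)"
proof -
  have "is_submodule uea_module ((\<lambda>u. u) ` whittaker_ideal lam mu)"
    by (rule presents_ideal_submodule[OF presents_uea left_ideal_whittaker])
  from presents_quotient[OF presents_uea this] show ?thesis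
    by (simp add: universal_whittaker_def whittaker_class_def[abs_def])
qed

lemma presents_finsum:
  assumes P: "presents f L Q"
  shows "finite A \<Longrightarrow> (\<Oplus>\<^bsub>Q\<^esub>k\<in>A. f (g k)) = f (sum g A)"
proof -
  note p = presentsD[OF P]
  interpret Q: Module.module complex_ring Q by (rule presents_module[OF P])
  assume "finite A"
  then show ?thesis
  proof (induction A rule: finite_induct)
    case (insert k A)
    have "(\<lambda>k. f (g k)) \<in> A \<rightarrow> carrier Q" "f (g k) \<in> carrier Q" by (simp_all add: p(2) rangeI)
    with insert show ?case by (simp add: p(4))
  qed (simp add: p(3))
qed

lemma presents_sugawara_term:
  assumes P: "presents f L Q"
  shows "sugawara_term Q n (f u) k = f (sug_term n k * u)"
  by (auto simp: sugawara_term_def normal_ordered_def presentsD(4-6)[OF P] sug_term_def nop_def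
      distrib_right mult.assoc simp flip: ue_def uf_def uh_def)

text \<open>The sum over the support in the module agrees with the finite sum \<open>sug_elt\<close>, because the summands outside
  the support lie in the Whittaker ideal.\<close>

lemma sugawara_whittaker_vector:
  "sugawara (universal_whittaker lam mu) n (whittaker_vector lam mu) = whittaker_class lam mu (sug_elt n)"
proof -
  let ?f = "whittaker_class lam mu" and ?V = "universal_whittaker lam mu"
  note P = presents_universal[of lam mu]
  note p = presentsD[OF P]
  interpret J: whittaker_quotient "whittaker_ideal lam mu" lam mu by (rule whittaker_quotient_universal)
  define N where "N = \<bar>n\<bar> + 2"
  define S where "S = {k. sugawara_term ?V n (?f 1) k \<noteq> \<zero>\<^bsub>?V\<^esub>}"
  have S: "k \<in> S \<longleftrightarrow> sug_term n k \<notin> whittaker_ideal lam mu" for k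
    by (simp add: S_def presents_sugawara_term[OF P] p(3,7))
  have sub: "S \<subseteq> {-N..N}"
  proof
    fix k assume "k \<in> S"
    then have "\<not> (k > \<bar>n\<bar> + 2 \<or> k < - (\<bar>n\<bar> + 2))" using J.sug_term_in_ideal S by blast
    then show "k \<in> {-N..N}" by (simp add: N_def not_less)
  qed
  have "(\<Oplus>\<^bsub>?V\<^esub>k\<in>S. sugawara_term ?V n (?f 1) k) = ?f (sum (sug_term n) S)"
    using presents_finsum[OF P finite_subset[OF sub]] by (simp add: presents_sugawara_term[OF P])
  also have "\<dots> = ?f (sum (sug_term n) {-N..N})"
  proof -
    have "sum (sug_term n) {-N..N} = sum (sug_term n) ({-N..N} - S) + sum (sug_term n) S"
      using sub by (intro sum.subset_diff) auto
    moreover have "sum (sug_term n) ({-N..N} - S) \<in> whittaker_ideal lam mu"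
      by (intro J.mem_sum) (auto simp: S)
    ultimately have "?f (sum (sug_term n) {-N..N}) = ?f (sum (sug_term n) S)" by (simp add: p(7))
    then show ?thesis by simp
  qed
  finally have "sugawara ?V n (?f 1) = (1/2) \<odot>\<^bsub>?V\<^esub> ?f (sum (sug_term n) {-N..N})"
    by (simp add: sugawara_def S_def)
  then show ?thesis
    by (simp add: whittaker_class_def[symmetric] whittaker_vector_def p(5) sug_elt_def sug_partial_def N_def)
qed

lemma generated_central:
  fixes lam mu :: complex and d :: "int \<Rightarrow> complex"
  defines "V \<equiv> universal_whittaker lam mu" and "w \<equiv> whittaker_vector lam mu"
  shows "generated_submodule V {sugawara V n w \<ominus>\<^bsub>V\<^esub> d n \<odot>\<^bsub>V\<^esub> w | n. n \<le> 0}
    = whittaker_class lam mu ` central_ideal lam mu d"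
proof -
  let ?f = "whittaker_class lam mu"
  note P = presents_universal[of lam mu, folded V_def]
  note p = presentsD[OF P]
  have w: "w = ?f 1" by (simp add: w_def whittaker_class_def whittaker_vector_def)
  have gen: "sugawara V n w \<ominus>\<^bsub>V\<^esub> d n \<odot>\<^bsub>V\<^esub> w = ?f (sug_elt n - uea_scalar (d n))" for n
    using sugawara_whittaker_vector[of lam mu n] by (simp add: w p(5) presents_minus[OF P] flip: V_def w_def)
  show ?thesis
  proof
    show "generated_submodule V {sugawara V n w \<ominus>\<^bsub>V\<^esub> d n \<odot>\<^bsub>V\<^esub> w | n. n \<le> 0} \<subseteq> ?f ` central_ideal lam mu d"
      unfolding generated_submodule_def gen
      by (rule hull_minimal) (use central_ideal_sug presents_ideal_submodule[OF P left_ideal_central] in auto)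
    show "?f ` central_ideal lam mu d \<subseteq> generated_submodule V {sugawara V n w \<ominus>\<^bsub>V\<^esub> d n \<odot>\<^bsub>V\<^esub> w | n. n \<le> 0}"
      unfolding generated_submodule_def gen hull_def
    proof safe
      fix u N assume u: "u \<in> central_ideal lam mu d" and N: "is_submodule V N"
        "{?f (sug_elt n - uea_scalar (d n)) |n. n \<le> 0} \<subseteq> N"
      note i = presents_submodule_ideal[OF P N(1)]
      have "central_ideal lam mu d \<subseteq> {u. ?f u \<in> N}"
        by (rule central_ideal_minimal) (use i N(2) in auto)
      with u show "?f u \<in> N" by blast
    qed
  qed
qed

lemma presents_whittaker_module:
  "presents (\<lambda>u. whittaker_class lam mu ` central_ideal lam mu (mode_coeff c) +>\<^bsub>universal_whittaker lam mu\<^esub> whittaker_class lam mu u)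
     (central_ideal lam mu (mode_coeff c)) (whittaker_module lam mu c)"
  using presents_quotient[OF presents_universal presents_ideal_submodule[OF presents_universal left_ideal_central], of lam mu lam mu "mode_coeff c"]
  unfolding presents_preimage[OF presents_universal left_ideal_central central_ideal_whittaker]
  by (simp add: whittaker_module_def generated_central)

lemma central_ideal_cong: "(\<And>n. n \<le> 0 \<Longrightarrow> d n = d' n) \<Longrightarrow> central_ideal lam mu d = central_ideal lam mu d'"
  by (intro antisym central_ideal_minimal left_ideal_central central_ideal_whittaker)
    (use central_ideal_sug in metis)+

theorem theorem4p2:
  fixes c c' :: "complex fls" and lam lam' mu mu' :: complex
  assumes "nonpositive_modes c" and "nonpositive_modes c'"
    and "lam \<noteq> 0" and "lam' \<noteq> 0"
  shows
    "simple_module (whittaker_module lam mu c) \<and>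
     (\<forall>N. is_submodule (universal_whittaker lam mu) N \<longrightarrow>
        simple_module (quotient_module (universal_whittaker lam mu) N) \<longrightarrow>
        (\<exists>d. nonpositive_modes d \<and>
           module_iso (quotient_module (universal_whittaker lam mu) N) (whittaker_module lam mu d))) \<and>
     (module_iso (whittaker_module lam mu c) (whittaker_module lam' mu' c') \<longleftrightarrow>
        lam = lam' \<and> mu = mu' \<and> c = c')"
proof (intro conjI allI impI)
  show "simple_module (whittaker_module lam mu c)"
    unfolding presents_simple_iff[OF presents_whittaker_module]
    using central_ideal_proper[OF assms(3)] central_ideal_maximal[OF assms(3)] by blast
next
  fix N
  assume N: "is_submodule (universal_whittaker lam mu) N"
    and simple: "simple_module (quotient_module (universal_whittaker lam mu) N)"
  let ?f = "whittaker_class lam mu"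
  note i = presents_submodule_ideal[OF presents_universal N]
  from simple have max: "1 \<notin> {u. ?f u \<in> N}"
    "\<And>L'. left_ideal L' \<Longrightarrow> {u. ?f u \<in> N} \<subseteq> L' \<Longrightarrow> L' = {u. ?f u \<in> N} \<or> L' = UNIV"
    unfolding presents_simple_iff[OF presents_quotient[OF presents_universal N]] by blast+
  from maximal_ideal_central[OF assms(3) i(1,2) max] obtain a where a: "{u. ?f u \<in> N} = central_ideal lam mu a"
    by blast
  define d :: "complex fls" where "d = fls_shift 2 (fps_to_fls (Abs_fps (\<lambda>k. a (- int k))))"
  have d: "mode_coeff d n = (if n \<le> 0 then a n else 0)" for n
    by (simp add: d_def mode_coeff_def)
  have "{u. ?f u \<in> N} = central_ideal lam mu (mode_coeff d)"
    unfolding a by (rule central_ideal_cong) (simp add: d)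
  then have "N = ?f ` central_ideal lam mu (mode_coeff d)" using i(3) by simp
  then have "quotient_module (universal_whittaker lam mu) N = whittaker_module lam mu d"
    by (simp add: whittaker_module_def generated_central)
  then show "\<exists>d. nonpositive_modes d \<and> module_iso (quotient_module (universal_whittaker lam mu) N) (whittaker_module lam mu d)"
    by (intro exI[of _ d]) (simp add: module_iso_refl nonpositive_modes_def d)
next
  show "module_iso (whittaker_module lam mu c) (whittaker_module lam' mu' c') \<longleftrightarrow> lam = lam' \<and> mu = mu' \<and> c = c'"
  proof
    assume "module_iso (whittaker_module lam mu c) (whittaker_module lam' mu' c')"
    from presents_iso[OF presents_whittaker_module presents_whittaker_module this]
    obtain v0 where v0: "\<And>u. u \<in> central_ideal lam mu (mode_coeff c) \<longleftrightarrow> u * v0 \<in> central_ideal lam' mu' (mode_coeff c')"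
      by blast
    have "v0 \<notin> central_ideal lam' mu' (mode_coeff c')"
      using v0[of 1] central_ideal_proper[OF assms(3)] by simp
    from iso_invariants[OF refl refl this _ assms(3)] v0
    have inv: "lam = lam'" "mu = mu'" "\<And>n. n \<le> 0 \<Longrightarrow> mode_coeff c n = mode_coeff c' n" by blast+
    have "mode_coeff c n = mode_coeff c' n" for n
      using inv(3)[of n] assms(1,2) by (cases "n \<le> 0") (auto simp: nonpositive_modes_def)
    then have "fls_nth c k = fls_nth c' k" for k
      unfolding mode_coeff_def by (metis add.commute diff_add_cancel minus_diff_eq minus_minus uminus_add_conv_diff)
    then have "c = c'" by (intro fls_eqI)
    with inv show "lam = lam' \<and> mu = mu' \<and> c = c'" by blast
  next
    assume "lam = lam' \<and> mu = mu' \<and> c = c'"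
    then show "module_iso (whittaker_module lam mu c) (whittaker_module lam' mu' c')" by (simp add: module_iso_refl)
  qed
qed

end
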